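(* Let $V$ be a non-degenerate space of quasi-polynomials with data $\{n, N_i, n_{ij}, \lambda_i, m, M_a, m_{ab}, z_a\}$ (where $i=1,\dots,n$, $j=1,\dots,N_i$, $a=1,\dots,m$, $b=1,\dots,M_a$), and let $U$ be the space bispectral dual to $V$, i.e. the complex vector space spanned by all functions $$\hat f_a(u)=\int_{\gamma_a}x^u f(x)\,dx,\qquad a=1,\dots,m,\ f\in V^\dagger .$$ Then: (i) $U$ is a non-degenerate space of quasi-exponentials with data $\{m, M_a, m_{ab}, z_a, n, N_i, n_{ij}, \lambda_i+N_i\}$. (ii) Let $D_V=\sum_{i=0}^M\sum_{j=0}^N A_{ij}\,x^i(x\partial_x)^j$, with $A_{ij}\in\mathbb C$, be the regularized fundamental differential operator of $V$. Then $\sum_{i=0}^M\sum_{j=0}^N A_{ij}\,u^j\tau_u^i$ is the regularized fundamental difference operator of $U$.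
   Context: **Quasi-polynomials.** Let $N_1,\dots,N_n$ be positive integers, $N=N_1+\dots+N_n$. For each $i$ let $0<n_{i1}<\dots<n_{iN_i}$ be integers and $p_{ij}\in\mathbb C[x]$ a polynomial of degree $n_{ij}$. Let $\lambda_1,\dots,\lambda_n\in\mathbb C$ with $\lambda_i-\lambda_j\notin\mathbb Z$ for $i\ne j$. The space $V$ spanned by the multivalued functions $x^{\lambda_i}p_{ij}(x)$ is called a space of quasi-polynomials; $\dim V=N$ (branches of $x^{\lambda_i}p_{ij}$ differ by nonzero constant factors). $V$ is *non-degenerate* if for all $i$ and $j=1,\dots,N_i$: there is a linear combination of $p_{i1},\dots,p_{iN_i}$ with a root at $x=0$ of multiplicity exactly $j-1$, and $x^{\lambda_i+n_{ij}}\notin V$. The exponents of $V$ at $z\in\mathbb C^*$ are the unique integers $e_1<\dots<e_N$ such that for each $i$ some $f\in V$ has a root at $z$ of multiplicity $e_i$; $z$ is singular if $\{e_i\}\neq\{0,\dots,N-1\}$. Let $z_1,\dots,z_m$ be all the singular points in $\mathbb C^*$, and write the exponents at $z_a$ as $0<1<\dots<N-M_a-1<N-M_a+m_{a1}<\dots<N-M_a+m_{aM_a}$ with $1\le M_a\le N$, $0<m_{a1}<\dots<m_{aM_a}$. Put $M=M_1+\dots+M_m$. Then $V$ is a space of quasi-polynomials with data $\{n,N_i,n_{ij},\lambda_i,m,M_a,m_{ab},z_a\}$. $\bar D_V$ is the unique monic linear differential operator of order $N$ annihilating $V$, and $D_V=x^N\prod_{a=1}^m(x-z_a)^{M_a}\,\bar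 D_V$ is the regularized fundamental differential operator of $V$; here $\partial_x=d/dx$. For non-degenerate $V$, $D_V$ is a polynomial in $x$ and $x\partial_x$, of degree at most $M$ in $x$ and $N$ in $x\partial_x$. Let $\mathrm{Wr}$ be the Wronskian determinant and $\mathrm{Wr}_V$ the Wronskian of a basis of $V$. $V^\star$ is the span of all $\mathrm{Wr}(f_1,\dots,f_{N-1})/\mathrm{Wr}_V$ with $f_i\in V$, and $V^\dagger=\{f(x)\,x^{-N}\prod_{a=1}^m(x-z_a)^{-M_a}: f\in V^\star\}$ (regularized conjugate space). $\gamma_a$ is a small circle around $z_a$ oriented counterclockwise. An argument of each $z_a$ is fixed; near $z_a$, the function $x^u$ and elements of $V^\dagger$ are computed with the corresponding branch of $\ln x$. **Quasi-exponentials.** $(\tau_uf)(u)=f(u+1)$. For a nonzero complex number $z$ with fixed argument, $z^u=e^{u\ln z}$. Let $z_1,\dots,z_m$ be distinct nonzero complex numbers with fixed arguments, $M_1,\dots,M_m$ positive integers, $M=\sum_aM_a$; for each $a$ let $0<m_{a1}<\dots<m_{aM_a}$ be integers and $q_{ab}\in\mathbb C[u]$ of degree $m_{ab}$. The span $U$ of the functions $z_a^uq_{ab}(u)$ is called a space of quasi-exponentials; $\dim U=M$. The discrete exponents of $U$ at $\lambda\in\mathbb C$ are the unique nonnegative integers $c_1<\dots<c_M$ for which there is a basis $f_1,\dots,f_M$ of $U$ with $f_i(\lambda+j)=0$ for $0\le j\le c_i-1$ and $f_i(\lambda+c_i)\ne0$. Let $\mu_1,\dots,\mu_n\in\mathbb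 C$, $\mu_i-\mu_j\notin\mathbb Z$ for $i\ne j$, be such that the discrete exponents of $U$ at $\mu_i$ are $0<\dots<M-N_i-1<M-N_i+n_{i1}<\dots<M-N_i+n_{iN_i}$ with $1\le N_i\le M$, $0<n_{i1}<\dots<n_{iN_i}$; put $N=\sum_iN_i$. Then $U$ is a space of quasi-exponentials with data $\{m,M_a,m_{ab},z_a,n,N_i,n_{ij},\mu_i\}$. It is *numerically non-degenerate* (with respect to these data) if $\sum_{a,b}(m_{ab}+1-b)=\sum_{i,j}(n_{ij}+1-j)$. The regularized fundamental difference operator of $U$ is the operator $D_U=B_0(u)\tau_u^M+B_1(u)\tau_u^{M-1}+\dots+B_M(u)$ of order $M$ with polynomial coefficients annihilating $U$ such that $B_0$ is monic of minimal possible degree. $U$ with data $\{m,M_a,m_{ab},z_a,n,N_i,n_{ij},\mu_i\}$ is *non-degenerate* if it is numerically non-degenerate and $\deg B_0=N=N_1+\dots+N_n$. *)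

theory Defs
  imports
    "HOL-Complex_Analysis.Complex_Analysis"
    "HOL-Library.Function_Algebras"
    "Jordan_Normal_Form.Determinant"
begin

global_interpretation cfun: vector_space "\<lambda>(c::complex) (f::complex \<Rightarrow> complex) x. c * f x"
  by unfold_locales (auto simp: fun_eq_iff algebra_simps)

definition basis_list :: "(complex \<Rightarrow> complex) set \<Rightarrow> (complex \<Rightarrow> complex) list \<Rightarrow> bool" where
  "basis_list W fs \<longleftrightarrow> distinct fs \<and> cfun.independent (set fs) \<and> cfun.span (set fs) = W"


section \<open>Multivalued functions\<close>

text \<open>
  A multivalued function of \<open>x \<in> \<complex> - {0}\<close> is a function on the universal cover of \<open>\<complex> - {0}\<close>.
  It is written in the global coordinate \<open>w = ln x\<close> of the cover, so that \<open>x = exp w\<close> and the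
  function \<open>x\<close> to the power \<open>\<lambda>\<close> is \<open>exp (\<lambda> * w)\<close>. The points over \<open>x\<close> (that is, the choices of a
  branch of \<open>ln\<close> at \<open>x\<close>) are the \<open>w\<close> with \<open>exp w = x\<close>.
\<close>

text \<open>The derivation \<open>d/dx\<close>, and \<open>x * d/dx\<close>, in the coordinate \<open>w\<close>.\<close>

definition ddx :: "(complex \<Rightarrow> complex) \<Rightarrow> complex \<Rightarrow> complex" where
  "ddx f w = deriv f w / exp w"

definition xddx :: "(complex \<Rightarrow> complex) \<Rightarrow> complex \<Rightarrow> complex" where
  "xddx f w = exp w * ddx f w"

definition Wr :: "(complex \<Rightarrow> complex) list \<Rightarrow> complex \<Rightarrow> complex" where
  "Wr fs w = Determinant.det
     (Matrix.mat (length fs) (length fs) (\<lambda>(i, j). (ddx ^^ i) (fs ! j) w))"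


section \<open>Spaces of quasi-polynomials\<close>

text \<open>All indices start at 1. The common part of the combinatorial data: \<open>K i \<ge> 1\<close> and
  \<open>0 < d i 1 < \<dots> < d i (K i)\<close> for \<open>i = 1, \<dots>, k\<close>.\<close>

definition degree_data :: "nat \<Rightarrow> (nat \<Rightarrow> nat) \<Rightarrow> (nat \<Rightarrow> nat \<Rightarrow> nat) \<Rightarrow> bool" where
  "degree_data k K d \<longleftrightarrow>
     (\<forall>i\<in>{1..k}. 1 \<le> K i \<and> (\<forall>j\<in>{1..K i}. 0 < d i j) \<and> strict_mono_on {1..K i} (d i))"

definition non_resonant :: "nat \<Rightarrow> (nat \<Rightarrow> complex) \<Rightarrow> bool" where
  "non_resonant n lam \<longleftrightarrow> (\<forall>i\<in>{1..n}. \<forall>j\<in>{1..n}. i \<noteq> j \<longrightarrow> lam i - lam j \<notin> \<int>)"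

text \<open>The set of exponents at \<open>x \<noteq> 0\<close>. Since \<open>exp\<close> is locally biholomorphic, the multiplicity
  of a root does not depend on using the coordinate \<open>w\<close> instead of \<open>x\<close>. The spaces below are stable
  under \<open>w \<mapsto> w + 2 * pi * \<i>\<close>, so all points \<open>w\<close> over \<open>x\<close> give the same multiplicities.\<close>

definition exponents :: "(complex \<Rightarrow> complex) set \<Rightarrow> complex \<Rightarrow> nat set" where
  "exponents V x = {e. \<exists>f\<in>V. f \<noteq> (\<lambda>_. 0) \<and> (\<exists>w. exp w = x \<and> zorder f w = int e)}"

definition quasi_polynomials ::
  "(complex \<Rightarrow> complex) set \<Rightarrow> (nat \<Rightarrow> nat \<Rightarrow> complex poly) \<Rightarrow>
   nat \<Rightarrow> (nat \<Rightarrow> nat) \<Rightarrow> (nat \<Rightarrow> nat \<Rightarrow> nat) \<Rightarrow> (nat \<Rightarrow> complex) \<Rightarrow>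
   nat \<Rightarrow> (nat \<Rightarrow> nat) \<Rightarrow> (nat \<Rightarrow> nat \<Rightarrow> nat) \<Rightarrow> (nat \<Rightarrow> complex) \<Rightarrow> bool" where
  "quasi_polynomials V p n N nn lam m M mm z \<longleftrightarrow>
     1 \<le> n \<and> degree_data n N nn \<and> non_resonant n lam \<and>
     (\<forall>i\<in>{1..n}. \<forall>j\<in>{1..N i}. degree (p i j) = nn i j) \<and>
     V = cfun.span {\<lambda>w. exp (lam i * w) * poly (p i j) (exp w) | i j. i \<in> {1..n} \<and> j \<in> {1..N i}} \<and>
     inj_on z {1..m} \<and>
     z ` {1..m} = {x. x \<noteq> 0 \<and> exponents V x \<noteq> {0..<sum N {1..n}}} \<and>
     degree_data m M mm \<and>
     (\<forall>a\<in>{1..m}. M a \<le> sum N {1..n} \<and>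
        exponents V (z a) =
          {0..<sum N {1..n} - M a} \<union> (\<lambda>b. sum N {1..n} - M a + mm a b) ` {1..M a})"

definition nondegenerate_quasi_polynomials ::
  "(complex \<Rightarrow> complex) set \<Rightarrow> (nat \<Rightarrow> nat \<Rightarrow> complex poly) \<Rightarrow>
   nat \<Rightarrow> (nat \<Rightarrow> nat) \<Rightarrow> (nat \<Rightarrow> nat \<Rightarrow> nat) \<Rightarrow> (nat \<Rightarrow> complex) \<Rightarrow> bool" where
  "nondegenerate_quasi_polynomials V p n N nn lam \<longleftrightarrow>
     (\<forall>i\<in>{1..n}. \<forall>j\<in>{1..N i}.
        (\<exists>c. (\<Sum>k=1..N i. Polynomial.smult (c k) (p i k)) \<noteq> 0 \<and>
             Polynomial.order 0 (\<Sum>k=1..N i. Polynomial.smult (c k) (p i k)) = j - 1) \<and>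
        (\<lambda>w. exp ((lam i + of_nat (nn i j)) * w)) \<notin> V)"


section \<open>Fundamental differential operators\<close>

text \<open>The differential operator \<open>b 0 (x) + b 1 (x) * d/dx + \<dots> + b K (x) * (d/dx)^K\<close>.\<close>

definition diff_operator ::
  "nat \<Rightarrow> (nat \<Rightarrow> complex \<Rightarrow> complex) \<Rightarrow> (complex \<Rightarrow> complex) \<Rightarrow> complex \<Rightarrow> complex" where
  "diff_operator K b f w = (\<Sum>k\<le>K. b k (exp w) * (ddx ^^ k) f w)"

text \<open>\<open>b\<close> is the coefficient family of the monic operator of order \<open>K\<close> annihilating \<open>V\<close>. Its
  coefficients are functions on \<open>\<complex> - {0}\<close> without the singular points \<open>S\<close>, where they are unique.\<close>

definition fundamental_diff_operator ::
  "(complex \<Rightarrow> complex) set \<Rightarrow> nat \<Rightarrow> complex set \<Rightarrow> (nat \<Rightarrow> complex \<Rightarrow> complex) \<Rightarrow> bool" where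
  "fundamental_diff_operator V K S b \<longleftrightarrow>
     (\<forall>k\<le>K. b k holomorphic_on (- insert 0 S)) \<and>
     (\<forall>x\<in>- insert 0 S. b K x = 1) \<and>
     (\<forall>f\<in>V. \<forall>w. exp w \<notin> S \<longrightarrow> diff_operator K b f w = 0)"

text \<open>\<open>D\<close> is the regularized fundamental differential operator of \<open>V\<close>. Operators are
  compared away from the singular points and on entire functions of \<open>w\<close>; the latter take on all jets
  at each point, so this is equality of all coefficients.\<close>

definition regularized_diff_operator ::
  "(complex \<Rightarrow> complex) set \<Rightarrow> nat \<Rightarrow> nat \<Rightarrow> (nat \<Rightarrow> nat) \<Rightarrow> (nat \<Rightarrow> complex) \<Rightarrow>
   ((complex \<Rightarrow> complex) \<Rightarrow> complex \<Rightarrow> complex) \<Rightarrow> bool" where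
  "regularized_diff_operator V K m M z D \<longleftrightarrow>
     (\<exists>b. fundamental_diff_operator V K (z ` {1..m}) b \<and>
          (\<forall>f w. f holomorphic_on UNIV \<and> exp w \<notin> z ` {1..m} \<longrightarrow>
             D f w = exp w ^ K * (\<Prod>a=1..m. (exp w - z a) ^ M a) * diff_operator K b f w))"


section \<open>The bispectral dual space\<close>

text \<open>All bases \<open>gs\<close> are allowed in the denominator; their Wronskians are proportional, so the span
  is the same as for a single one. Values at the zeros of the denominator play no role.\<close>

definition conjugate_space ::
  "(complex \<Rightarrow> complex) set \<Rightarrow> nat \<Rightarrow> (complex \<Rightarrow> complex) set" where
  "conjugate_space V K = cfun.span
     {\<lambda>w. Wr fs w / Wr gs w | fs gs. set fs \<subseteq> V \<and> length fs = K - 1 \<and> basis_list V gs}"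

definition regularized_conjugate_space ::
  "(complex \<Rightarrow> complex) set \<Rightarrow> nat \<Rightarrow> nat \<Rightarrow> (nat \<Rightarrow> nat) \<Rightarrow> (nat \<Rightarrow> complex) \<Rightarrow>
   (complex \<Rightarrow> complex) set" where
  "regularized_conjugate_space V K m M z =
     (\<lambda>f w. f w / (exp w ^ K * (\<Prod>a=1..m. (exp w - z a) ^ M a))) ` conjugate_space V K"

text \<open>The branch of \<open>ln\<close> on the disc \<open>ball z (cmod z)\<close> whose value at the centre \<open>z\<close> is \<open>l\<close>.\<close>

definition log_branch :: "complex \<Rightarrow> complex \<Rightarrow> complex \<Rightarrow> complex" where
  "log_branch z l x = l + Ln (x / z)"

text \<open>Radii of admissible small circles around the points \<open>z a\<close>: the branch of \<open>ln\<close> is defined on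
  the closed disc, and \<open>z a\<close> is the only singular point in it.\<close>

definition small_radii :: "nat \<Rightarrow> (nat \<Rightarrow> complex) \<Rightarrow> (nat \<Rightarrow> real) \<Rightarrow> bool" where
  "small_radii m z r \<longleftrightarrow>
     (\<forall>a\<in>{1..m}. 0 < r a \<and> r a < cmod (z a) \<and>
        (\<forall>b\<in>{1..m}. b \<noteq> a \<longrightarrow> r a < dist (z a) (z b)))"

text \<open>\<open>l a\<close> is the value of \<open>ln (z a)\<close> given by the fixed argument of \<open>z a\<close>.\<close>

definition bispectral_dual ::
  "(complex \<Rightarrow> complex) set \<Rightarrow> nat \<Rightarrow> nat \<Rightarrow> (nat \<Rightarrow> nat) \<Rightarrow> (nat \<Rightarrow> complex) \<Rightarrow>
   (nat \<Rightarrow> complex) \<Rightarrow> (nat \<Rightarrow> real) \<Rightarrow> (complex \<Rightarrow> complex) set" where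
  "bispectral_dual V K m M z l r = cfun.span
     {\<lambda>u. contour_integral (circlepath (z a) (r a))
            (\<lambda>x. exp (u * log_branch (z a) (l a) x) * f (log_branch (z a) (l a) x))
      | a f. a \<in> {1..m} \<and> f \<in> regularized_conjugate_space V K m M z}"


section \<open>Spaces of quasi-exponentials\<close>

definition discrete_exponents ::
  "(complex \<Rightarrow> complex) set \<Rightarrow> complex \<Rightarrow> nat list \<Rightarrow> bool" where
  "discrete_exponents U mu cs \<longleftrightarrow> sorted_wrt (<) cs \<and>
     (\<exists>fs. basis_list U fs \<and> length fs = length cs \<and>
        (\<forall>i<length cs. (\<forall>j<cs ! i. (fs ! i) (mu + of_nat j) = 0) \<and>
                       (fs ! i) (mu + of_nat (cs ! i)) \<noteq> 0))"

text \<open>Here \<open>z a\<close> to the power \<open>u\<close> is \<open>exp (u * l a)\<close>, where \<open>l a\<close> is the fixed value of \<open>ln (z a)\<close>.\<close>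

definition quasi_exponentials ::
  "(complex \<Rightarrow> complex) set \<Rightarrow>
   nat \<Rightarrow> (nat \<Rightarrow> nat) \<Rightarrow> (nat \<Rightarrow> nat \<Rightarrow> nat) \<Rightarrow> (nat \<Rightarrow> complex) \<Rightarrow> (nat \<Rightarrow> complex) \<Rightarrow>
   nat \<Rightarrow> (nat \<Rightarrow> nat) \<Rightarrow> (nat \<Rightarrow> nat \<Rightarrow> nat) \<Rightarrow> (nat \<Rightarrow> complex) \<Rightarrow> bool" where
  "quasi_exponentials U m M mm z l n N nn mu \<longleftrightarrow>
     1 \<le> m \<and> 1 \<le> n \<and> degree_data m M mm \<and>
     inj_on z {1..m} \<and> (\<forall>a\<in>{1..m}. z a \<noteq> 0 \<and> exp (l a) = z a) \<and>
     (\<exists>q :: nat \<Rightarrow> nat \<Rightarrow> complex poly.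
        (\<forall>a\<in>{1..m}. \<forall>b\<in>{1..M a}. degree (q a b) = mm a b) \<and>
        U = cfun.span {\<lambda>u. exp (u * l a) * poly (q a b) u | a b. a \<in> {1..m} \<and> b \<in> {1..M a}}) \<and>
     non_resonant n mu \<and> degree_data n N nn \<and>
     (\<forall>i\<in>{1..n}. N i \<le> sum M {1..m} \<and>
        discrete_exponents U (mu i)
          ([0..<sum M {1..m} - N i] @ map (\<lambda>j. sum M {1..m} - N i + nn i j) [1..<Suc (N i)]))"

text \<open>A difference operator \<open>C 0 (u) + C 1 (u) * \<tau> + \<dots> + C K (u) * \<tau>^K\<close> is given by its
  coefficients, indexed by the power of the shift \<open>\<tau>\<close>; thus \<open>C K\<close> is the leading coefficient.\<close>

definition annihilating_difference_operator ::
  "(complex \<Rightarrow> complex) set \<Rightarrow> nat \<Rightarrow> (nat \<Rightarrow> complex poly) \<Rightarrow> bool" where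
  "annihilating_difference_operator U K C \<longleftrightarrow>
     (\<forall>f\<in>U. \<forall>u. (\<Sum>i\<le>K. poly (C i) u * f (u + of_nat i)) = 0)"

definition regularized_difference_operator ::
  "(complex \<Rightarrow> complex) set \<Rightarrow> nat \<Rightarrow> (nat \<Rightarrow> complex poly) \<Rightarrow> bool" where
  "regularized_difference_operator U K C \<longleftrightarrow>
     annihilating_difference_operator U K C \<and> lead_coeff (C K) = 1 \<and>
     (\<forall>C'. annihilating_difference_operator U K C' \<and> lead_coeff (C' K) = 1 \<longrightarrow>
        degree (C K) \<le> degree (C' K))"

definition numerically_nondegenerate ::
  "nat \<Rightarrow> (nat \<Rightarrow> nat) \<Rightarrow> (nat \<Rightarrow> nat \<Rightarrow> nat) \<Rightarrow> nat \<Rightarrow> (nat \<Rightarrow> nat) \<Rightarrow> (nat \<Rightarrow> nat \<Rightarrow> nat) \<Rightarrow> bool" where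
  "numerically_nondegenerate m M mm n N nn \<longleftrightarrow>
     (\<Sum>a=1..m. \<Sum>b=1..M a. int (mm a b) + 1 - int b) =
     (\<Sum>i=1..n. \<Sum>j=1..N i. int (nn i j) + 1 - int j)"

definition nondegenerate_quasi_exponentials ::
  "(complex \<Rightarrow> complex) set \<Rightarrow>
   nat \<Rightarrow> (nat \<Rightarrow> nat) \<Rightarrow> (nat \<Rightarrow> nat \<Rightarrow> nat) \<Rightarrow> nat \<Rightarrow> (nat \<Rightarrow> nat) \<Rightarrow> (nat \<Rightarrow> nat \<Rightarrow> nat) \<Rightarrow> bool" where
  "nondegenerate_quasi_exponentials U m M mm n N nn \<longleftrightarrow>
     numerically_nondegenerate m M mm n N nn \<and>
     (\<exists>C. regularized_difference_operator U (sum M {1..m}) C \<and>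
          degree (C (sum M {1..m})) = sum N {1..n})"

end

theory Submission
  imports
    Defs
    "HOL-Computational_Algebra.Fundamental_Theorem_Algebra"
    "HOL-Combinatorics.Stirling"
begin

text \<open>
  Write \<open>w = ln x\<close>, so that \<open>x d/dx\<close> is the ordinary derivative in \<open>w\<close> and the elements of
  \<open>V\<close> are entire functions of \<open>w\<close>. Everything rests on two explicit facts, the shape of the operator
  annihilating \<open>V\<close> and the integral transform of the conjugate space.

  \<^emph>\<open>The operator.\<close> The Wronskian of the generators \<open>x\<close> to the power \<open>\<lambda>\<^sub>i\<close> times \<open>p\<^sub>i\<^sub>j\<close>, and the
  determinants obtained from it by replacing one row with the derivatives of order \<open>N\<close>, are a common
  power of \<open>x\<close> times polynomials. By Cramer's rule these polynomials are the coefficients of an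
  operator annihilating \<open>V\<close>, the Wronskian being the leading one. Vandermonde determinants in the exponents at infinity and at
  \<open>0\<close> give its exact degree and its exact order at \<open>0\<close>, where the exponents are
  \<open>\<lambda>\<^sub>i, \<dots>, \<lambda>\<^sub>i + N\<^sub>i - 1\<close> by nondegeneracy; its order at a singular point is the sum of the exponents there minus
  \<open>0 + \<dots> + (N - 1)\<close>. Counting zeros proves numerical nondegeneracy. The other determinants vanish at
  \<open>z\<^sub>a\<close> to at least this order minus \<open>M\<^sub>a\<close>, because only \<open>M\<^sub>a\<close> of the exponents exceed their minimal
  values. Dividing by the common factor leaves polynomial coefficients of degree at most \<open>M\<close>, with
  leading one the product of the \<open>(x - z\<^sub>a)\<close> to the power \<open>M\<^sub>a\<close> (\<open>operator_exists\<close>).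

  \<^emph>\<open>The transform.\<close> The conjugate space is spanned by the last column of the inverse of the
  Wronskian matrix of any basis of \<open>V\<close> (\<open>conjugate_space_eq\<close>). With a basis adapted to \<open>z\<^sub>a\<close>, an element
  with exponent \<open>e\<close> gives an element of the regularized conjugate space of order \<open>N - M\<^sub>a - 1 - e\<close> at
  \<open>z\<^sub>a\<close>. So \<open>N - M\<^sub>a\<close> of them are holomorphic and contribute nothing, and the others have poles of order
  \<open>m\<^sub>a\<^sub>b + 1\<close>, whose residue against \<open>x\<close> to the power \<open>u\<close> is \<open>z\<^sub>a\<close> to the power \<open>u\<close> times a polynomial of
  degree \<open>m\<^sub>a\<^sub>b\<close> (\<open>integral_shape\<close>). Let \<open>\<chi>\<^sub>i(u)\<close> be the coefficient of \<open>x\<close> to the power \<open>u + i\<close> in the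
  image of \<open>x\<close> to the power \<open>u\<close> under the operator. Variation of constants shows that this image, times
  an element of the regularized conjugate space, is an exact derivative near \<open>z\<^sub>a\<close>. Integrating over the
  circle gives the recurrence \<open>\<Sum> \<chi>\<^sub>i(u) f(u + i) = 0\<close> on \<open>U\<close> (\<open>integral_recurrence\<close>).

  \<^emph>\<open>Consequences.\<close> The exponents of \<open>V\<close> at infinity and at \<open>0\<close> say that \<open>\<chi>\<^sub>M\<close> is monic with the simple
  zeros \<open>\<lambda>\<^sub>i + n\<^sub>i\<^sub>j\<close>, and that \<open>\<chi>\<^sub>s(\<lambda>\<^sub>i + k) = 0\<close> if \<open>s + k < N\<^sub>i\<close>. Evaluating the recurrence at
  \<open>\<lambda>\<^sub>i + k\<close> shows that the first nonzero value of an element of \<open>U\<close> on \<open>\<lambda>\<^sub>i + N\<^sub>i, \<lambda>\<^sub>i + N\<^sub>i + 1, \<dots>\<close>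
  occurs at one of the \<open>M\<close> prescribed places (\<open>first_nonzero\<close>). As \<open>dim U = M\<close>, all of them occur, by
  interpolation. Finally, a difference operator annihilating \<open>U\<close> of order \<open>M\<close> is proportional to the
  one found. If its leading coefficient had smaller degree, all \<open>\<chi>\<^sub>i\<close> would vanish at some
  \<open>\<lambda>\<^sub>i + n\<^sub>i\<^sub>j\<close>. Then \<open>x\<close> to this power would be annihilated by the operator of \<open>V\<close> and thus lie in
  \<open>V\<close>, which nondegeneracy excludes (\<open>power_not_killed\<close>).
\<close>

section \<open>Determinants of doubly indexed families\<close>

text \<open>Square arrays are indexed by pairs of natural numbers rather than given as matrices, so that
  rows and columns can be replaced, scaled and summed without dimension side conditions.\<close>

definition ndet :: "nat \<Rightarrow> (nat \<Rightarrow> nat \<Rightarrow> 'a::comm_ring_1) \<Rightarrow> 'a" where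
  "ndet n a = Determinant.det (Matrix.mat n n (\<lambda>(i, j). a i j))"

definition ncofactor :: "nat \<Rightarrow> (nat \<Rightarrow> nat \<Rightarrow> 'a::comm_ring_1) \<Rightarrow> nat \<Rightarrow> nat \<Rightarrow> 'a" where
  "ncofactor n a i j = (-1) ^ (i + j) * ndet (n - 1) (\<lambda>r k. a (insert_index i r) (insert_index j k))"

lemma ndet_cong:
  assumes "\<And>i j. i < n \<Longrightarrow> j < n \<Longrightarrow> a i j = b i j"
  shows "ndet n a = ndet n b"
proof -
  have "Matrix.mat n n (\<lambda>(i, j). a i j) = Matrix.mat n n (\<lambda>(i, j). b i j)"
    using assms by (intro Matrix.eq_matI) auto
  thus ?thesis by (simp add: ndet_def)
qed

lemma ndet_leibniz: "ndet n a = (\<Sum>p | p permutes {0..<n}. signof p * (\<Prod>i = 0..<n. a i (p i)))"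
proof -
  have "ndet n a = (\<Sum>p | p permutes {0..<n}.
          signof p * (\<Prod>i = 0..<n. Matrix.mat n n (\<lambda>(i, j). a i j) $$ (i, p i)))"
    unfolding ndet_def by (rule det_def') simp
  also have "\<dots> = (\<Sum>p | p permutes {0..<n}. signof p * (\<Prod>i = 0..<n. a i (p i)))"
  proof (intro sum.cong refl arg_cong2[where f = "(*)"] prod.cong)
    fix p i assume "p \<in> {p. p permutes {0..<n}}" "i \<in> {0..<n}"
    hence "p i < n" "i < n" using permutes_in_image[of p "{0..<n}" i] by auto
    thus "Matrix.mat n n (\<lambda>(i, j). a i j) $$ (i, p i) = a i (p i)" by simp
  qed
  finally show ?thesis .
qed

lemma ndet_transpose: "ndet n (\<lambda>i j. a j i) = ndet n a"
proof -
  have "Matrix.mat n n (\<lambda>(i, j). a j i) = Matrix.transpose_mat (Matrix.mat n n (\<lambda>(i, j). a i j))"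
    by (intro Matrix.eq_matI) auto
  moreover have "Determinant.det (Matrix.transpose_mat (Matrix.mat n n (\<lambda>(i, j). a i j))) =
      Determinant.det (Matrix.mat n n (\<lambda>(i, j). a i j))"
    by (rule Determinant.det_transpose[of _ n]) simp
  ultimately show ?thesis by (simp add: ndet_def)
qed

lemma ndet_mult: "ndet n (\<lambda>i j. \<Sum>k<n. a i k * b k j) = ndet n a * ndet n b"
proof -
  have "Matrix.mat n n (\<lambda>(i, j). \<Sum>k<n. a i k * b k j) =
      Matrix.mat n n (\<lambda>(i, j). a i j) * Matrix.mat n n (\<lambda>(i, j). b i j)"
    by (intro Matrix.eq_matI)
       (auto simp: times_mat_def scalar_prod_def lessThan_atLeast0 intro!: sum.cong)
  thus ?thesis unfolding ndet_def
    by (simp only:) (rule Determinant.det_mult[of _ n]; simp)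
qed

lemma ncofactor_eq: "i < n \<Longrightarrow> j < n \<Longrightarrow> ncofactor n a i j = cofactor (Matrix.mat n n (\<lambda>(i, j). a i j)) i j"
proof -
  assume "i < n" "j < n"
  hence "mat_delete (Matrix.mat n n (\<lambda>(i, j). a i j)) i j =
      Matrix.mat (n - 1) (n - 1) (\<lambda>(r, k). a (insert_index i r) (insert_index j k))"
    unfolding mat_delete_def by (intro Matrix.eq_matI) (auto simp: insert_index_def)
  thus ?thesis by (simp add: ncofactor_def cofactor_def ndet_def)
qed

lemma ncofactor_cong:
  assumes "\<And>r k. r < n \<Longrightarrow> k < n \<Longrightarrow> r \<noteq> i \<Longrightarrow> k \<noteq> j \<Longrightarrow> a r k = b r k" "i < n" "j < n"
  shows "ncofactor n a i j = ncofactor n b i j"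
  unfolding ncofactor_def
proof (intro arg_cong2[where f = "(*)"] refl ndet_cong)
  fix r k assume "r < n - 1" "k < n - 1"
  moreover have "insert_index i r \<noteq> i" "insert_index j k \<noteq> j" by (auto simp: insert_index_def)
  ultimately show "a (insert_index i r) (insert_index j k) = b (insert_index i r) (insert_index j k)"
    using assms(2,3) by (intro assms(1)) (auto simp: insert_index_def)
qed

lemma ndet_expand_row:
  assumes "i < n"
  shows "ndet n (\<lambda>r k. if r = i then y k else a r k) = (\<Sum>k<n. y k * ncofactor n a i k)"
proof -
  let ?b = "\<lambda>r k. if r = i then y k else a r k"
  have "ndet n ?b = (\<Sum>k<n. Matrix.mat n n (\<lambda>(i, j). ?b i j) $$ (i, k) * cofactor (Matrix.mat n n (\<lambda>(i, j). ?b i j)) i k)"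
    unfolding ndet_def by (rule laplace_expansion_row) (use assms in auto)
  also have "\<dots> = (\<Sum>k<n. y k * ncofactor n a i k)"
  proof (intro sum.cong refl)
    fix k assume "k \<in> {..<n}"
    hence k: "k < n" by simp
    have "cofactor (Matrix.mat n n (\<lambda>(i, j). ?b i j)) i k = ncofactor n ?b i k"
      by (rule ncofactor_eq[symmetric]) (use assms k in auto)
    also have "\<dots> = ncofactor n a i k" by (rule ncofactor_cong) (use assms k in auto)
    finally show "Matrix.mat n n (\<lambda>(i, j). ?b i j) $$ (i, k) * cofactor (Matrix.mat n n (\<lambda>(i, j). ?b i j)) i k
        = y k * ncofactor n a i k" using assms k by simp
  qed
  finally show ?thesis .
qed

lemma ncofactor_transpose: "ncofactor n (\<lambda>r k. a k r) i j = ncofactor n a j i"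
  unfolding ncofactor_def by (subst ndet_transpose[symmetric]) (simp add: add.commute)

lemma ndet_expand_col:
  assumes "j < n"
  shows "ndet n (\<lambda>r k. if k = j then y r else a r k) = (\<Sum>r<n. y r * ncofactor n a r j)"
proof -
  have "ndet n (\<lambda>r k. if k = j then y r else a r k) = ndet n (\<lambda>r k. if r = j then y k else a k r)"
    by (subst ndet_transpose[symmetric]) simp
  also have "\<dots> = (\<Sum>r<n. y r * ncofactor n (\<lambda>r k. a k r) j r)" by (rule ndet_expand_row[OF assms])
  finally show ?thesis by (simp add: ncofactor_transpose[of n a])
qed

lemma ndet_adj_row:
  assumes "i < n" "j < n"
  shows "(\<Sum>k<n. a i k * ncofactor n a j k) = (if i = j then ndet n a else 0)"
proof -
  let ?A = "Matrix.mat n n (\<lambda>(i, j). a i j)"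
  have "(?A * adj_mat ?A) $$ (i, j) = (Determinant.det ?A \<cdot>\<^sub>m 1\<^sub>m n) $$ (i, j)"
    by (subst adj_mat(2)[of _ n]) auto
  moreover have "(?A * adj_mat ?A) $$ (i, j) = (\<Sum>k<n. a i k * ncofactor n a j k)"
    using assms by (auto simp: times_mat_def scalar_prod_def adj_mat_def ncofactor_eq lessThan_atLeast0 intro!: sum.cong)
  ultimately show ?thesis using assms by (simp add: ndet_def)
qed

lemma ndet_adj_col:
  assumes "i < n" "j < n"
  shows "(\<Sum>k<n. a k j * ncofactor n a k i) = (if i = j then ndet n a else 0)"
proof -
  have "(\<Sum>k<n. a k j * ncofactor n a k i) = (\<Sum>k<n. a k j * ncofactor n (\<lambda>r k. a k r) i k)"
    by (simp add: ncofactor_transpose[of n a])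
  also have "\<dots> = (if i = j then ndet n a else 0)"
    using ndet_adj_row[of j n i "\<lambda>r k. a k r"] assms by (auto simp: ndet_transpose[of n a])
  finally show ?thesis .
qed

text \<open>Cramer's rule without division: the replaced determinants are \<open>ndet n a\<close> times the
  coordinates of \<open>y\<close> with respect to the rows of \<open>a\<close>. For a Wronskian matrix, with \<open>y\<close> the row of
  derivatives of one order more, this produces a differential equation with holomorphic coefficients.\<close>

lemma ndet_cramer:
  assumes "l < n"
  shows "(\<Sum>j<n. ndet n (\<lambda>r k. if r = j then y k else a r k) * a j l) = ndet n a * y l"
proof -
  have "(\<Sum>j<n. ndet n (\<lambda>r k. if r = j then y k else a r k) * a j l) =
      (\<Sum>j<n. \<Sum>k<n. y k * (a j l * ncofactor n a j k))"
    by (intro sum.cong refl) (simp add: ndet_expand_row sum_distrib_left sum_distrib_right mult_ac)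
  also have "\<dots> = (\<Sum>k<n. y k * (\<Sum>j<n. a j l * ncofactor n a j k))"
    by (subst sum.swap) (simp add: sum_distrib_left)
  also have "\<dots> = (\<Sum>k<n. y k * (if k = l then ndet n a else 0))"
    using assms by (intro sum.cong refl) (simp add: ndet_adj_col)
  also have "\<dots> = (\<Sum>k<n. if k = l then y k * ndet n a else 0)" by (intro sum.cong) auto
  finally show ?thesis using assms by simp
qed

lemma ndet_scale: "ndet n (\<lambda>i j. x i * (a i j * y j)) = (\<Prod>i<n. x i) * ndet n a * (\<Prod>j<n. y j)"
proof -
  have "signof p * (\<Prod>i = 0..<n. x i * (a i (p i) * y (p i))) =
      (\<Prod>i<n. x i) * (signof p * (\<Prod>i = 0..<n. a i (p i))) * (\<Prod>j<n. y j)"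
    if "p permutes {0..<n}" for p
  proof -
    have "(\<Prod>i = 0..<n. y (p i)) = (\<Prod>i = 0..<n. y i)"
      using prod.permute[OF that, of y] by (simp add: comp_def)
    thus ?thesis by (simp add: prod.distrib lessThan_atLeast0 mult_ac)
  qed
  thus ?thesis unfolding ndet_leibniz by (simp add: sum_distrib_left sum_distrib_right)
qed

lemma ndet_zero_kernel:
  fixes a :: "nat \<Rightarrow> nat \<Rightarrow> 'a::field"
  assumes "ndet n a = 0"
  obtains c where "\<And>i. i < n \<Longrightarrow> (\<Sum>j<n. a i j * c j) = 0" "\<exists>j<n. c j \<noteq> 0"
proof -
  let ?A = "Matrix.mat n n (\<lambda>(i, j). a i j)"
  from assms obtain v where v: "v \<in> carrier_vec n" "v \<noteq> 0\<^sub>v n" "?A *\<^sub>v v = 0\<^sub>v n"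
    using det_0_iff_vec_prod_zero_field[of ?A n] by (auto simp: ndet_def)
  show thesis
  proof (rule that[of "\<lambda>j. Matrix.vec_index v j"])
    fix i assume "i < n"
    hence "Matrix.vec_index (?A *\<^sub>v v) i = 0" by (simp add: v(3))
    thus "(\<Sum>j<n. a i j * Matrix.vec_index v j) = 0"
      using \<open>i < n\<close> v(1) by (auto simp: scalar_prod_def lessThan_atLeast0)
  next
    show "\<exists>j<n. Matrix.vec_index v j \<noteq> 0"
      using v(1,2) by (metis Matrix.eq_vecI carrier_vecD index_zero_vec(1,2))
  qed
qed

lemma ndet_zero_left_kernel:
  fixes a :: "nat \<Rightarrow> nat \<Rightarrow> 'a::field"
  assumes "ndet n a = 0"
  obtains c where "\<And>j. j < n \<Longrightarrow> (\<Sum>i<n. c i * a i j) = 0" "\<exists>i<n. c i \<noteq> 0"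
proof -
  have "ndet n (\<lambda>i j. a j i) = 0" using assms by (simp add: ndet_transpose[of n a])
  thus thesis by (elim ndet_zero_kernel) (rule that, auto simp: mult.commute)
qed

lemma ndet_solve:
  fixes a :: "nat \<Rightarrow> nat \<Rightarrow> 'a::field"
  assumes "ndet n a \<noteq> 0"
  obtains x where "\<And>i. i < n \<Longrightarrow> (\<Sum>j<n. a i j * x j) = b i"
proof (rule that[of "\<lambda>j. (\<Sum>k<n. ncofactor n a k j * b k) / ndet n a"])
  fix i assume i: "i < n"
  have "(\<Sum>j<n. a i j * ((\<Sum>k<n. ncofactor n a k j * b k) / ndet n a)) =
     (\<Sum>j<n. \<Sum>k<n. b k * (a i j * ncofactor n a k j)) / ndet n a"
    by (simp add: sum_divide_distrib sum_distrib_left sum_distrib_right mult_ac)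
  also have "\<dots> = (\<Sum>k<n. b k * (\<Sum>j<n. a i j * ncofactor n a k j)) / ndet n a"
    by (subst sum.swap) (simp add: sum_distrib_left)
  also have "(\<Sum>k<n. b k * (\<Sum>j<n. a i j * ncofactor n a k j)) = (\<Sum>k<n. if k = i then b k * ndet n a else 0)"
    using i by (intro sum.cong refl) (auto simp: ndet_adj_row)
  finally show "(\<Sum>j<n. a i j * ((\<Sum>k<n. ncofactor n a k j * b k) / ndet n a)) = b i"
    using i assms by simp
qed

lemma ndet_nonzero_kernel:
  fixes a :: "nat \<Rightarrow> nat \<Rightarrow> 'a::field"
  assumes "ndet n a \<noteq> 0" "\<And>i. i < n \<Longrightarrow> (\<Sum>j<n. a i j * c j) = 0" "l < n"
  shows "c l = 0"
proof -
  have "ndet n a * c l = (\<Sum>j<n. (\<Sum>i<n. a i j * ncofactor n a i l) * c j)"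
  proof -
    have "(\<Sum>j<n. (\<Sum>i<n. a i j * ncofactor n a i l) * c j) = (\<Sum>j<n. if j = l then ndet n a * c l else 0)"
      using assms(3) by (intro sum.cong refl) (auto simp: ndet_adj_col)
    thus ?thesis using assms(3) by simp
  qed
  also have "\<dots> = (\<Sum>i<n. (\<Sum>j<n. a i j * c j) * ncofactor n a i l)"
    unfolding sum_distrib_right by (subst sum.swap) (simp add: mult_ac)
  also have "\<dots> = 0" using assms(2) by simp
  finally show ?thesis using assms(1) by simp
qed

text \<open>Injective square systems are solvable. This replaces dimension arguments for the dual space.\<close>

lemma square_solve:
  fixes a :: "nat \<Rightarrow> nat \<Rightarrow> 'a::field"
  assumes "\<And>c. (\<And>i. i < n \<Longrightarrow> (\<Sum>j<n. a i j * c j) = 0) \<Longrightarrow> (\<forall>j<n. c j = 0)"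
  obtains x where "\<And>i. i < n \<Longrightarrow> (\<Sum>j<n. a i j * x j) = b i"
proof -
  have "ndet n a \<noteq> 0"
  proof
    assume "ndet n a = 0"
    then obtain c where "\<And>i. i < n \<Longrightarrow> (\<Sum>j<n. a i j * c j) = 0" "\<exists>j<n. c j \<noteq> 0"
      by (rule ndet_zero_kernel) blast
    thus False using assms by blast
  qed
  thus thesis by (rule ndet_solve[where b = b]) (rule that)
qed

lemma poly_ndet: "poly (ndet n a) x = ndet n (\<lambda>i j. poly (a i j) x)"
proof -
  have "poly (signof p :: 'a poly) x = signof p" for p by (simp add: sign_def)
  thus ?thesis unfolding ndet_leibniz by (simp add: poly_sum poly_prod)
qed

lemma ndet_holomorphic:
  assumes "\<And>i j. i < n \<Longrightarrow> j < n \<Longrightarrow> (\<lambda>w. a w i j) holomorphic_on S"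
  shows "(\<lambda>w. ndet n (a w)) holomorphic_on S"
  unfolding ndet_leibniz
proof (intro holomorphic_intros)
  fix p i assume "p \<in> {p. p permutes {0..<n}}" "i \<in> {0..<n}"
  hence "p i < n" "i < n" using permutes_in_image[of p "{0..<n}" i] by auto
  thus "(\<lambda>w. a w i (p i)) holomorphic_on S" by (rule assms[rotated])
qed

lemma ndet_lower_unitriangular:
  assumes "\<And>i j. i < j \<Longrightarrow> j < n \<Longrightarrow> a i j = 0" "\<And>i. i < n \<Longrightarrow> a i i = 1"
  shows "ndet n a = 1"
proof -
  have "ndet n a = prod_list (diag_mat (Matrix.mat n n (\<lambda>(i, j). a i j)))"
    unfolding ndet_def by (rule det_lower_triangular[of n]) (use assms(1) in auto)
  also have "diag_mat (Matrix.mat n n (\<lambda>(i, j). a i j)) = map (\<lambda>i. 1) [0..<n]"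
    unfolding diag_mat_def using assms(2) by auto
  finally show ?thesis by (simp add: map_replicate_const)
qed

text \<open>Compare the coefficients at the largest degree that occurs with nonzero weight.\<close>

lemma distinct_degree_independent:
  fixes q :: "'b \<Rightarrow> 'a::idom poly"
  assumes "finite A" "inj_on (\<lambda>k. degree (q k)) A" "\<And>k. k \<in> A \<Longrightarrow> q k \<noteq> 0"
    and "(\<Sum>k\<in>A. Polynomial.smult (c k) (q k)) = 0"
  shows "\<forall>k\<in>A. c k = 0"
proof (rule ccontr)
  assume "\<not> ?thesis"
  hence ne: "{k\<in>A. c k \<noteq> 0} \<noteq> {}" by auto
  define m where "m = Max ((\<lambda>k. degree (q k)) ` {k\<in>A. c k \<noteq> 0})"
  have fin: "finite {k\<in>A. c k \<noteq> 0}" using assms(1) by simp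
  have "m \<in> (\<lambda>k. degree (q k)) ` {k\<in>A. c k \<noteq> 0}"
    unfolding m_def using ne fin by (intro Max_in) auto
  then obtain k where k: "k \<in> A" "c k \<noteq> 0" "degree (q k) = m" by auto
  have small: "degree (q i) < m" if "i \<in> A" "c i \<noteq> 0" "i \<noteq> k" for i
  proof -
    have "degree (q i) \<le> m" unfolding m_def using that fin by (intro Max_ge) auto
    moreover have "degree (q i) \<noteq> m" using that k assms(2) by (auto simp: inj_on_def)
    ultimately show ?thesis by simp
  qed
  have "0 = coeff (\<Sum>k\<in>A. Polynomial.smult (c k) (q k)) m" by (simp add: assms(4))
  also have "\<dots> = (\<Sum>i\<in>A. c i * coeff (q i) m)" by (simp add: coeff_sum)
  also have "\<dots> = (\<Sum>i\<in>A. if i = k then c k * coeff (q k) m else 0)"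
  proof (intro sum.cong refl)
    fix i assume "i \<in> A"
    thus "c i * coeff (q i) m = (if i = k then c k * coeff (q k) m else 0)"
      using small[of i] by (cases "c i = 0") (auto simp: coeff_eq_0)
  qed
  also have "\<dots> = c k * lead_coeff (q k)" using k assms(1) by simp
  finally have "lead_coeff (q k) = 0" using k(2) by simp
  thus False using assms(3)[OF k(1)] by (simp only: leading_coeff_0_iff)
qed

text \<open>A vanishing combination of the rows is a polynomial of degree less than \<open>n\<close> with \<open>n\<close> zeros. With
  \<open>\<phi> r\<close> a power this governs Wronskians at \<open>0\<close> and at infinity, with falling factorials those at
  points of \<open>\<complex> - {0}\<close>.\<close>

lemma generalized_vandermonde:
  fixes \<phi> :: "nat \<Rightarrow> 'a::field poly"
  assumes "\<And>r. r < n \<Longrightarrow> degree (\<phi> r) = r" "\<And>r. r < n \<Longrightarrow> \<phi> r \<noteq> 0"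
    and "inj_on x {..<n}" "\<And>k. k < n \<Longrightarrow> c k \<noteq> 0"
  shows "ndet n (\<lambda>r k. poly (\<phi> r) (x k) * c k) \<noteq> 0"
proof
  assume "ndet n (\<lambda>r k. poly (\<phi> r) (x k) * c k) = 0"
  then obtain v where v: "\<And>k. k < n \<Longrightarrow> (\<Sum>r<n. v r * (poly (\<phi> r) (x k) * c k)) = 0" "\<exists>r<n. v r \<noteq> 0"
    by (rule ndet_zero_left_kernel) blast
  define P where "P = (\<Sum>r<n. Polynomial.smult (v r) (\<phi> r))"
  have "poly P (x k) = 0" if "k < n" for k
  proof -
    have "c k * poly P (x k) = (\<Sum>r<n. v r * (poly (\<phi> r) (x k) * c k))"
      by (simp add: P_def poly_sum sum_distrib_left mult_ac)
    thus ?thesis using v(1)[OF that] assms(4)[OF that] by simp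
  qed
  moreover have "degree P < n" if "n > 0"
    unfolding P_def using assms(1) that
    by (intro le_less_trans[OF degree_sum_le[of _ _ "n - 1"]]) (auto intro: order_trans[OF degree_smult_le])
  moreover have "n > 0" using v(2) by auto
  ultimately have "P = 0"
  proof (rule_tac ccontr)
    assume *: "\<And>k. k < n \<Longrightarrow> poly P (x k) = 0" "0 < n \<Longrightarrow> degree P < n" "n > 0" "P \<noteq> 0"
    have "card (x ` {..<n}) \<le> card {y. poly P y = 0}"
      using * by (intro card_mono poly_roots_finite) auto
    also have "\<dots> \<le> degree P" using * by (intro card_poly_roots_bound) auto
    finally show False using * assms(3) by (simp add: card_image)
  qed
  hence "\<forall>r\<in>{..<n}. v r = 0"
    unfolding P_def using assms(1,2)
    by (intro distinct_degree_independent[of _ \<phi>]) (auto simp: inj_on_def)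
  thus False using v(2) by auto
qed

section \<open>Local orders of entire functions and of Wronskians\<close>

lemma eq_of_eq_off_point:
  fixes f g :: "complex \<Rightarrow> complex"
  assumes "continuous_on UNIV f" "continuous_on UNIV g" "\<And>w. w \<noteq> c \<Longrightarrow> f w = g w"
  shows "f w = g w"
proof (cases "w = c")
  case True
  have "f \<midarrow>c\<rightarrow> f c" "g \<midarrow>c\<rightarrow> g c"
    using assms(1,2) by (auto simp: continuous_on_def)
  moreover have "(f \<longlongrightarrow> g c) (at c)"
    using \<open>g \<midarrow>c\<rightarrow> g c\<close> assms(3) by (subst tendsto_cong[of f g]) (auto simp: eventually_at_filter)
  ultimately have "f c = g c" using tendsto_unique[of "at c" f] by auto
  thus ?thesis using True by simp
qed (use assms in auto)

lemma cancel_power: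
  fixes y h :: "complex \<Rightarrow> complex"
  assumes "continuous_on UNIV y" "continuous_on UNIV h"
    and "\<And>w. (w - c) ^ (a + p) * y w = (w - c) ^ (a + q) * h w"
  shows "(w - c) ^ p * y w = (w - c) ^ q * h w"
proof (rule eq_of_eq_off_point[where c = c and f = "\<lambda>w. (w - c) ^ p * y w" and g = "\<lambda>w. (w - c) ^ q * h w"])
  fix w assume "w \<noteq> c"
  thus "(w - c) ^ p * y w = (w - c) ^ q * h w"
    using assms(3)[of w] by (simp add: power_add)
qed (intro continuous_intros assms)+

lemma entire_continuous: "f holomorphic_on UNIV \<Longrightarrow> continuous_on UNIV f"
  by (rule holomorphic_on_imp_continuous_on)

lemma entire_factorization:
  assumes "f holomorphic_on UNIV" "f \<noteq> (\<lambda>_. 0)"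
  obtains g where "g holomorphic_on UNIV" "g c \<noteq> 0" "\<And>w. f w = (w - c) ^ nat (zorder f c) * g w"
proof -
  let ?d = "nat (zorder f c)" and ?z = "zor_poly f c"
  have nz: "\<exists>w\<in>UNIV. f w \<noteq> 0" using assms(2) by auto
  have "\<exists>r>0. ?z holomorphic_on cball c r \<and> (\<forall>w\<in>cball c r. f w = ?z w * (w - c) ^ ?d \<and> ?z w \<noteq> 0)"
    using zorder_exist_zero[OF assms(1) open_UNIV connected_UNIV UNIV_I nz] by blast
  then obtain r where r: "r > 0" "?z holomorphic_on cball c r"
      "\<And>w. w \<in> cball c r \<Longrightarrow> f w = ?z w * (w - c) ^ ?d \<and> ?z w \<noteq> 0" by blast
  define g where "g = (\<lambda>w. if w \<in> ball c r then ?z w else f w / (w - c) ^ ?d)"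
  have g2: "g w = f w / (w - c) ^ ?d" if "w \<noteq> c" for w
    using that r(3)[of w] by (auto simp: g_def)
  have "g holomorphic_on ball c r"
    by (rule holomorphic_transform[OF holomorphic_on_subset[OF r(2)]]) (auto simp: g_def)
  moreover have "g holomorphic_on (- {c})"
    by (rule holomorphic_transform[of "\<lambda>w. f w / (w - c) ^ ?d"])
       (auto intro!: holomorphic_intros holomorphic_on_subset[OF assms(1)] simp: g2)
  ultimately have "g holomorphic_on (ball c r \<union> - {c})"
    by (intro holomorphic_on_Un) auto
  moreover have "ball c r \<union> - {c} = UNIV" using r(1) by auto
  ultimately have "g holomorphic_on UNIV" by simp
  moreover have "g c \<noteq> 0" using r(3)[of c] r(1) by (simp add: g_def)
  moreover have "f w = (w - c) ^ ?d * g w" for w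
  proof (cases "w = c")
    case True
    thus ?thesis using r(3)[of c] r(1) by (simp add: g_def)
  qed (simp add: g2)
  ultimately show thesis using that by blast
qed

lemma entire_higher_deriv: "f holomorphic_on UNIV \<Longrightarrow> (deriv ^^ r) f holomorphic_on UNIV"
  by (rule holomorphic_higher_deriv) auto

text \<open>The operator \<open>(w - c)\<^sup>r (d/dw)\<^sup>r\<close> multiplies \<open>(w - c)\<^sup>e\<close> by a falling factorial of \<open>e\<close> and
  preserves the order of vanishing. This converts statements about orders of derivatives into
  statements about values at \<open>c\<close>.\<close>

lemma euler_power_local:
  assumes "g holomorphic_on UNIV" "\<And>w. f w = (w - c) ^ e * g w"
  shows "\<exists>h. h holomorphic_on UNIV \<and> (\<forall>w. (w - c) ^ r * (deriv ^^ r) f w = (w - c) ^ e * h w) \<and>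
             h c = (\<Prod>i<r. of_nat e - of_nat i) * g c"
proof (induction r)
  case 0
  show ?case using assms by (intro exI[of _ g]) auto
next
  case (Suc r)
  have f: "f holomorphic_on UNIV"
  proof -
    have "f = (\<lambda>w. (w - c) ^ e * g w)" using assms(2) by auto
    thus ?thesis by (auto intro!: holomorphic_intros assms(1))
  qed
  from Suc obtain h where h: "h holomorphic_on UNIV"
    "\<And>w. (w - c) ^ r * (deriv ^^ r) f w = (w - c) ^ e * h w"
    "h c = (\<Prod>i<r. of_nat e - of_nat i) * g c" by blast
  let ?y = "(deriv ^^ r) f"
  \<comment> \<open>obtained by differentiating the induction hypothesis and multiplying it by \<open>w - c\<close>\<close>
  let ?h = "\<lambda>w. (of_nat e - of_nat r) * h w + (w - c) * deriv h w"
  have "(w - c) ^ Suc r * deriv ?y w = (w - c) ^ e * ?h w" for w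
  proof -
    have d1: "((\<lambda>w. (w - c) ^ r * ?y w) has_field_derivative
        (of_nat r * (w - c) ^ (r - 1)) * ?y w + (w - c) ^ r * deriv ?y w) (at w)"
      using holomorphic_derivI[OF entire_higher_deriv[OF f, of r] open_UNIV, of w]
      by (auto intro!: derivative_eq_intros)
    have d2: "((\<lambda>w. (w - c) ^ e * h w) has_field_derivative
        (of_nat e * (w - c) ^ (e - 1)) * h w + (w - c) ^ e * deriv h w) (at w)"
      using holomorphic_derivI[OF h(1) open_UNIV, of w] by (auto intro!: derivative_eq_intros)
    have "(\<lambda>w. (w - c) ^ r * ?y w) = (\<lambda>w. (w - c) ^ e * h w)" using h(2) by auto
    hence eq: "(of_nat r * (w - c) ^ (r - 1)) * ?y w + (w - c) ^ r * deriv ?y w =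
        (of_nat e * (w - c) ^ (e - 1)) * h w + (w - c) ^ e * deriv h w"
      using DERIV_unique[OF d1] d2 by simp
    have p: "(w - c) * (of_nat k * (w - c) ^ (k - 1)) = of_nat k * (w - c) ^ k" for k
      by (cases k) auto
    have "of_nat r * ((w - c) ^ r * ?y w) + (w - c) ^ Suc r * deriv ?y w =
        (w - c) * ((of_nat r * (w - c) ^ (r - 1)) * ?y w + (w - c) ^ r * deriv ?y w)"
      using p[of r] by (auto simp: distrib_left mult.assoc[symmetric])
    also have "\<dots> = (w - c) * (of_nat e * (w - c) ^ (e - 1)) * h w + (w - c) * ((w - c) ^ e * deriv h w)"
      unfolding eq by (simp add: distrib_left mult.assoc)
    also have "\<dots> = of_nat e * (w - c) ^ e * h w + (w - c) * ((w - c) ^ e * deriv h w)"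
      by (simp only: p)
    finally show ?thesis unfolding h(2) by (simp add: algebra_simps)
  qed
  moreover have "?h holomorphic_on UNIV"
    using h(1) by (auto intro!: holomorphic_intros holomorphic_deriv)
  moreover have "?h c = (\<Prod>i<Suc r. of_nat e - of_nat i) * g c" by (simp add: h(3))
  ultimately show ?case by (intro exI[of _ ?h]) auto
qed

text \<open>The rows are the derivatives of the orders \<open>\<rho> 0, \<dots>, \<rho> (n - 1)\<close> in the coordinate \<open>w = ln x\<close>; the
  Wronskian proper has \<open>\<rho> r = r\<close>. Other choices of \<open>\<rho>\<close> give the coefficients of the operator.\<close>

definition wronskian :: "(nat \<Rightarrow> nat) \<Rightarrow> nat \<Rightarrow> (nat \<Rightarrow> complex \<Rightarrow> complex) \<Rightarrow> complex \<Rightarrow> complex" where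
  "wronskian \<rho> n F w = ndet n (\<lambda>r k. (deriv ^^ \<rho> r) (F k) w)"

lemma wronskian_entire:
  assumes "\<And>k. k < n \<Longrightarrow> F k holomorphic_on UNIV"
  shows "wronskian \<rho> n F holomorphic_on UNIV"
  unfolding wronskian_def using assms by (intro ndet_holomorphic entire_higher_deriv) auto

text \<open>Rows are weighted by \<open>\<sigma>\<close> and columns by \<open>v\<close>. Weights that reflect the actual orders give the exact
  order of the determinant, cruder weights a lower bound.\<close>

lemma wronskian_factor:
  assumes "\<And>r k w. r < n \<Longrightarrow> k < n \<Longrightarrow> (w - c) ^ \<sigma> r * (deriv ^^ \<rho> r) (F k) w = (w - c) ^ v k * h r k w"
  shows "(w - c) ^ (\<Sum>r<n. \<sigma> r) * wronskian \<rho> n F w = (w - c) ^ (\<Sum>k<n. v k) * ndet n (\<lambda>r k. h r k w)"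
proof -
  have "(w - c) ^ (\<Sum>r<n. \<sigma> r) * wronskian \<rho> n F w = ndet n (\<lambda>r k. (w - c) ^ \<sigma> r * ((deriv ^^ \<rho> r) (F k) w * 1))"
    by (subst ndet_scale) (simp add: wronskian_def power_sum)
  also have "\<dots> = ndet n (\<lambda>r k. 1 * (h r k w * (w - c) ^ v k))"
    by (rule ndet_cong) (simp add: assms)
  also have "\<dots> = (w - c) ^ (\<Sum>k<n. v k) * ndet n (\<lambda>r k. h r k w)"
    by (subst ndet_scale) (simp add: power_sum)
  finally show ?thesis .
qed

lemma falling_factorial_poly:
  fixes \<phi> :: "nat \<Rightarrow> complex poly"
  defines "\<phi> \<equiv> \<lambda>r. \<Prod>i<r. [:- of_nat i, 1:]"
  shows "poly (\<phi> r) x = (\<Prod>i<r. x - of_nat i)" "degree (\<phi> r) = r" "lead_coeff (\<phi> r) = 1" "\<phi> r \<noteq> 0"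
proof -
  show "poly (\<phi> r) x = (\<Prod>i<r. x - of_nat i)" by (simp add: \<phi>_def poly_prod)
  show "degree (\<phi> r) = r" unfolding \<phi>_def by (subst degree_prod_eq_sum_degree) auto
  show l: "lead_coeff (\<phi> r) = 1" unfolding \<phi>_def by (subst lead_coeff_prod) auto
  thus "\<phi> r \<noteq> 0" by auto
qed

text \<open>After extracting the powers of \<open>w - c\<close> from rows and columns, the value at \<open>c\<close> of the remaining
  determinant is a Vandermonde determinant of falling factorials in the distinct exponents.\<close>

lemma wronskian_order:
  assumes "\<And>k. k < n \<Longrightarrow> g k holomorphic_on UNIV" "\<And>k. k < n \<Longrightarrow> g k c \<noteq> 0"
    and "\<And>k w. k < n \<Longrightarrow> F k w = (w - c) ^ e k * g k w" "inj_on e {..<n}"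
  obtains B where "B holomorphic_on UNIV" "B c \<noteq> 0" "(\<Sum>r<n. r) \<le> (\<Sum>k<n. e k)"
    "\<And>w. wronskian (\<lambda>r. r) n F w = (w - c) ^ ((\<Sum>k<n. e k) - (\<Sum>r<n. r)) * B w"
proof -
  have "\<forall>r k. \<exists>h. k < n \<longrightarrow> h holomorphic_on UNIV \<and>
      (\<forall>w. (w - c) ^ r * (deriv ^^ r) (F k) w = (w - c) ^ e k * h w) \<and>
      h c = (\<Prod>i<r. of_nat (e k) - of_nat i) * g k c"
    using euler_power_local[OF assms(1,3)] by blast
  then obtain h where h: "\<And>r k. k < n \<Longrightarrow> h r k holomorphic_on UNIV"
      "\<And>r k w. k < n \<Longrightarrow> (w - c) ^ r * (deriv ^^ r) (F k) w = (w - c) ^ e k * h r k w"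
      "\<And>r k. k < n \<Longrightarrow> h r k c = (\<Prod>i<r. of_nat (e k) - of_nat i) * g k c"
    by metis
  define B where "B = (\<lambda>w. ndet n (\<lambda>r k. h r k w))"
  have B: "B holomorphic_on UNIV" unfolding B_def using h(1) by (intro ndet_holomorphic) auto
  have Fh: "F k holomorphic_on UNIV" if "k < n" for k
  proof -
    have "F k = (\<lambda>w. (w - c) ^ e k * g k w)" using assms(3) that by auto
    thus ?thesis using assms(1)[OF that] by (auto intro!: holomorphic_intros)
  qed
  have W: "wronskian (\<lambda>r. r) n F holomorphic_on UNIV" by (rule wronskian_entire[OF Fh])
  have Bc: "B c \<noteq> 0"
  proof -
    have "B c = ndet n (\<lambda>r k. poly (\<Prod>i<r. [:- of_nat i, 1:]) (of_nat (e k)) * g k c)"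
      unfolding B_def by (rule ndet_cong) (simp add: h(3) falling_factorial_poly)
    also have "\<dots> \<noteq> 0"
      using assms(2,4) by (intro generalized_vandermonde) (auto simp: falling_factorial_poly inj_on_def)
    finally show ?thesis .
  qed
  have eq: "(w - c) ^ (\<Sum>r<n. r) * wronskian (\<lambda>r. r) n F w = (w - c) ^ (\<Sum>k<n. e k) * B w" for w
    unfolding B_def by (rule wronskian_factor) (simp add: h(2))
  \<comment> \<open>otherwise \<open>B\<close> would be divisible by \<open>w - c\<close>\<close>
  have le: "(\<Sum>r<n. r) \<le> (\<Sum>k<n. e k)"
  proof (rule ccontr)
    assume "\<not> ?thesis"
    then obtain p where p: "(\<Sum>r<n. r) = (\<Sum>k<n. e k) + Suc p"
      using less_iff_Suc_add by (metis not_le add_Suc_right)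
    have "(w - c) ^ Suc p * wronskian (\<lambda>r. r) n F w = (w - c) ^ 0 * B w" for w
      by (rule cancel_power[where a = "\<Sum>k<n. e k"])
         (use W B eq p in \<open>auto intro: entire_continuous simp del: power_Suc\<close>)
    from this[of c] Bc show False by simp
  qed
  have "(w - c) ^ 0 * wronskian (\<lambda>r. r) n F w = (w - c) ^ ((\<Sum>k<n. e k) - (\<Sum>r<n. r)) * B w" for w
    by (rule cancel_power[where a = "\<Sum>r<n. r"])
       (use W B eq le in \<open>auto intro: entire_continuous\<close>)
  thus thesis using that[OF B Bc le] by simp
qed

lemma higher_deriv_lincomb:
  assumes "finite A" "\<And>k. k \<in> A \<Longrightarrow> F k holomorphic_on UNIV"
  shows "(deriv ^^ r) (\<lambda>w. \<Sum>k\<in>A. c k * F k w) = (\<lambda>w. \<Sum>k\<in>A. c k * (deriv ^^ r) (F k) w)"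
proof (induction r)
  case (Suc r)
  have "deriv (\<lambda>w. \<Sum>k\<in>A. c k * (deriv ^^ r) (F k) w) w = (\<Sum>k\<in>A. c k * deriv ((deriv ^^ r) (F k)) w)" for w
    by (rule DERIV_imp_deriv)
       (auto intro!: derivative_eq_intros holomorphic_derivI[OF entire_higher_deriv[OF assms(2)] open_UNIV] sum.cong)
  thus ?case using Suc by auto
qed simp

lemma wronskian_lincomb:
  assumes "\<And>k. k < n \<Longrightarrow> F k holomorphic_on UNIV" "\<And>k. k < n \<Longrightarrow> G k = (\<lambda>w. \<Sum>l<n. c l k * F l w)"
  shows "wronskian \<rho> n G w = wronskian \<rho> n F w * ndet n c"
proof -
  have "wronskian \<rho> n G w = ndet n (\<lambda>r k. \<Sum>l<n. (deriv ^^ \<rho> r) (F l) w * c l k)"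
    unfolding wronskian_def
  proof (rule ndet_cong)
    fix r k assume "r < n" "k < n"
    have "(deriv ^^ \<rho> r) (G k) = (\<lambda>w. \<Sum>l<n. c l k * (deriv ^^ \<rho> r) (F l) w)"
      unfolding assms(2)[OF \<open>k < n\<close>] by (rule higher_deriv_lincomb) (use assms(1) in auto)
    thus "(deriv ^^ \<rho> r) (G k) w = (\<Sum>l<n. (deriv ^^ \<rho> r) (F l) w * c l k)"
      by (simp add: mult.commute)
  qed
  thus ?thesis by (simp add: ndet_mult wronskian_def)
qed

text \<open>If \<open>y\<close> had a zero of finite order \<open>d \<ge> N\<close> at \<open>c\<close>, multiplying the equation by \<open>(w - c)\<^sup>N\<close> would
  leave only the term of order \<open>N\<close> in the leading coefficient at \<open>c\<close>, which is \<open>a N c\<close> times a falling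
  factorial of \<open>d\<close> times the leading coefficient of \<open>y\<close>, and thus nonzero.\<close>

lemma linear_ode_unique:
  assumes "\<And>j. j \<le> N \<Longrightarrow> continuous_on UNIV (a j)" "a N c \<noteq> 0" "y holomorphic_on UNIV"
    and "\<And>w. (\<Sum>j\<le>N. a j w * (deriv ^^ j) y w) = 0" "\<And>j. j < N \<Longrightarrow> (deriv ^^ j) y c = 0"
  shows "y = (\<lambda>_. 0)"
proof (rule ccontr)
  assume "y \<noteq> (\<lambda>_. 0)"
  obtain g where g0: "g holomorphic_on UNIV" "g c \<noteq> 0" "\<And>w. y w = (w - c) ^ nat (zorder y c) * g w"
    by (rule entire_factorization[OF assms(3) \<open>y \<noteq> _\<close>, of c]) (rule that)
  define d where "d = nat (zorder y c)"
  note g = g0[folded d_def]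
  from euler_power_local[OF g(1,3)] obtain h where h: "\<And>r. h r holomorphic_on UNIV"
      "\<And>r w. (w - c) ^ r * (deriv ^^ r) y w = (w - c) ^ d * h r w"
      "\<And>r. h r c = (\<Prod>i<r. of_nat d - of_nat i) * g c" by metis
  have hne: "h r c \<noteq> 0" if "r \<le> d" for r
    using that g(2) by (auto simp: h(3))
  have dN: "N \<le> d"
  proof (rule ccontr)
    assume "\<not> N \<le> d"
    have "(w - c) ^ 0 * (deriv ^^ d) y w = (w - c) ^ 0 * h d w" for w
      by (rule cancel_power[where a = d])
         (use h entire_higher_deriv[OF assms(3)] in \<open>auto intro!: entire_continuous\<close>)
    from this[of c] hne[of d] assms(5)[of d] \<open>\<not> N \<le> d\<close> show False by simp
  qed
  define R where "R = (\<lambda>w. \<Sum>j\<le>N. a j w * ((w - c) ^ (N - j) * h j w))"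
  have cR: "continuous_on UNIV R" unfolding R_def
    by (intro continuous_intros assms entire_continuous h(1)) auto
  have "(w - c) ^ 0 * (\<lambda>_. 0) w = (w - c) ^ 0 * R w" for w
  proof (rule cancel_power[where a = d])
    fix w
    have "(w - c) ^ d * R w = (\<Sum>j\<le>N. a j w * ((w - c) ^ (N - j) * ((w - c) ^ d * h j w)))"
      by (simp add: R_def sum_distrib_left mult_ac)
    also have "\<dots> = (\<Sum>j\<le>N. (w - c) ^ N * (a j w * (deriv ^^ j) y w))"
    proof (intro sum.cong refl)
      fix j assume "j \<in> {..N}"
      hence "(w - c) ^ (N - j) * (w - c) ^ j = (w - c) ^ N" by (simp flip: power_add)
      thus "a j w * ((w - c) ^ (N - j) * ((w - c) ^ d * h j w)) = (w - c) ^ N * (a j w * (deriv ^^ j) y w)"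
        unfolding h(2)[symmetric] by (metis mult.assoc mult.commute)
    qed
    also have "\<dots> = 0" by (simp flip: sum_distrib_left add: assms(4))
    finally show "(w - c) ^ (d + 0) * 0 = (w - c) ^ (d + 0) * R w" by simp
  qed (use cR in auto)
  from this[of c] have "R c = 0" by simp
  moreover have "R c = (\<Sum>j\<le>N. if j = N then a N c * h N c else 0)"
    unfolding R_def by (intro sum.cong) auto
  ultimately show False using hne[OF dN] assms(2) by simp
qed

section \<open>Quasi-monomials\<close>

text \<open>The action of \<open>x d/dx\<close> on \<open>p\<close> when \<open>p\<close> is multiplied by \<open>x\<close> to the power \<open>L\<close>.\<close>

definition twisted_theta :: "complex \<Rightarrow> complex poly \<Rightarrow> complex poly" where
  "twisted_theta L p = Polynomial.smult L p + pCons 0 (pderiv p)"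

lemma coeff_twisted_theta: "coeff (twisted_theta L p) s = (L + of_nat s) * coeff p s"
  by (cases s) (auto simp: twisted_theta_def coeff_pderiv algebra_simps)

lemma coeff_twisted_theta_iter: "coeff ((twisted_theta L ^^ r) p) s = (L + of_nat s) ^ r * coeff p s"
  by (induction r) (auto simp: coeff_twisted_theta)

lemma degree_twisted_theta_iter: "degree p \<le> d \<Longrightarrow> degree ((twisted_theta L ^^ r) p) \<le> d"
  by (rule degree_le) (auto simp: coeff_twisted_theta_iter coeff_eq_0)

definition quasi_monomial :: "complex \<Rightarrow> complex poly \<Rightarrow> complex \<Rightarrow> complex" where
  "quasi_monomial L p w = exp (L * w) * poly p (exp w)"

lemma quasi_monomial_entire: "quasi_monomial L p holomorphic_on UNIV"
  unfolding quasi_monomial_def by (auto intro!: holomorphic_intros simp: poly_altdef)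

lemma deriv_quasi_monomial: "deriv (quasi_monomial L p) = quasi_monomial L (twisted_theta L p)"
proof
  fix w
  have "((\<lambda>w. exp (L * w) * poly p (exp w)) has_field_derivative
      exp (L * w) * (L * poly p (exp w) + exp w * poly (pderiv p) (exp w))) (at w)"
    by (auto intro!: derivative_eq_intros DERIV_chain2[OF poly_DERIV] simp: algebra_simps)
  thus "deriv (quasi_monomial L p) w = quasi_monomial L (twisted_theta L p) w"
    unfolding quasi_monomial_def twisted_theta_def by (simp add: DERIV_imp_deriv)
qed

lemma higher_deriv_quasi_monomial: "(deriv ^^ r) (quasi_monomial L p) = quasi_monomial L ((twisted_theta L ^^ r) p)"
  by (induction r) (auto simp: deriv_quasi_monomial)

text \<open>The exponential factors depend only on the column, so that every generalized Wronskian is one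
  exponential times a polynomial in \<open>x = exp w\<close>.\<close>

lemma wronskian_quasi_monomial:
  "wronskian \<rho> n (\<lambda>k. quasi_monomial (L k) (P k)) w =
     exp ((\<Sum>k<n. L k) * w) * poly (ndet n (\<lambda>r k. (twisted_theta (L k) ^^ \<rho> r) (P k))) (exp w)"
proof -
  have "wronskian \<rho> n (\<lambda>k. quasi_monomial (L k) (P k)) w =
      ndet n (\<lambda>r k. 1 * (poly ((twisted_theta (L k) ^^ \<rho> r) (P k)) (exp w) * exp (L k * w)))"
    unfolding wronskian_def by (rule ndet_cong) (simp add: higher_deriv_quasi_monomial quasi_monomial_def)
  also have "\<dots> = ndet n (\<lambda>r k. poly ((twisted_theta (L k) ^^ \<rho> r) (P k)) (exp w)) * (\<Prod>k<n. exp (L k * w))"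
    by (subst ndet_scale) simp
  also have "(\<Prod>k<n. exp (L k * w)) = exp ((\<Sum>k<n. L k) * w)"
    by (simp add: exp_sum sum_distrib_right)
  finally show ?thesis by (simp add: poly_ndet mult.commute)
qed

lemma coeff_mult_top:
  fixes p q :: "'a::comm_ring_1 poly"
  assumes "degree p \<le> a" "degree q \<le> b"
  shows "coeff (p * q) (a + b) = coeff p a * coeff q b"
proof -
  have "coeff (p * q) (a + b) = (\<Sum>i\<le>a+b. if i = a then coeff p a * coeff q b else 0)"
    unfolding coeff_mult
  proof (intro sum.cong refl)
    fix i assume i: "i \<in> {..a+b}"
    consider "i = a" | "i < a" | "i > a" by linarith
    thus "coeff p i * coeff q (a + b - i) = (if i = a then coeff p a * coeff q b else 0)"
    proof cases
      assume "i < a"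
      hence "degree q < a + b - i" using assms(2) by simp
      thus ?thesis using \<open>i < a\<close> by (simp add: coeff_eq_0)
    next
      assume "i > a"
      hence "degree p < i" using assms(1) by simp
      thus ?thesis using \<open>i > a\<close> by (simp add: coeff_eq_0)
    qed auto
  qed
  thus ?thesis by simp
qed

lemma coeff_prod_top:
  fixes q :: "'b \<Rightarrow> 'a::comm_ring_1 poly"
  assumes "finite A" "\<And>i. i \<in> A \<Longrightarrow> degree (q i) \<le> d i"
  shows "degree (\<Prod>i\<in>A. q i) \<le> (\<Sum>i\<in>A. d i) \<and> coeff (\<Prod>i\<in>A. q i) (\<Sum>i\<in>A. d i) = (\<Prod>i\<in>A. coeff (q i) (d i))"
  using assms
proof (induction A rule: finite_induct)
  case (insert x A)
  hence IH: "degree (\<Prod>i\<in>A. q i) \<le> (\<Sum>i\<in>A. d i)"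
    "coeff (\<Prod>i\<in>A. q i) (\<Sum>i\<in>A. d i) = (\<Prod>i\<in>A. coeff (q i) (d i))" by auto
  have "degree (q x) \<le> d x" using insert by simp
  thus ?case using insert IH
    by (auto simp: coeff_mult_top intro: order_trans[OF degree_mult_le] add_mono)
qed auto

text \<open>The degree bound depends only on the column, hence every term of the determinant has the same
  formal degree and the top coefficients form a determinant again.\<close>

lemma ndet_top_coeff:
  fixes a :: "nat \<Rightarrow> nat \<Rightarrow> 'a::comm_ring_1 poly"
  assumes "\<And>r k. r < n \<Longrightarrow> k < n \<Longrightarrow> degree (a r k) \<le> d k"
  shows "degree (ndet n a) \<le> (\<Sum>k<n. d k)" "coeff (ndet n a) (\<Sum>k<n. d k) = ndet n (\<lambda>r k. coeff (a r k) (d k))"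
proof -
  have *: "degree (\<Prod>i = 0..<n. a i (p i)) \<le> (\<Sum>k<n. d k)"
    "coeff (\<Prod>i = 0..<n. a i (p i)) (\<Sum>k<n. d k) = (\<Prod>i = 0..<n. coeff (a i (p i)) (d (p i)))"
    if p: "p permutes {0..<n}" for p
  proof -
    have "degree (a i (p i)) \<le> d (p i)" if "i \<in> {0..<n}" for i
      using assms[of i "p i"] that permutes_in_image[OF p, of i] by auto
    note c = coeff_prod_top[of "{0..<n}" "\<lambda>i. a i (p i)" "\<lambda>i. d (p i)", OF _ this]
    have "(\<Sum>i = 0..<n. d (p i)) = (\<Sum>k<n. d k)"
      using sum.permute[OF p, of d] by (simp add: comp_def lessThan_atLeast0)
    with c show "degree (\<Prod>i = 0..<n. a i (p i)) \<le> (\<Sum>k<n. d k)"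
      "coeff (\<Prod>i = 0..<n. a i (p i)) (\<Sum>k<n. d k) = (\<Prod>i = 0..<n. coeff (a i (p i)) (d (p i)))"
      by auto
  qed
  have sg: "(signof p :: 'a poly) = [:signof p:]" for p
    by (simp add: sign_def one_pCons)
  show "degree (ndet n a) \<le> (\<Sum>k<n. d k)"
    unfolding ndet_leibniz sg using *(1)
    by (intro degree_sum_le) (auto intro: order_trans[OF degree_smult_le] simp: finite_permutations)
  show "coeff (ndet n a) (\<Sum>k<n. d k) = ndet n (\<lambda>r k. coeff (a r k) (d k))"
    unfolding ndet_leibniz sg using *(2) by (simp add: coeff_sum)
qed

text \<open>The counterpart at \<open>x = 0\<close>: a power of \<open>x\<close> comes out of each column.\<close>

lemma ndet_low_coeff:
  fixes a :: "nat \<Rightarrow> nat \<Rightarrow> 'a::idom poly"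
  assumes "\<And>r k s. r < n \<Longrightarrow> k < n \<Longrightarrow> s < d k \<Longrightarrow> coeff (a r k) s = 0"
  obtains q where "ndet n a = monom 1 (\<Sum>k<n. d k) * q" "poly q 0 = ndet n (\<lambda>r k. coeff (a r k) (d k))"
proof -
  have "\<exists>q. r < n \<longrightarrow> k < n \<longrightarrow> a r k = monom 1 (d k) * q" for r k
  proof (cases "r < n \<and> k < n")
    case True
    hence "monom 1 (d k) dvd a r k" using assms by (simp add: monom_1_dvd_iff')
    thus ?thesis by (auto elim: dvdE)
  qed auto
  then obtain b where b: "\<And>r k. r < n \<Longrightarrow> k < n \<Longrightarrow> a r k = monom 1 (d k) * b r k" by metis
  show thesis
  proof (rule that)
    have "ndet n a = ndet n (\<lambda>r k. 1 * (b r k * monom 1 (d k)))" by (rule ndet_cong) (simp add: b)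
    also have "\<dots> = ndet n b * (\<Prod>k<n. monom 1 (d k))" by (subst ndet_scale) simp
    also have "(\<Prod>k<n. monom 1 (d k)) = (monom 1 (\<Sum>k<n. d k) :: 'a poly)"
      by (induction n) (auto simp: mult_monom)
    finally show "ndet n a = monom 1 (\<Sum>k<n. d k) * ndet n b" by (simp add: mult.commute)
    show "poly (ndet n b) 0 = ndet n (\<lambda>r k. coeff (a r k) (d k))"
      unfolding poly_ndet by (rule ndet_cong) (simp add: b poly_0_coeff_0 coeff_monom_mult)
  qed
qed

section \<open>Finite spans, and polynomials in an exponential\<close>

lemma sum_fun_apply: "(\<Sum>k\<in>A. f k) w = (\<Sum>k\<in>A. f k w)" for f :: "'a \<Rightarrow> complex \<Rightarrow> complex"
  by (induction A rule: infinite_finite_induct) auto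

lemma span_image_eq:
  assumes "finite A"
  shows "cfun.span (F ` A) = {f. \<exists>c. f = (\<lambda>w. \<Sum>k\<in>A. c k * F k w)}" (is "_ = ?R")
proof
  show "?R \<subseteq> cfun.span (F ` A)"
  proof safe
    fix c
    have "(\<lambda>w. \<Sum>k\<in>A. c k * F k w) = (\<Sum>k\<in>A. (\<lambda>w. c k * F k w))"
      by (rule ext) (simp add: sum_fun_apply)
    also have "\<dots> \<in> cfun.span (F ` A)"
      by (intro cfun.span_sum cfun.span_scale cfun.span_base) auto
    finally show "(\<lambda>w. \<Sum>k\<in>A. c k * F k w) \<in> cfun.span (F ` A)" .
  qed
  show "cfun.span (F ` A) \<subseteq> ?R"
  proof (rule cfun.span_minimal)
    show "F ` A \<subseteq> ?R"
    proof safe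
      fix k assume "k \<in> A"
      have "F k = (\<lambda>w. \<Sum>i\<in>A. (if i = k then 1 else 0) * F i w)"
      proof
        fix w
        have "(\<Sum>i\<in>A. (if i = k then 1 else 0) * F i w) = (\<Sum>i\<in>A. if i = k then F i w else 0)"
          by (intro sum.cong) auto
        thus "F k w = (\<Sum>i\<in>A. (if i = k then 1 else 0) * F i w)"
          using \<open>k \<in> A\<close> assms by simp
      qed
      thus "\<exists>c. F k = (\<lambda>w. \<Sum>k\<in>A. c k * F k w)" by (rule exI[of _ "\<lambda>i. if i = k then 1 else 0"])
    qed
    show "cfun.subspace ?R"
    proof (rule cfun.subspaceI)
      show "0 \<in> ?R" by (auto intro!: exI[of _ "\<lambda>_. 0"])
    next
      fix x y assume "x \<in> ?R" "y \<in> ?R"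
      then obtain c d where "x = (\<lambda>w. \<Sum>k\<in>A. c k * F k w)" "y = (\<lambda>w. \<Sum>k\<in>A. d k * F k w)" by auto
      thus "x + y \<in> ?R"
        by (auto intro!: exI[of _ "\<lambda>k. c k + d k"] simp: distrib_right sum.distrib)
    next
      fix s x assume "x \<in> ?R"
      then obtain c where "x = (\<lambda>w. \<Sum>k\<in>A. c k * F k w)" by auto
      thus "(\<lambda>w. s * x w) \<in> ?R"
        by (auto intro!: exI[of _ "\<lambda>k. s * c k"] simp: sum_distrib_left mult_ac)
    qed
  qed
qed

lemma basis_listI:
  assumes "\<And>c. (\<And>w. (\<Sum>k<n. c k * f k w) = 0) \<Longrightarrow> \<forall>k<n. c k = 0"
    and "U = {g. \<exists>c. g = (\<lambda>w. \<Sum>k<n. c k * f k w)}"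
  shows "basis_list U (map f [0..<n])"
proof -
  have inj: "inj_on f {..<n}"
  proof (rule inj_onI, rule ccontr)
    fix i j assume ij: "i \<in> {..<n}" "j \<in> {..<n}" "f i = f j" "i \<noteq> j"
    have "(\<Sum>k<n. (if k = i then 1 else if k = j then -1 else 0) * f k w) = 0" for w
    proof -
      have "(\<Sum>k<n. (if k = i then 1 else if k = j then -1 else 0) * f k w) =
          (\<Sum>k<n. (if k = i then f i w else 0) + (if k = j then - f j w else 0))"
        using ij by (intro sum.cong) auto
      also have "\<dots> = 0" using ij by (simp add: sum.distrib)
      finally show ?thesis .
    qed
    from assms(1)[OF this] ij show False by auto
  qed
  have st: "set (map f [0..<n]) = f ` {..<n}" by (auto simp: lessThan_atLeast0)
  have "\<not> cfun.dependent (f ` {..<n})"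
  proof
    assume "cfun.dependent (f ` {..<n})"
    then obtain u v where u: "v \<in> f ` {..<n}" "u v \<noteq> 0" "(\<Sum>v\<in>f ` {..<n}. (\<lambda>w. u v * v w)) = 0"
      by (subst (asm) cfun.dependent_finite) auto
    have "(\<Sum>k<n. u (f k) * f k w) = 0" for w
    proof -
      have "(\<Sum>v\<in>f ` {..<n}. (\<lambda>w. u v * v w)) w = 0" by (subst u(3)) simp
      thus ?thesis by (simp add: sum_fun_apply sum.reindex[OF inj])
    qed
    from assms(1)[OF this] u show False by auto
  qed
  moreover have "distinct (map f [0..<n])" using inj by (simp add: distinct_map lessThan_atLeast0)
  moreover have "cfun.span (f ` {..<n}) = U" unfolding assms(2) by (rule span_image_eq) simp
  ultimately show ?thesis unfolding basis_list_def st by blast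
qed

lemma basis_listD:
  assumes "basis_list U gs"
  shows "U = {g. \<exists>c. g = (\<lambda>w. \<Sum>k<length gs. c k * (gs ! k) w)}"
    and "\<And>c. (\<And>w. (\<Sum>k<length gs. c k * (gs ! k) w) = 0) \<Longrightarrow> \<forall>k<length gs. c k = 0"
proof -
  have st: "set gs = (!) gs ` {..<length gs}" by (metis map_nth set_map set_upt lessThan_atLeast0)
  have inj: "inj_on ((!) gs) {..<length gs}"
    using assms by (auto simp: basis_list_def inj_on_def nth_eq_iff_index_eq)
  have "U = cfun.span ((!) gs ` {..<length gs})" using assms st by (simp add: basis_list_def)
  also have "\<dots> = {g. \<exists>c. g = (\<lambda>w. \<Sum>k<length gs. c k * (gs ! k) w)}"
    by (rule span_image_eq) simp
  finally show "U = {g. \<exists>c. g = (\<lambda>w. \<Sum>k<length gs. c k * (gs ! k) w)}" .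
  fix c assume c: "\<And>w. (\<Sum>k<length gs. c k * (gs ! k) w) = 0"
  define u where "u = (\<lambda>v. c (the_inv_into {..<length gs} ((!) gs) v))"
  have u: "u (gs ! k) = c k" if "k < length gs" for k
    using that inj by (simp add: u_def the_inv_into_f_f)
  have "(\<Sum>v\<in>set gs. (\<lambda>w. u v * v w)) = 0"
    unfolding st by (rule ext) (simp add: sum.reindex[OF inj] sum_fun_apply u c)
  hence "\<forall>v\<in>set gs. u v = 0"
    using assms cfun.independentD[of "set gs" "set gs" u] by (auto simp: basis_list_def)
  thus "\<forall>k<length gs. c k = 0" using u by force
qed

lemma basis_list_length:
  assumes "basis_list U gs" "basis_list U hs"
  shows "length gs = length hs"
proof -
  have "cfun.dim (set gs) = card (set gs)" "cfun.dim (set gs) = card (set hs)"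
    using assms by (intro cfun.dim_eq_card; simp add: basis_list_def)+
  thus ?thesis using assms by (simp add: basis_list_def distinct_card)
qed

text \<open>The local coordinates \<open>x - exp c\<close> and \<open>w - c\<close> differ by a factor that is nonzero at \<open>c\<close>.\<close>

lemma exp_minus_exp_factor:
  obtains \<psi> where "\<psi> holomorphic_on UNIV" "\<psi> c \<noteq> 0" "\<And>w. exp w - exp c = (w - c) * \<psi> w"
proof -
  have ne: "(\<lambda>w. exp w - exp c) \<noteq> (\<lambda>_. 0)"
  proof
    assume "(\<lambda>w. exp w - exp c) = (\<lambda>_. 0)"
    from fun_cong[OF this, of "c + 1"] have "exp (1::complex) = 1" by (simp add: exp_add)
    thus False by (simp add: exp_eq_1)
  qed
  have hol: "(\<lambda>w. exp w - exp c) holomorphic_on UNIV" by (intro holomorphic_intros)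
  obtain \<psi> where \<psi>: "\<psi> holomorphic_on UNIV" "\<psi> c \<noteq> 0"
      "\<And>w. exp w - exp c = (w - c) ^ nat (zorder (\<lambda>w. exp w - exp c) c) * \<psi> w"
    by (rule entire_factorization[OF hol ne, of c]) (rule that)
  define d where "d = nat (zorder (\<lambda>w. exp w - exp c) c)"
  have eq: "(\<lambda>w. exp w - exp c) = (\<lambda>w. (w - c) ^ d * \<psi> w)"
    by (rule ext) (rule \<psi>(3)[folded d_def])
  have "d \<noteq> 0"
  proof
    assume "d = 0"
    thus False using fun_cong[OF eq, of c] \<psi>(2) by simp
  qed
  moreover have "\<not> d \<ge> 2"
  proof
    assume "d \<ge> 2"
    have d1: "((\<lambda>w. exp w - exp c) has_field_derivative exp c) (at c)"
      by (auto intro!: derivative_eq_intros)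
    have "((\<lambda>w. (w - c) ^ d * \<psi> w) has_field_derivative 0) (at c)"
      using holomorphic_derivI[OF \<psi>(1) open_UNIV, of c] \<open>d \<ge> 2\<close>
      by (auto intro!: derivative_eq_intros simp: power_0_left)
    hence "((\<lambda>w. exp w - exp c) has_field_derivative 0) (at c)" unfolding eq .
    from DERIV_unique[OF d1 this] show False by simp
  qed
  ultimately have "d = 1" by simp
  have "exp w - exp c = (w - c) * \<psi> w" for w
    using fun_cong[OF eq, of w] \<open>d = 1\<close> by simp
  thus thesis by (rule that[OF \<psi>(1,2)])
qed

lemma poly_eq_of_exp:
  fixes p q :: "complex poly"
  assumes "\<And>w. exp w \<notin> S \<Longrightarrow> poly p (exp w) = poly q (exp w)" "finite S"
  shows "p = q"
proof -
  have "poly (p - q) x = 0" if "x \<notin> insert 0 S" for x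
    using assms(1)[of "Ln x"] that by simp
  hence "- insert 0 S \<subseteq> {x. poly (p - q) x = 0}" by auto
  moreover have "infinite (- insert 0 S)"
    using assms(2) by (metis finite_insert finite_compl infinite_UNIV_char_0 Diff_eq Compl_eq_Diff_UNIV finite_Diff2)
  ultimately have "p - q = 0" using poly_roots_finite[of "p - q"] finite_subset by blast
  thus ?thesis by simp
qed

text \<open>Transfers orders of vanishing in the coordinate \<open>w\<close> to multiplicities of roots of polynomials
  in \<open>x\<close>.\<close>

lemma order_of_poly_exp:
  fixes Q :: "complex poly"
  assumes "\<And>w. exp (\<Lambda> * w) * poly Q (exp w) = (w - c) ^ k * C w" "continuous_on UNIV C"
  shows "[:- exp c, 1:] ^ k dvd Q" "C c \<noteq> 0 \<Longrightarrow> Q \<noteq> 0 \<and> order (exp c) Q = k"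
proof -
  obtain \<psi> where \<psi>: "\<psi> holomorphic_on UNIV" "\<psi> c \<noteq> 0" "\<And>w. exp w - exp c = (w - c) * \<psi> w"
    by (rule exp_minus_exp_factor) (rule that)
  have main: "k \<le> order (exp c) Q \<and> (C c \<noteq> 0 \<longrightarrow> order (exp c) Q \<le> k)" if "Q \<noteq> 0"
  proof -
    define d where "d = order (exp c) Q"
    from order_decomp[OF that, of "exp c"] obtain R where
      R: "Q = [:- exp c, 1:] ^ d * R" "\<not> [:- exp c, 1:] dvd R" unfolding d_def by blast
    have Rc: "poly R (exp c) \<noteq> 0" using R(2) by (simp add: poly_eq_0_iff_dvd)
    define T where "T = (\<lambda>w. exp (\<Lambda> * w) * \<psi> w ^ d * poly R (exp w))"
    have T: "continuous_on UNIV T" unfolding T_def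
      by (intro continuous_intros entire_continuous \<psi>(1)) auto
    have Tc: "T c \<noteq> 0" using Rc \<psi>(2) by (simp add: T_def)
    have eq: "(w - c) ^ d * T w = (w - c) ^ k * C w" for w
      using assms(1)[of w] \<psi>(3)[of w] by (simp add: R(1) T_def poly_power power_mult_distrib mult_ac)
    have "k \<le> d"
    proof (rule ccontr)
      assume "\<not> k \<le> d"
      then obtain q where q: "k = d + Suc q" using less_iff_Suc_add by (metis not_le add_Suc_right)
      have "(w - c) ^ 0 * T w = (w - c) ^ Suc q * C w" for w
        by (rule cancel_power[where a = d]) (use T assms(2) eq q in auto)
      from this[of c] Tc show False by simp
    qed
    moreover have "d \<le> k" if "C c \<noteq> 0"
    proof (rule ccontr)
      assume "\<not> d \<le> k"
      then obtain q where q: "d = k + Suc q" using less_iff_Suc_add by (metis not_le add_Suc_right)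
      have "(w - c) ^ Suc q * T w = (w - c) ^ 0 * C w" for w
        by (rule cancel_power[where a = k]) (use T assms(2) eq q in auto)
      from this[of c] that show False by simp
    qed
    ultimately show ?thesis by (simp add: d_def)
  qed
  show "[:- exp c, 1:] ^ k dvd Q" using main by (auto simp: order_divides)
  assume "C c \<noteq> 0"
  moreover have "Q \<noteq> 0"
  proof
    assume "Q = 0"
    hence *: "(w - c) ^ k * 0 = (w - c) ^ k * C w" for w using assms(1)[of w] by simp
    have "(w - c) ^ 0 * 0 = (w - c) ^ 0 * C w" for w
      by (rule cancel_power[where a = k and y = "\<lambda>_. 0"]) (use assms(2) * in auto)
    from this[of c] \<open>C c \<noteq> 0\<close> show False by simp
  qed
  ultimately show "Q \<noteq> 0 \<and> order (exp c) Q = k" using main by auto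
qed

lemma linear_powers_dvd:
  fixes R :: "complex poly"
  assumes "finite A" "inj_on z A" "\<And>a. a \<in> A \<Longrightarrow> [:- z a, 1:] ^ k a dvd R"
  shows "(\<Prod>a\<in>A. [:- z a, 1:] ^ k a) dvd R"
  using assms
proof (induction A rule: finite_induct)
  case (insert a A)
  hence "(\<Prod>a\<in>A. [:- z a, 1:] ^ k a) dvd R" by auto
  then obtain S where S: "R = (\<Prod>a\<in>A. [:- z a, 1:] ^ k a) * S" by (elim dvdE)
  have "[:- z a, 1:] ^ k a dvd S"
  proof (cases "R = 0")
    case False
    have "poly (\<Prod>a\<in>A. [:- z a, 1:] ^ k a) (z a) \<noteq> 0"
      using insert by (auto simp: poly_prod poly_power inj_on_def)
    hence "order (z a) (\<Prod>a\<in>A. [:- z a, 1:] ^ k a) = 0" by (rule order_0I)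
    hence "order (z a) R = order (z a) S" using False S by (simp add: order_mult)
    moreover have "k a \<le> order (z a) R" using insert.prems(2)[of a] False by (simp add: order_divides)
    ultimately show ?thesis by (simp add: order_divides)
  next
    case True
    have "(\<Prod>a\<in>A. [:- z a, 1:] ^ k a) \<noteq> 0" using insert(1) by auto
    hence "S = 0" using S True by simp
    thus ?thesis by simp
  qed
  thus ?case using insert(1,2) S by (simp add: mult.commute mult_dvd_mono)
qed auto

lemma poly_eq_linear_powers:
  fixes Q :: "complex poly"
  assumes "finite A" "inj_on z A" "{x. poly Q x = 0} \<subseteq> z ` A"
  shows "Q = Polynomial.smult (lead_coeff Q) (\<Prod>a\<in>A. [:- z a, 1:] ^ order (z a) Q)"
proof -
  have "(\<Prod>x | poly Q x = 0. [:- x, 1:] ^ order x Q) = (\<Prod>x\<in>z ` A. [:- x, 1:] ^ order x Q)"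
    using assms(1,3) by (intro prod.mono_neutral_left) (auto simp: order_0I)
  also have "\<dots> = (\<Prod>a\<in>A. [:- z a, 1:] ^ order (z a) Q)"
    by (subst prod.reindex[OF assms(2)]) simp
  finally show ?thesis using complex_poly_decompose[of Q] by simp
qed

lemma degree_linear_powers: "finite A \<Longrightarrow> degree (\<Prod>a\<in>A. [:- z a, 1:] ^ k a) = (\<Sum>a\<in>A. k a)"
  for z :: "'b \<Rightarrow> 'a::idom"
  by (subst degree_prod_eq_sum_degree) (auto simp: degree_linear_power)

lemma lead_coeff_linear_powers: "lead_coeff (\<Prod>a\<in>A. [:- z a, 1:] ^ k a) = 1"
  for z :: "'b \<Rightarrow> 'a::idom"
  by (subst lead_coeff_prod) (auto simp: lead_coeff_power)

section \<open>The space of quasi-polynomials at zero and at infinity\<close>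

lemma degree_data_ge:
  assumes "degree_data k K d" "i \<in> {1..k}" "j \<in> {1..K i}"
  shows "j \<le> d i j"
proof -
  have pos: "\<And>j. j \<in> {1..K i} \<Longrightarrow> 0 < d i j" and mono: "strict_mono_on {1..K i} (d i)"
    using assms(1,2) by (auto simp: degree_data_def)
  have "j \<in> {1..K i} \<longrightarrow> j \<le> d i j"
  proof (induction j)
    case (Suc j)
    show ?case
    proof
      assume S: "Suc j \<in> {1..K i}"
      show "Suc j \<le> d i (Suc j)"
      proof (cases "j = 0")
        case True
        thus ?thesis using pos[OF S] by simp
      next
        case False
        hence "j \<in> {1..K i}" using S by auto
        moreover have "d i j < d i (Suc j)"
          using mono S \<open>j \<in> {1..K i}\<close> by (auto simp: strict_mono_on_def)
        ultimately show ?thesis using Suc by auto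
      qed
    qed
  qed simp
  thus ?thesis using assms(3) by simp
qed

lemma sum_lessThan_add: "(\<Sum>k<a+b. f k) = (\<Sum>k<a. f k) + (\<Sum>k<b. f (a + k))"
  for f :: "nat \<Rightarrow> 'a::comm_monoid_add"
  by (induction b) (auto simp: add.assoc)

lemma sum_atLeast1_shift: "(\<Sum>b=1..k. f b) = (\<Sum>b<k. f (Suc b))"
  for f :: "nat \<Rightarrow> 'a::comm_monoid_add"
  by (rule sum.reindex_bij_witness[of _ Suc "\<lambda>b. b - 1"]) auto

locale qp_space =
  fixes V :: "(complex \<Rightarrow> complex) set" and p :: "nat \<Rightarrow> nat \<Rightarrow> complex poly"
    and n :: nat and N :: "nat \<Rightarrow> nat" and nn :: "nat \<Rightarrow> nat \<Rightarrow> nat" and lam :: "nat \<Rightarrow> complex"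
    and m :: nat and M :: "nat \<Rightarrow> nat" and mm :: "nat \<Rightarrow> nat \<Rightarrow> nat" and z :: "nat \<Rightarrow> complex"
  assumes quasi: "quasi_polynomials V p n N nn lam m M mm z"
    and nondeg: "nondegenerate_quasi_polynomials V p n N nn lam"
begin

text \<open>Here \<open>K\<close> is the dimension of \<open>V\<close> and \<open>dim_U\<close> will be the dimension of its dual. The pairs \<open>(i, j)\<close>
  are enumerated by a single index \<open>k < K\<close>, in an arbitrary order, so that the generators \<open>G k\<close> can be
  used as the columns of a Wronskian.\<close>

definition K :: nat where "K = sum N {1..n}"
definition dim_U :: nat where "dim_U = sum M {1..m}"
definition ix :: "nat \<Rightarrow> nat \<times> nat" where
  "ix = (SOME h. bij_betw h {..<K} (SIGMA i:{1..n}. {1..N i}))"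
definition L :: "nat \<Rightarrow> complex" where "L k = lam (fst (ix k))"
definition gen_poly :: "nat \<Rightarrow> complex poly" where "gen_poly k = p (fst (ix k)) (snd (ix k))"
definition gen_degree :: "nat \<Rightarrow> nat" where "gen_degree k = nn (fst (ix k)) (snd (ix k))"
definition G :: "nat \<Rightarrow> complex \<Rightarrow> complex" where "G k = quasi_monomial (L k) (gen_poly k)"

lemma quasi_polynomial_data:
  shows n1: "1 \<le> n" and dd_n: "degree_data n N nn" and nr: "non_resonant n lam"
    and deg_p: "\<And>i j. i \<in> {1..n} \<Longrightarrow> j \<in> {1..N i} \<Longrightarrow> degree (p i j) = nn i j"
    and V_span: "V = cfun.span {\<lambda>w. exp (lam i * w) * poly (p i j) (exp w) | i j. i \<in> {1..n} \<and> j \<in> {1..N i}}"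
    and z_inj: "inj_on z {1..m}"
    and sing: "z ` {1..m} = {x. x \<noteq> 0 \<and> exponents V x \<noteq> {0..<K}}"
    and dd_m: "degree_data m M mm"
    and M_le: "\<And>a. a \<in> {1..m} \<Longrightarrow> M a \<le> K"
    and exps: "\<And>a. a \<in> {1..m} \<Longrightarrow> exponents V (z a) = {0..<K - M a} \<union> (\<lambda>b. K - M a + mm a b) ` {1..M a}"
  using quasi unfolding quasi_polynomials_def K_def by blast+

lemma z_nz: "a \<in> {1..m} \<Longrightarrow> z a \<noteq> 0"
  using sing by blast

lemma ix: "bij_betw ix {..<K} (SIGMA i:{1..n}. {1..N i})"
proof -
  have "card (SIGMA i:{1..n}. {1..N i}) = K" by (simp add: K_def)
  hence "\<exists>h. bij_betw h {..<K} (SIGMA i:{1..n}. {1..N i})"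
    using ex_bij_betw_nat_finite[of "SIGMA i:{1..n}. {1..N i}"] by (auto simp: lessThan_atLeast0)
  thus ?thesis unfolding ix_def by (rule someI_ex)
qed

lemma ix_range: "k < K \<Longrightarrow> fst (ix k) \<in> {1..n}" "k < K \<Longrightarrow> snd (ix k) \<in> {1..N (fst (ix k))}"
  using bij_betwE[OF ix] by force+

lemma sum_ix: "(\<Sum>k<K. f (fst (ix k)) (snd (ix k))) = (\<Sum>i=1..n. \<Sum>j=1..N i. f i j)"
proof -
  have "(\<Sum>k<K. f (fst (ix k)) (snd (ix k))) = (\<Sum>x\<in>(SIGMA i:{1..n}. {1..N i}). f (fst x) (snd x))"
    by (rule sum.reindex_bij_betw[OF ix, of "\<lambda>x. f (fst x) (snd x)"])
  also have "\<dots> = (\<Sum>i=1..n. \<Sum>j=1..N i. f i j)"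
    by (subst sum.Sigma) (auto simp: case_prod_beta)
  finally show ?thesis .
qed

lemma V_eq_span: "V = cfun.span (G ` {..<K})"
proof -
  have "{\<lambda>w. exp (lam i * w) * poly (p i j) (exp w) | i j. i \<in> {1..n} \<and> j \<in> {1..N i}} =
      (\<lambda>x. quasi_monomial (lam (fst x)) (p (fst x) (snd x))) ` (SIGMA i:{1..n}. {1..N i})"
    by (force simp: quasi_monomial_def fun_eq_iff)
  also have "\<dots> = (\<lambda>x. quasi_monomial (lam (fst x)) (p (fst x) (snd x))) ` (ix ` {..<K})"
    using ix by (simp add: bij_betw_def)
  also have "\<dots> = G ` {..<K}" by (auto simp: G_def[abs_def] L_def gen_poly_def image_image)
  finally show ?thesis using V_span by simp
qed

lemma V_eq: "V = {f. \<exists>c. f = (\<lambda>w. \<Sum>k<K. c k * G k w)}"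
  unfolding V_eq_span by (rule span_image_eq) simp

lemma G_entire: "G k holomorphic_on UNIV"
  by (simp add: G_def quasi_monomial_entire)

lemma V_entire: "f \<in> V \<Longrightarrow> f holomorphic_on UNIV"
  unfolding V_eq by (auto intro!: holomorphic_intros G_entire)

lemma V_lincomb: "(\<And>k. k \<in> A \<Longrightarrow> F k \<in> V) \<Longrightarrow> (\<lambda>w. \<Sum>k\<in>A. c k * F k w) \<in> V"
proof -
  assume *: "\<And>k. k \<in> A \<Longrightarrow> F k \<in> V"
  have "(\<lambda>w. \<Sum>k\<in>A. c k * F k w) = (\<Sum>k\<in>A. (\<lambda>w. c k * F k w))"
    by (rule ext) (simp add: sum_fun_apply)
  also have "\<dots> \<in> V" using * unfolding V_eq_span by (intro cfun.span_sum cfun.span_scale)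
  finally show ?thesis .
qed

lemma in_V_coeffs:
  assumes "\<And>k. k < K' \<Longrightarrow> F k \<in> V"
  obtains C where "\<And>k. k < K' \<Longrightarrow> F k = (\<lambda>w. \<Sum>l<K. C l k * G l w)"
proof -
  have "\<forall>k. \<exists>c. k < K' \<longrightarrow> F k = (\<lambda>w. \<Sum>l<K. c l * G l w)"
    using assms unfolding V_eq by auto
  from choice[OF this] obtain c where "\<forall>k. k < K' \<longrightarrow> F k = (\<lambda>w. \<Sum>l<K. c k l * G l w)"
    by (elim exE) (rule that)
  thus thesis by (intro that[of "\<lambda>l k. c k l"]) simp
qed

text \<open>Distinctness of exponents: within one \<open>i\<close> by assumption, across different \<open>i\<close> because the
  \<open>\<lambda>\<^sub>i\<close> do not differ by integers.\<close>

lemma inj_exponents: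
  assumes "\<And>i. i \<in> {1..n} \<Longrightarrow> inj_on (f i) {1..N i}"
  shows "inj_on (\<lambda>k. L k + of_nat (f (fst (ix k)) (snd (ix k)))) {..<K}"
proof (rule inj_onI)
  fix k k' assume k: "k \<in> {..<K}" "k' \<in> {..<K}"
    and eq: "L k + of_nat (f (fst (ix k)) (snd (ix k))) = L k' + of_nat (f (fst (ix k')) (snd (ix k')))"
  have "L k - L k' = of_int (int (f (fst (ix k')) (snd (ix k'))) - int (f (fst (ix k)) (snd (ix k))))"
    using eq by (simp add: algebra_simps)
  hence "lam (fst (ix k)) - lam (fst (ix k')) \<in> \<int>" by (simp add: L_def)
  hence i: "fst (ix k) = fst (ix k')"
    using nr[unfolded non_resonant_def, rule_format, OF ix_range(1)[of k] ix_range(1)[of k']] k by blast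
  hence "f (fst (ix k)) (snd (ix k)) = f (fst (ix k)) (snd (ix k'))" using eq by (simp add: L_def)
  moreover have "snd (ix k) \<in> {1..N (fst (ix k))}" "snd (ix k') \<in> {1..N (fst (ix k))}"
    using ix_range(2)[of k] ix_range(2)[of k'] k i by auto
  moreover have "inj_on (f (fst (ix k))) {1..N (fst (ix k))}"
    using assms ix_range(1)[of k] k by blast
  ultimately have "snd (ix k) = snd (ix k')" by (blast dest: inj_onD)
  hence "ix k = ix k'" using i by (simp add: prod_eq_iff)
  thus "k = k'" using ix k by (auto simp: bij_betw_def inj_on_def)
qed

lemma nn_inj: "i \<in> {1..n} \<Longrightarrow> inj_on (nn i) {1..N i}"
  using dd_n unfolding degree_data_def by (auto intro: strict_mono_on_imp_inj_on)

lemma nn_ge: "i \<in> {1..n} \<Longrightarrow> j \<in> {1..N i} \<Longrightarrow> j \<le> nn i j"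
  using degree_data_ge[OF dd_n] .

lemma mm_ge: "a \<in> {1..m} \<Longrightarrow> b \<in> {1..M a} \<Longrightarrow> b \<le> mm a b"
  using degree_data_ge[OF dd_m] .

definition wronskian_poly :: "(nat \<Rightarrow> nat) \<Rightarrow> complex poly" where
  "wronskian_poly \<rho> = ndet K (\<lambda>r k. (twisted_theta (L k) ^^ \<rho> r) (gen_poly k))"

lemma wronskian_G: "wronskian \<rho> K G w = exp ((\<Sum>k<K. L k) * w) * poly (wronskian_poly \<rho>) (exp w)"
  using wronskian_quasi_monomial[of \<rho> K L gen_poly w] unfolding wronskian_poly_def G_def[abs_def] .

lemma degree_gen_poly: "k < K \<Longrightarrow> degree (gen_poly k) = gen_degree k"
  using deg_p ix_range by (simp add: gen_poly_def gen_degree_def)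

lemma gen_poly_nz: "k < K \<Longrightarrow> gen_poly k \<noteq> 0"
  using degree_gen_poly[of k] nn_ge[OF ix_range(1) ix_range(2), of k] ix_range(2)[of k] by (auto simp: gen_degree_def)

lemma degree_wronskian_poly_le: "degree (wronskian_poly \<rho>) \<le> (\<Sum>k<K. gen_degree k)"
  unfolding wronskian_poly_def by (rule ndet_top_coeff(1)) (simp add: degree_twisted_theta_iter degree_gen_poly)

lemma vandermonde_powers:
  assumes "inj_on x {..<k}" "\<And>i. i < k \<Longrightarrow> c i \<noteq> (0::complex)"
  shows "ndet k (\<lambda>r i. x i ^ r * c i) \<noteq> 0"
  using generalized_vandermonde[of k "\<lambda>r. monom 1 r" x c] assms
  by (simp add: poly_monom degree_monom_eq)

text \<open>The exponents at infinity \<open>\<lambda>\<^sub>i + n\<^sub>i\<^sub>j\<close> are distinct, so the top coefficient is a nonzero Vandermonde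
  determinant. In particular the generators are linearly independent.\<close>

lemma coeff_wronskian_poly: "coeff (wronskian_poly (\<lambda>r. r)) (\<Sum>k<K. gen_degree k) \<noteq> 0"
proof -
  have "coeff (wronskian_poly (\<lambda>r. r)) (\<Sum>k<K. gen_degree k) = ndet K (\<lambda>r k. coeff ((twisted_theta (L k) ^^ r) (gen_poly k)) (gen_degree k))"
    unfolding wronskian_poly_def by (rule ndet_top_coeff(2)) (simp add: degree_twisted_theta_iter degree_gen_poly)
  also have "\<dots> = ndet K (\<lambda>r k. (L k + of_nat (gen_degree k)) ^ r * coeff (gen_poly k) (gen_degree k))"
    by (simp add: coeff_twisted_theta_iter)
  also have "\<dots> \<noteq> 0"
  proof (rule vandermonde_powers)
    show "inj_on (\<lambda>k. L k + of_nat (gen_degree k)) {..<K}"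
      unfolding gen_degree_def by (rule inj_exponents) (rule nn_inj)
    show "\<And>i. i < K \<Longrightarrow> coeff (gen_poly i) (gen_degree i) \<noteq> 0"
      by (metis degree_gen_poly gen_poly_nz leading_coeff_0_iff)
  qed
  finally show ?thesis .
qed

lemma wronskian_poly_nz: "wronskian_poly (\<lambda>r. r) \<noteq> 0"
  using coeff_wronskian_poly by auto

lemma degree_wronskian_poly: "degree (wronskian_poly (\<lambda>r. r)) = (\<Sum>k<K. gen_degree k)"
  using degree_wronskian_poly_le[of "\<lambda>r. r"] coeff_wronskian_poly le_degree by (intro antisym) auto

definition order_at_zero :: nat where "order_at_zero = (\<Sum>k<K. snd (ix k) - 1)"

text \<open>Nondegeneracy at \<open>x = 0\<close>, rephrased as a change of generators that does not mix different \<open>i\<close>.\<close>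

lemma adapted_at_0:
  obtains C P0 where "\<And>k. k < K \<Longrightarrow> P0 k = (\<Sum>l<K. Polynomial.smult (C l k) (gen_poly l))"
    "\<And>k l. k < K \<Longrightarrow> l < K \<Longrightarrow> C l k \<noteq> 0 \<Longrightarrow> fst (ix l) = fst (ix k)"
    "\<And>k s. k < K \<Longrightarrow> s < snd (ix k) - 1 \<Longrightarrow> coeff (P0 k) s = 0"
    "\<And>k. k < K \<Longrightarrow> coeff (P0 k) (snd (ix k) - 1) \<noteq> 0"
proof -
  have "\<forall>k. \<exists>c. k < K \<longrightarrow> (\<Sum>j=1..N (fst (ix k)). Polynomial.smult (c j) (p (fst (ix k)) j)) \<noteq> 0 \<and>
     Polynomial.order 0 (\<Sum>j=1..N (fst (ix k)). Polynomial.smult (c j) (p (fst (ix k)) j)) = snd (ix k) - 1"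
    using nondeg ix_range unfolding nondegenerate_quasi_polynomials_def by blast
  from choice[OF this] obtain c where c0: "\<forall>k. k < K \<longrightarrow>
     (\<Sum>j=1..N (fst (ix k)). Polynomial.smult (c k j) (p (fst (ix k)) j)) \<noteq> 0 \<and>
     Polynomial.order 0 (\<Sum>j=1..N (fst (ix k)). Polynomial.smult (c k j) (p (fst (ix k)) j)) = snd (ix k) - 1"
    by (elim exE) (rule that)
  note c = c0[rule_format, THEN conjunct1] c0[rule_format, THEN conjunct2]
  define P0 where "P0 = (\<lambda>k. \<Sum>j=1..N (fst (ix k)). Polynomial.smult (c k j) (p (fst (ix k)) j))"
  define C where "C = (\<lambda>l k. if fst (ix l) = fst (ix k) then c k (snd (ix l)) else 0)"
  have "P0 k = (\<Sum>l<K. Polynomial.smult (C l k) (gen_poly l))" if "k < K" for k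
  proof -
    have "(\<Sum>l<K. Polynomial.smult (C l k) (gen_poly l)) =
       (\<Sum>l<K. (\<lambda>i j. if i = fst (ix k) then Polynomial.smult (c k j) (p i j) else 0) (fst (ix l)) (snd (ix l)))"
      by (intro sum.cong refl) (auto simp: C_def gen_poly_def)
    also have "\<dots> = (\<Sum>i=1..n. \<Sum>j=1..N i. if i = fst (ix k) then Polynomial.smult (c k j) (p i j) else 0)"
      by (rule sum_ix)
    also have "\<dots> = (\<Sum>i=1..n. if i = fst (ix k) then P0 k else 0)"
      by (intro sum.cong refl) (auto simp: P0_def)
    also have "\<dots> = P0 k" using ix_range(1)[OF that] by simp
    finally show ?thesis by simp
  qed
  moreover have "C l k \<noteq> 0 \<Longrightarrow> fst (ix l) = fst (ix k)" for k l by (auto simp: C_def split: if_splits)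
  moreover have "coeff (P0 k) s = 0" if "k < K" "s < snd (ix k) - 1" for k s
  proof -
    have "monom 1 (snd (ix k) - 1) dvd P0 k"
      using c(2)[OF that(1)] order_1[of 0 "P0 k"] by (simp add: P0_def monom_altdef)
    thus ?thesis using that(2) by (simp add: monom_1_dvd_iff')
  qed
  moreover have "coeff (P0 k) (snd (ix k) - 1) \<noteq> 0" if "k < K" for k
  proof
    assume "coeff (P0 k) (snd (ix k) - 1) = 0"
    moreover have "coeff (P0 k) s = 0" if "s < snd (ix k) - 1" for s
      using calculation \<open>\<And>k s. k < K \<Longrightarrow> s < snd (ix k) - 1 \<Longrightarrow> coeff (P0 k) s = 0\<close> \<open>k < K\<close> that by blast
    ultimately have "monom 1 (Suc (snd (ix k) - 1)) dvd P0 k"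
      by (auto simp: monom_1_dvd_iff' less_Suc_eq)
    hence "[:- 0, 1:] ^ Suc (snd (ix k) - 1) dvd P0 k" by (simp add: monom_altdef)
    moreover have "P0 k \<noteq> 0" using c(1)[OF that] by (simp add: P0_def)
    ultimately have "Suc (snd (ix k) - 1) \<le> order 0 (P0 k)" by (simp only: order_divides) simp
    thus False using c(2)[OF that] by (simp add: P0_def)
  qed
  ultimately show thesis by (rule that)
qed

text \<open>In adapted generators the exponents at \<open>0\<close> are \<open>\<lambda>\<^sub>i + j - 1\<close>; they are distinct, and the lowest
  coefficient is a nonzero Vandermonde determinant. The change of generators only contributes a
  constant factor, which is nonzero for this very reason.\<close>

lemma wronskian_poly_at_0: "[:- 0, 1:] ^ order_at_zero dvd wronskian_poly \<rho>" "order 0 (wronskian_poly (\<lambda>r. r)) = order_at_zero"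
proof -
  obtain C P0 where C: "\<And>k. k < K \<Longrightarrow> P0 k = (\<Sum>l<K. Polynomial.smult (C l k) (gen_poly l))"
    "\<And>k l. k < K \<Longrightarrow> l < K \<Longrightarrow> C l k \<noteq> 0 \<Longrightarrow> fst (ix l) = fst (ix k)"
    "\<And>k s. k < K \<Longrightarrow> s < snd (ix k) - 1 \<Longrightarrow> coeff (P0 k) s = 0"
    "\<And>k. k < K \<Longrightarrow> coeff (P0 k) (snd (ix k) - 1) \<noteq> 0" by (rule adapted_at_0) blast
  define D where "D = (\<lambda>\<rho>. ndet K (\<lambda>r k. (twisted_theta (L k) ^^ \<rho> r) (P0 k)))"
  have th: "(twisted_theta (L k) ^^ r) (P0 k) = (\<Sum>l<K. (twisted_theta (L l) ^^ r) (gen_poly l) * [:C l k:])" if "k < K" for k r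
  proof (rule poly_eqI)
    fix s
    have "coeff ((twisted_theta (L k) ^^ r) (P0 k)) s = (\<Sum>l<K. (L k + of_nat s) ^ r * (C l k * coeff (gen_poly l) s))"
      by (simp add: coeff_twisted_theta_iter C(1)[OF that] coeff_sum sum_distrib_left)
    also have "\<dots> = (\<Sum>l<K. (L l + of_nat s) ^ r * (C l k * coeff (gen_poly l) s))"
    proof (intro sum.cong refl)
      fix l assume "l \<in> {..<K}"
      thus "(L k + of_nat s) ^ r * (C l k * coeff (gen_poly l) s) = (L l + of_nat s) ^ r * (C l k * coeff (gen_poly l) s)"
        using C(2)[OF that, of l] by (cases "C l k = 0") (auto simp: L_def)
    qed
    finally show "coeff ((twisted_theta (L k) ^^ r) (P0 k)) s = coeff (\<Sum>l<K. (twisted_theta (L l) ^^ r) (gen_poly l) * [:C l k:]) s"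
      by (simp add: coeff_sum coeff_twisted_theta_iter mult_ac)
  qed
  have "ndet K (\<lambda>l k. [:C l k:]) = [:ndet K C:]"
    by (rule poly_ext) (simp add: poly_ndet)
  moreover have "D \<rho> = wronskian_poly \<rho> * ndet K (\<lambda>l k. [:C l k:])" for \<rho>
    unfolding D_def wronskian_poly_def ndet_mult[symmetric] by (rule ndet_cong) (simp add: th)
  ultimately have D: "D \<rho> = Polynomial.smult (ndet K C) (wronskian_poly \<rho>)" for \<rho> by simp
  have low: "\<exists>q. D \<rho> = monom 1 order_at_zero * q \<and>
      poly q 0 = ndet K (\<lambda>r k. coeff ((twisted_theta (L k) ^^ \<rho> r) (P0 k)) (snd (ix k) - 1))" for \<rho>
  proof -
    obtain q where "ndet K (\<lambda>r k. (twisted_theta (L k) ^^ \<rho> r) (P0 k)) = monom 1 (\<Sum>k<K. snd (ix k) - 1) * q"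
      "poly q 0 = ndet K (\<lambda>r k. coeff ((twisted_theta (L k) ^^ \<rho> r) (P0 k)) (snd (ix k) - 1))"
      by (rule ndet_low_coeff[where n = K and a = "\<lambda>r k. (twisted_theta (L k) ^^ \<rho> r) (P0 k)"
            and d = "\<lambda>k. snd (ix k) - 1"]) (simp add: coeff_twisted_theta_iter C(3), rule that)
    thus ?thesis unfolding D_def order_at_zero_def by (intro exI[of _ q] conjI)
  qed
  from low[of "\<lambda>r. r"] obtain q where q: "D (\<lambda>r. r) = monom 1 order_at_zero * q"
    "poly q 0 = ndet K (\<lambda>r k. coeff ((twisted_theta (L k) ^^ r) (P0 k)) (snd (ix k) - 1))" by (elim exE conjE) (rule that)
  have "poly q 0 = ndet K (\<lambda>r k. (L k + of_nat (snd (ix k) - 1)) ^ r * coeff (P0 k) (snd (ix k) - 1))"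
    unfolding q(2) by (simp add: coeff_twisted_theta_iter)
  also have "\<dots> \<noteq> 0"
  proof (rule vandermonde_powers)
    show "inj_on (\<lambda>k. L k + of_nat (snd (ix k) - 1)) {..<K}"
      by (rule inj_exponents) (auto simp: inj_on_def)
  qed (rule C(4))
  finally have q0: "poly q 0 \<noteq> 0" .
  have c: "ndet K C \<noteq> 0"
  proof
    assume "ndet K C = 0"
    hence "monom 1 order_at_zero * q = 0" using D[of "\<lambda>r. r"] q(1) by simp
    thus False using q0 by auto
  qed
  from low[of \<rho>] have "[:- 0, 1:] ^ order_at_zero dvd D \<rho>" by (auto simp: monom_altdef)
  thus "[:- 0, 1:] ^ order_at_zero dvd wronskian_poly \<rho>" using c by (simp add: D dvd_smult_iff)
  have "order 0 (wronskian_poly (\<lambda>r. r)) = order 0 (D (\<lambda>r. r))" using c by (simp add: D order_smult)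
  also have "\<dots> = order 0 (monom 1 order_at_zero :: complex poly) + order 0 q"
    unfolding q(1) using q0 by (intro order_mult) auto
  also have "order 0 q = 0" using q0 by (rule order_0I)
  also have "order 0 (monom 1 order_at_zero :: complex poly) = order_at_zero"
    using order_power_n_n[of 0 order_at_zero] by (simp add: monom_altdef)
  finally show "order 0 (wronskian_poly (\<lambda>r. r)) = order_at_zero" by simp
qed

section \<open>Frames of the space of quasi-polynomials\<close>

text \<open>Monodromy: all points over a given \<open>x\<close> see the same exponents.\<close>

lemma V_shift:
  assumes "f \<in> V"
  shows "(\<lambda>w. f (w + (of_int (2 * t) * pi) * \<i>)) \<in> V"
proof -
  have G: "G k (w + (of_int (2 * t) * pi) * \<i>) = exp (L k * ((of_int (2 * t) * pi) * \<i>)) * G k w" for k w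
  proof -
    have "exp (w + (of_int (2 * t) * pi) * \<i>) = exp w" by (subst exp_eq) auto
    thus ?thesis by (simp add: G_def quasi_monomial_def distrib_left exp_add)
  qed
  from assms obtain c where c: "f = (\<lambda>w. \<Sum>k<K. c k * G k w)" unfolding V_eq by auto
  have "(\<lambda>w. f (w + (of_int (2 * t) * pi) * \<i>)) =
      (\<lambda>w. \<Sum>k<K. (c k * exp (L k * ((of_int (2 * t) * pi) * \<i>))) * G k w)"
    unfolding c G by (simp add: mult_ac)
  thus ?thesis unfolding V_eq by (intro CollectI exI)
qed

text \<open>The function \<open>F k\<close> has exact order \<open>e k\<close> at \<open>c\<close>, with cofactor \<open>g k\<close>.\<close>

definition adapted :: "complex \<Rightarrow> (nat \<Rightarrow> nat) \<Rightarrow> (nat \<Rightarrow> complex \<Rightarrow> complex) \<Rightarrow> (nat \<Rightarrow> complex \<Rightarrow> complex) \<Rightarrow> bool" where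
  "adapted c e F g \<longleftrightarrow> (\<forall>k<K. F k \<in> V \<and> g k holomorphic_on UNIV \<and> g k c \<noteq> 0 \<and>
     (\<forall>w. F k w = (w - c) ^ e k * g k w))"

text \<open>A basis of \<open>V\<close>, given as a family rather than a list and recognized by its Wronskian.\<close>

definition frame :: "(nat \<Rightarrow> complex \<Rightarrow> complex) \<Rightarrow> bool" where
  "frame F \<longleftrightarrow> (\<forall>k<K. F k \<in> V) \<and> (\<exists>w. wronskian (\<lambda>r. r) K F w \<noteq> 0)"

lemma exponent_function:
  assumes "e \<in> exponents V (exp c)"
  shows "\<exists>f g. f \<in> V \<and> g holomorphic_on UNIV \<and> g c \<noteq> 0 \<and> (\<forall>w. f w = (w - c) ^ e * g w)"
proof -
  from assms obtain f c' where f: "f \<in> V" "f \<noteq> (\<lambda>_. 0)" "exp c' = exp c" "zorder f c' = int e"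
    by (auto simp: exponents_def)
  from f(3) obtain t where t: "c' = c + (of_int (2 * t) * pi) * \<i>" by (auto simp: exp_eq)
  obtain g where g: "g holomorphic_on UNIV" "g c' \<noteq> 0" "\<And>w. f w = (w - c') ^ nat (zorder f c') * g w"
    by (rule entire_factorization[OF V_entire[OF f(1)] f(2), of c']) (rule that)
  let ?s = "(of_int (2 * t) * pi) * \<i>"
  have "(\<lambda>w. f (w + ?s)) \<in> V" by (rule V_shift[OF f(1)])
  moreover have "(\<lambda>w. g (w + ?s)) holomorphic_on UNIV"
  proof -
    have "(g \<circ> (\<lambda>w. w + ?s)) holomorphic_on UNIV"
      by (rule holomorphic_on_compose) (auto intro!: holomorphic_intros holomorphic_on_subset[OF g(1)])
    thus ?thesis by (simp only: comp_def)
  qed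
  moreover have "g (c + ?s) \<noteq> 0" using g(2) t by simp
  moreover have "f (w + ?s) = (w - c) ^ e * g (w + ?s)" for w
  proof -
    have "f (w + ?s) = (w + ?s - c') ^ e * g (w + ?s)" using g(3)[of "w + ?s"] f(4) by simp
    thus ?thesis by (simp add: t)
  qed
  ultimately show ?thesis by (intro exI[of _ "\<lambda>w. f (w + ?s)"] exI[of _ "\<lambda>w. g (w + ?s)"]) auto
qed

lemma exists_adapted:
  assumes "\<And>k. k < K \<Longrightarrow> e k \<in> exponents V (exp c)"
  obtains F g where "adapted c e F g"
proof -
  have "\<forall>k. \<exists>f g. k < K \<longrightarrow> f \<in> V \<and> g holomorphic_on UNIV \<and> g c \<noteq> 0 \<and> (\<forall>w. f w = (w - c) ^ e k * g w)"
    using exponent_function[OF assms] by auto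
  from choice[OF this] obtain F where F: "\<forall>k. \<exists>g. k < K \<longrightarrow> F k \<in> V \<and> g holomorphic_on UNIV \<and>
      g c \<noteq> 0 \<and> (\<forall>w. F k w = (w - c) ^ e k * g w)" by (elim exE) (rule that)
  from choice[OF this] obtain g where "\<forall>k. k < K \<longrightarrow> F k \<in> V \<and> g k holomorphic_on UNIV \<and>
      g k c \<noteq> 0 \<and> (\<forall>w. F k w = (w - c) ^ e k * g k w)" by (elim exE) (rule that)
  hence "adapted c e F g" by (simp add: adapted_def)
  thus thesis by (rule that)
qed

lemma adapted_wronskian:
  assumes "adapted c e F g" "inj_on e {..<K}"
  obtains B where "B holomorphic_on UNIV" "B c \<noteq> 0" "(\<Sum>r<K. r) \<le> (\<Sum>k<K. e k)"
    "\<And>w. wronskian (\<lambda>r. r) K F w = (w - c) ^ ((\<Sum>k<K. e k) - (\<Sum>r<K. r)) * B w"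
  by (rule wronskian_order[of K g c F e]) (use assms in \<open>simp_all add: adapted_def that\<close>)

lemma adapted_frame:
  assumes "adapted c e F g" "inj_on e {..<K}"
  shows "frame F"
proof -
  obtain B where B: "B holomorphic_on UNIV" "B c \<noteq> 0" "(\<Sum>r<K. r) \<le> (\<Sum>k<K. e k)"
    "\<And>w. wronskian (\<lambda>r. r) K F w = (w - c) ^ ((\<Sum>k<K. e k) - (\<Sum>r<K. r)) * B w"
    by (rule adapted_wronskian[OF assms]) (rule that)
  have "\<exists>w. wronskian (\<lambda>r. r) K F w \<noteq> 0"
  proof (rule ccontr)
    assume "\<not> ?thesis"
    hence *: "(w - c) ^ ((\<Sum>k<K. e k) - (\<Sum>r<K. r)) * B w = 0" for w using B(4)[of w] by simp
    have "B w = 0" for w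
      by (rule eq_of_eq_off_point[where f = B and g = "\<lambda>_. 0" and c = c])
         (use B(1) * in \<open>auto intro: entire_continuous\<close>)
    thus False using B(2) by simp
  qed
  thus ?thesis using assms(1) by (simp add: frame_def adapted_def)
qed

lemma frame_coeffs:
  assumes "frame F"
  obtains C where "ndet K C \<noteq> 0" "\<And>k. k < K \<Longrightarrow> F k = (\<lambda>w. \<Sum>l<K. C l k * G l w)"
    "\<And>\<rho> w. wronskian \<rho> K F w = wronskian \<rho> K G w * ndet K C"
proof -
  have "\<And>k. k < K \<Longrightarrow> F k \<in> V" using assms by (simp add: frame_def)
  then obtain C where C: "\<And>k. k < K \<Longrightarrow> F k = (\<lambda>w. \<Sum>l<K. C l k * G l w)"
    by (rule in_V_coeffs[of K F]) (simp, rule that, simp)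
  have w: "wronskian \<rho> K F w = wronskian \<rho> K G w * ndet K C" for \<rho> w
    by (rule wronskian_lincomb[OF G_entire C])
  hence "ndet K C \<noteq> 0" using assms by (auto simp: frame_def)
  thus thesis using C w by (rule that)
qed

lemma frame_V: "frame F \<Longrightarrow> k < K \<Longrightarrow> F k \<in> V"
  by (simp add: frame_def)

lemma frame_entire: "frame F \<Longrightarrow> k < K \<Longrightarrow> F k holomorphic_on UNIV"
  using frame_V V_entire by blast

lemma frame_span:
  assumes "frame F"
  shows "V = {f. \<exists>c. f = (\<lambda>w. \<Sum>k<K. c k * F k w)}"
proof
  show "{f. \<exists>c. f = (\<lambda>w. \<Sum>k<K. c k * F k w)} \<subseteq> V"
    using frame_V[OF assms] by (auto intro!: V_lincomb)
  show "V \<subseteq> {f. \<exists>c. f = (\<lambda>w. \<Sum>k<K. c k * F k w)}"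
  proof
    fix f assume "f \<in> V"
    then obtain c where c: "f = (\<lambda>w. \<Sum>k<K. c k * G k w)" unfolding V_eq by auto
    obtain C where C: "ndet K C \<noteq> 0" "\<And>k. k < K \<Longrightarrow> F k = (\<lambda>w. \<Sum>l<K. C l k * G l w)"
      "\<And>\<rho> w. wronskian \<rho> K F w = wronskian \<rho> K G w * ndet K C"
      by (rule frame_coeffs[OF assms]) (rule that)
    obtain x where x: "\<And>l. l < K \<Longrightarrow> (\<Sum>k<K. C l k * x k) = c l"
      by (rule ndet_solve[OF C(1), of c]) (rule that)
    have "f = (\<lambda>w. \<Sum>k<K. x k * F k w)"
    proof
      fix w
      have "(\<Sum>k<K. x k * F k w) = (\<Sum>k<K. \<Sum>l<K. C l k * x k * G l w)"
        by (intro sum.cong refl) (simp add: C(2) sum_distrib_left mult_ac)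
      also have "\<dots> = (\<Sum>l<K. (\<Sum>k<K. C l k * x k) * G l w)"
        by (subst sum.swap) (simp add: sum_distrib_right)
      finally show "f w = (\<Sum>k<K. x k * F k w)" by (simp add: c x)
    qed
    thus "f \<in> {f. \<exists>c. f = (\<lambda>w. \<Sum>k<K. c k * F k w)}" by (intro CollectI exI)
  qed
qed

lemma wronskian_poly_order:
  assumes "adapted c e F g" "inj_on e {..<K}"
  shows "order (exp c) (wronskian_poly (\<lambda>r. r)) = (\<Sum>k<K. e k) - (\<Sum>r<K. r)"
proof -
  obtain B where B: "B holomorphic_on UNIV" "B c \<noteq> 0" "(\<Sum>r<K. r) \<le> (\<Sum>k<K. e k)"
    "\<And>w. wronskian (\<lambda>r. r) K F w = (w - c) ^ ((\<Sum>k<K. e k) - (\<Sum>r<K. r)) * B w"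
    by (rule adapted_wronskian[OF assms]) (rule that)
  obtain C where C: "ndet K C \<noteq> 0" "\<And>\<rho> w. wronskian \<rho> K F w = wronskian \<rho> K G w * ndet K C"
    by (rule frame_coeffs[OF adapted_frame[OF assms]]) (rule that)
  have eq: "exp ((\<Sum>k<K. L k) * w) * poly (wronskian_poly (\<lambda>r. r)) (exp w) =
      (w - c) ^ ((\<Sum>k<K. e k) - (\<Sum>r<K. r)) * (B w / ndet K C)" for w
    using B(4)[of w] C(1) by (simp add: C(2) wronskian_G field_simps)
  have "continuous_on UNIV (\<lambda>w. B w / ndet K C)"
    using C(1) by (intro continuous_intros entire_continuous B(1)) auto
  from order_of_poly_exp(2)[OF eq this] show ?thesis using B(2) C(1) by simp
qed

text \<open>At a nonsingular point the exponents are \<open>0, \<dots>, K - 1\<close>, so the order of the Wronskian is \<open>0\<close>.\<close>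

lemma wronskian_G_regular:
  assumes "exp w \<notin> z ` {1..m}"
  shows "wronskian (\<lambda>r. r) K G w \<noteq> 0"
proof -
  have "exponents V (exp w) = {0..<K}" using assms sing by auto
  hence "\<And>k. k < K \<Longrightarrow> k \<in> exponents V (exp w)" by simp
  then obtain F g where A: "adapted w (\<lambda>k. k) F g" by (rule exists_adapted)
  have inj: "inj_on (\<lambda>k. k) {..<K}" by simp
  obtain B where B: "B w \<noteq> 0" "wronskian (\<lambda>r. r) K F w = (w - w) ^ ((\<Sum>k<K. k) - (\<Sum>r<K. r)) * B w"
    by (rule adapted_wronskian[OF A inj]) (rule that)
  obtain C where C: "ndet K C \<noteq> 0" "\<And>\<rho> w. wronskian \<rho> K F w = wronskian \<rho> K G w * ndet K C"
    by (rule frame_coeffs[OF adapted_frame[OF A inj]]) (rule that)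
  from B C(2)[of "\<lambda>r. r" w] show ?thesis by auto
qed

lemma frame_regular:
  assumes "frame F" "exp w \<notin> z ` {1..m}"
  shows "wronskian (\<lambda>r. r) K F w \<noteq> 0"
proof -
  obtain C where "ndet K C \<noteq> 0" "\<And>\<rho> w. wronskian \<rho> K F w = wronskian \<rho> K G w * ndet K C"
    by (rule frame_coeffs[OF assms(1)]) (rule that)
  thus ?thesis using wronskian_G_regular[OF assms(2)] by simp
qed

lemma exists_regular_point:
  obtains w where "exp w \<notin> z ` {1..m}"
proof -
  have "infinite (UNIV - insert 0 (z ` {1..m}))" by (rule Diff_infinite_finite) (auto simp: infinite_UNIV_char_0)
  then obtain x where "x \<notin> insert 0 (z ` {1..m})" by (metis Diff_iff ex_in_conv finite.emptyI)
  thus thesis by (intro that[of "Ln x"]) simp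
qed

lemma frame_G: "frame G"
proof -
  obtain w where "exp w \<notin> z ` {1..m}" by (rule exists_regular_point)
  hence "wronskian (\<lambda>r. r) K G w \<noteq> 0" by (rule wronskian_G_regular)
  moreover have "G k \<in> V" if "k < K" for k
    unfolding V_eq_span using that by (intro cfun.span_base) auto
  ultimately show ?thesis by (auto simp: frame_def)
qed

section \<open>The singular points and the differential operator\<close>

text \<open>The exponents at the singular point \<open>z a\<close> in increasing order, indexed from \<open>0\<close>.\<close>

definition sing_exponent :: "nat \<Rightarrow> nat \<Rightarrow> nat" where
  "sing_exponent a k = (if k < K - M a then k else K - M a + mm a (k - (K - M a) + 1))"

text \<open>The order of the Wronskian at \<open>z a\<close>, and the multiplicity with which \<open>x - z a\<close> can be cancelled from
  all the determinants that Cramer's rule produces.\<close>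

definition wronskian_mult :: "nat \<Rightarrow> nat" where "wronskian_mult a = (\<Sum>b=1..M a. mm a b + 1 - b)"
definition reduced_mult :: "nat \<Rightarrow> nat" where "reduced_mult a = (\<Sum>b=1..M a. mm a b - b)"

lemma wronskian_mult_eq: "a \<in> {1..m} \<Longrightarrow> wronskian_mult a = reduced_mult a + M a"
proof -
  assume a: "a \<in> {1..m}"
  have "wronskian_mult a = (\<Sum>b=1..M a. (mm a b - b) + 1)"
    unfolding wronskian_mult_def by (intro sum.cong refl) (use mm_ge[OF a] in \<open>force\<close>)
  thus ?thesis unfolding reduced_mult_def sum.distrib by simp
qed

lemma sing_exponent_exponent: "a \<in> {1..m} \<Longrightarrow> k < K \<Longrightarrow> sing_exponent a k \<in> exponents V (z a)"
proof -
  assume a: "a \<in> {1..m}" and k: "k < K"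
  show ?thesis
  proof (cases "k < K - M a")
    case False
    hence "k - (K - M a) + 1 \<in> {1..M a}" using k M_le[OF a] by auto
    thus ?thesis using False by (auto simp: sing_exponent_def exps[OF a])
  qed (simp add: sing_exponent_def exps[OF a])
qed

lemma sing_exponent_inj: "a \<in> {1..m} \<Longrightarrow> inj_on (sing_exponent a) {..<K}"
proof -
  assume a: "a \<in> {1..m}"
  have mono: "strict_mono_on {1..M a} (mm a)" using dd_m a by (simp add: degree_data_def)
  have "sing_exponent a k < sing_exponent a k'" if "k < k'" "k' < K" for k k'
  proof -
    consider "k' < K - M a" | "k < K - M a" "\<not> k' < K - M a" | "\<not> k < K - M a" using that by linarith
    thus ?thesis
    proof cases
      case 3
      have "mm a (k - (K - M a) + 1) < mm a (k' - (K - M a) + 1)"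
        using 3 that M_le[OF a] by (intro strict_mono_onD[OF mono]) auto
      thus ?thesis using 3 that by (simp add: sing_exponent_def)
    qed (use that in \<open>auto simp: sing_exponent_def\<close>)
  qed
  hence "strict_mono_on {..<K} (sing_exponent a)" by (auto simp: strict_mono_on_def)
  thus ?thesis by (rule strict_mono_on_imp_inj_on)
qed

lemma sing_exponent_sum: "a \<in> {1..m} \<Longrightarrow> (\<Sum>k<K. sing_exponent a k) = (\<Sum>r<K. r) + wronskian_mult a"
proof -
  assume a: "a \<in> {1..m}"
  have K: "K = (K - M a) + M a" using M_le[OF a] by simp
  have "(\<Sum>k<K. sing_exponent a k) = (\<Sum>k<K - M a. k) + (\<Sum>b<M a. K - M a + mm a (Suc b))"
    by (subst (1) K, subst sum_lessThan_add) (simp add: sing_exponent_def)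
  also have "(\<Sum>b<M a. K - M a + mm a (Suc b)) = (\<Sum>b<M a. (K - M a + b) + (mm a (Suc b) + 1 - Suc b))"
  proof (intro sum.cong refl)
    fix b assume "b \<in> {..<M a}"
    hence "Suc b \<le> mm a (Suc b)" by (intro mm_ge[OF a]) auto
    thus "K - M a + mm a (Suc b) = (K - M a + b) + (mm a (Suc b) + 1 - Suc b)" by simp
  qed
  also have "\<dots> = (\<Sum>b<M a. K - M a + b) + wronskian_mult a"
    unfolding wronskian_mult_def sum_atLeast1_shift sum.distrib by simp
  also have "(\<Sum>k<K - M a. k) + ((\<Sum>b<M a. K - M a + b) + wronskian_mult a) = (\<Sum>r<(K - M a) + M a. r) + wronskian_mult a"
    by (simp add: sum_lessThan_add)
  finally show ?thesis using K by simp
qed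

lemma adapted_at_sing:
  assumes "a \<in> {1..m}" "exp c = z a"
  obtains F g where "adapted c (sing_exponent a) F g"
  by (rule exists_adapted[of "sing_exponent a" c]) (use assms sing_exponent_exponent in \<open>auto intro: that\<close>)

lemma wronskian_poly_order_sing:
  assumes "a \<in> {1..m}"
  shows "order (z a) (wronskian_poly (\<lambda>r. r)) = wronskian_mult a"
proof -
  have c: "exp (Ln (z a)) = z a" using z_nz[OF assms] by simp
  obtain F g where A: "adapted (Ln (z a)) (sing_exponent a) F g"
    by (rule adapted_at_sing[OF assms c]) (rule that)
  show ?thesis using wronskian_poly_order[OF A sing_exponent_inj[OF assms]] sing_exponent_sum[OF assms] c by simp
qed

text \<open>Weight the \<open>M a\<close> columns of large exponent by \<open>m\<^sub>a\<^sub>b\<close> and the other columns by \<open>0\<close>, and a row of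
  order \<open>s\<close> by the excess of \<open>s\<close> over \<open>K - M a\<close>. The orders of the rows are distinct and at most \<open>K\<close>, so
  the row weights add up to at most \<open>1 + \<dots> + M a\<close>, whereas the column weights add up to
  \<open>reduced_mult a\<close> plus this number.\<close>

lemma wronskian_poly_dvd_sing:
  assumes a: "a \<in> {1..m}" and j: "j \<le> K"
  shows "[:- z a, 1:] ^ reduced_mult a dvd wronskian_poly (\<lambda>r. if r = j then K else r)"
proof -
  define c where "c = Ln (z a)"
  have c: "exp c = z a" using z_nz[OF assms(1)] by (simp add: c_def)
  obtain F g where A: "adapted c (sing_exponent a) F g"
    by (rule adapted_at_sing[OF assms(1) c]) (rule that)
  define \<rho> where "\<rho> = (\<lambda>r. if r = j then K else r)"
  define q where "q = K - M a"
  define \<sigma> where "\<sigma> = (\<lambda>r. \<rho> r - q)"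
  define v where "v = (\<lambda>k. if k < q then 0 else mm a (k - q + 1))"
  have F: "F k holomorphic_on UNIV" if "k < K" for k
    using A that by (auto simp: adapted_def intro: V_entire)
  have "\<exists>h. r < K \<longrightarrow> k < K \<longrightarrow> h holomorphic_on UNIV \<and>
      (\<forall>w. (w - c) ^ \<sigma> r * (deriv ^^ \<rho> r) (F k) w = (w - c) ^ v k * h w)" for r k
  proof (cases "k < K")
    case k: True
    show ?thesis
    proof (cases "k < q")
      case True
      thus ?thesis using entire_higher_deriv[OF F[OF k], of "\<rho> r"]
        by (intro exI[of _ "\<lambda>w. (w - c) ^ \<sigma> r * (deriv ^^ \<rho> r) (F k) w"])
           (auto simp: v_def intro!: holomorphic_intros)
    next
      case False
      hence e: "sing_exponent a k = q + v k" by (simp add: sing_exponent_def v_def q_def)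
      have "g k holomorphic_on UNIV" "\<And>w. F k w = (w - c) ^ sing_exponent a k * g k w"
        using A k by (auto simp: adapted_def)
      from euler_power_local[OF this, of "\<rho> r"] obtain h where h: "h holomorphic_on UNIV"
          "\<And>w. (w - c) ^ \<rho> r * (deriv ^^ \<rho> r) (F k) w = (w - c) ^ (q + v k) * h w"
        unfolding e by (elim exE conjE) (rule that, assumption, erule spec)
      have cy: "continuous_on UNIV ((deriv ^^ \<rho> r) (F k))"
        by (intro entire_continuous entire_higher_deriv F k)
      show ?thesis
      proof (cases "q \<le> \<rho> r")
        case True
        have "(w - c) ^ \<sigma> r * (deriv ^^ \<rho> r) (F k) w = (w - c) ^ v k * h w" for w
          by (rule cancel_power[where a = q])
             (use True h cy in \<open>auto intro: entire_continuous simp: \<sigma>_def\<close>)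
        thus ?thesis using h(1) by (intro exI[of _ h]) simp
      next
        case F: False
        have "(w - c) ^ 0 * (deriv ^^ \<rho> r) (F k) w = (w - c) ^ (q - \<rho> r + v k) * h w" for w
          by (rule cancel_power[where a = "\<rho> r"])
             (use F h cy in \<open>auto intro: entire_continuous\<close>)
        hence "(deriv ^^ \<rho> r) (F k) w = (w - c) ^ v k * ((w - c) ^ (q - \<rho> r) * h w)" for w
          unfolding power_add by (simp add: mult_ac)
        thus ?thesis using F h(1)
          by (intro exI[of _ "\<lambda>w. (w - c) ^ (q - \<rho> r) * h w"])
             (auto simp: \<sigma>_def intro!: holomorphic_intros)
      qed
    qed
  qed auto
  hence "\<forall>r. \<exists>h. \<forall>k. r < K \<longrightarrow> k < K \<longrightarrow> h k holomorphic_on UNIV \<and>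
      (\<forall>w. (w - c) ^ \<sigma> r * (deriv ^^ \<rho> r) (F k) w = (w - c) ^ v k * h k w)"
    by (intro allI choice)
  from choice[OF this] obtain h where h: "\<forall>r k. r < K \<longrightarrow> k < K \<longrightarrow> h r k holomorphic_on UNIV \<and>
      (\<forall>w. (w - c) ^ \<sigma> r * (deriv ^^ \<rho> r) (F k) w = (w - c) ^ v k * h r k w)"
    by (elim exE) (rule that)
  define B where "B = (\<lambda>w. ndet K (\<lambda>r k. h r k w))"
  have B: "B holomorphic_on UNIV" unfolding B_def using h by (intro ndet_holomorphic) auto
  have W: "(w - c) ^ (\<Sum>r<K. \<sigma> r) * wronskian \<rho> K F w = (w - c) ^ (\<Sum>k<K. v k) * B w" for w
    unfolding B_def by (rule wronskian_factor) (use h in auto)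
  have q: "K = q + M a" using M_le[OF a] by (simp add: q_def)
  have sv: "(\<Sum>k<K. v k) = reduced_mult a + (\<Sum>b=1..M a. b)"
  proof -
    have "(\<Sum>k<K. v k) = (\<Sum>b<M a. mm a (Suc b))"
      by (subst q, subst sum_lessThan_add) (simp add: v_def)
    also have "\<dots> = (\<Sum>b=1..M a. mm a b)" by (rule sum_atLeast1_shift[symmetric])
    also have "\<dots> = (\<Sum>b=1..M a. (mm a b - b) + b)"
      by (intro sum.cong refl) (use mm_ge[OF a] in force)
    finally show ?thesis unfolding reduced_mult_def sum.distrib .
  qed
  have s\<sigma>: "(\<Sum>r<K. \<sigma> r) \<le> (\<Sum>b=1..M a. b)"
  proof -
    have inj: "inj_on \<rho> {..<K}" by (auto simp: inj_on_def \<rho>_def)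
    have "(\<Sum>r<K. \<sigma> r) = (\<Sum>s\<in>\<rho> ` {..<K}. s - q)"
      unfolding \<sigma>_def by (subst sum.reindex[OF inj]) simp
    also have "\<dots> \<le> (\<Sum>s<Suc K. s - q)"
      by (rule sum_mono2) (auto simp: \<rho>_def)
    also have "\<dots> = (\<Sum>s<q + Suc (M a). s - q)" using q by simp
    also have "\<dots> = (\<Sum>b<Suc (M a). b)" by (subst sum_lessThan_add) simp
    also have "\<dots> = (\<Sum>b=1..M a. b)" unfolding sum_atLeast1_shift sum.lessThan_Suc_shift by simp
    finally show ?thesis .
  qed
  define t where "t = (\<Sum>b=1..M a. b) - (\<Sum>r<K. \<sigma> r)"
  have sv': "(\<Sum>k<K. v k) = (\<Sum>r<K. \<sigma> r) + (reduced_mult a + t)" using sv s\<sigma> by (simp add: t_def)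
  have W': "(w - c) ^ 0 * wronskian \<rho> K F w = (w - c) ^ (reduced_mult a + t) * B w" for w
  proof (rule cancel_power[where a = "\<Sum>r<K. \<sigma> r"])
    show "continuous_on UNIV (wronskian \<rho> K F)" by (intro entire_continuous wronskian_entire F)
  qed (use B W sv' in \<open>auto intro: entire_continuous\<close>)
  obtain C where C: "ndet K C \<noteq> 0" "\<And>\<rho> w. wronskian \<rho> K F w = wronskian \<rho> K G w * ndet K C"
    by (rule frame_coeffs[OF adapted_frame[OF A sing_exponent_inj[OF a]]]) (rule that)
  have "exp ((\<Sum>k<K. L k) * w) * poly (wronskian_poly \<rho>) (exp w) =
      (w - c) ^ reduced_mult a * ((w - c) ^ t * B w / ndet K C)" for w
    using W'[of w] C(1) by (simp add: C(2) wronskian_G field_simps power_add)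
  moreover have "continuous_on UNIV (\<lambda>w. (w - c) ^ t * B w / ndet K C)"
    using C(1) by (intro continuous_intros entire_continuous B) auto
  ultimately have "[:- exp c, 1:] ^ reduced_mult a dvd wronskian_poly \<rho>" by (rule order_of_poly_exp(1))
  thus ?thesis unfolding \<rho>_def c .
qed

definition sing_poly :: "complex poly" where "sing_poly = (\<Prod>a=1..m. [:- z a, 1:] ^ M a)"

text \<open>The origin is treated as one more point, with index \<open>0\<close>.\<close>

lemma points_inj: "inj_on (\<lambda>a. if a = 0 then 0 else z a) {0..m}"
proof (rule inj_onI)
  fix a b assume ab: "a \<in> {0..m}" "b \<in> {0..m}" "(if a = 0 then 0 else z a) = (if b = 0 then 0 else z b)"
  show "a = b"
  proof (cases "a = 0 \<or> b = 0")
    case True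
    thus ?thesis using ab z_nz[of a] z_nz[of b] by (auto split: if_splits)
  next
    case False
    hence "z a = z b" "a \<in> {1..m}" "b \<in> {1..m}" using ab by auto
    thus ?thesis using z_inj by (blast dest: inj_onD)
  qed
qed

text \<open>The Wronskian has no zeros besides \<open>0\<close> and the singular points, and its multiplicities there are
  known.\<close>

lemma wronskian_poly_eq:
  obtains c where "c \<noteq> 0"
    "wronskian_poly (\<lambda>r. r) = Polynomial.smult c ([:- 0, 1:] ^ order_at_zero * (\<Prod>a=1..m. [:- z a, 1:] ^ reduced_mult a) * sing_poly)"
proof -
  define z' where "z' = (\<lambda>a. if a = 0 then 0 else z a)"
  have inj: "inj_on z' {0..m}"
    unfolding z'_def by (rule points_inj)
  have "{x. poly (wronskian_poly (\<lambda>r. r)) x = 0} \<subseteq> z' ` {0..m}"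
  proof safe
    fix x assume x: "poly (wronskian_poly (\<lambda>r. r)) x = 0"
    show "x \<in> z' ` {0..m}"
    proof (cases "x = 0")
      case False
      have "x \<in> z ` {1..m}"
      proof (rule ccontr)
        assume "x \<notin> z ` {1..m}"
        hence "wronskian (\<lambda>r. r) K G (Ln x) \<noteq> 0" using False by (intro wronskian_G_regular) simp
        thus False using x False by (simp add: wronskian_G)
      qed
      then obtain a where "a \<in> {1..m}" "x = z a" by auto
      thus ?thesis by (intro image_eqI[of _ _ a]) (auto simp: z'_def)
    qed (auto simp: z'_def intro!: image_eqI[of _ _ 0])
  qed
  from poly_eq_linear_powers[OF _ inj this]
  have "wronskian_poly (\<lambda>r. r) = Polynomial.smult (lead_coeff (wronskian_poly (\<lambda>r. r)))
      (\<Prod>a\<in>{0..m}. [:- z' a, 1:] ^ order (z' a) (wronskian_poly (\<lambda>r. r)))" by simp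
  also have "{0..m} = insert 0 {1..m}" by auto
  also have "(\<Prod>a\<in>insert 0 {1..m}. [:- z' a, 1:] ^ order (z' a) (wronskian_poly (\<lambda>r. r))) =
      [:- 0, 1:] ^ order_at_zero * (\<Prod>a=1..m. [:- z a, 1:] ^ wronskian_mult a)"
    by (subst prod.insert) (auto simp: z'_def wronskian_poly_at_0 wronskian_poly_order_sing intro!: prod.cong arg_cong2[where f = "(*)"])
  also have "(\<Prod>a=1..m. [:- z a, 1:] ^ wronskian_mult a) = (\<Prod>a=1..m. [:- z a, 1:] ^ reduced_mult a) * sing_poly"
    unfolding sing_poly_def prod.distrib[symmetric] by (intro prod.cong refl) (simp add: wronskian_mult_eq power_add)
  finally show thesis
    by (intro that[of "lead_coeff (wronskian_poly (\<lambda>r. r))"]) (use wronskian_poly_nz in \<open>auto simp: mult.assoc\<close>)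
qed

lemma sing_poly_props: "degree sing_poly = dim_U" "lead_coeff sing_poly = 1" "sing_poly \<noteq> 0"
  "poly sing_poly x = (\<Prod>a=1..m. (x - z a) ^ M a)"
proof -
  show "degree sing_poly = dim_U" unfolding sing_poly_def dim_U_def by (rule degree_linear_powers) simp
  show "lead_coeff sing_poly = 1" unfolding sing_poly_def by (rule lead_coeff_linear_powers)
  thus "sing_poly \<noteq> 0" by auto
  show "poly sing_poly x = (\<Prod>a=1..m. (x - z a) ^ M a)"
    by (simp add: sing_poly_def poly_prod poly_power)
qed

text \<open>Compare degrees in the factorization of the Wronskian. This is the Fuchs relation for the exponents of
  \<open>V\<close>, and numerical nondegeneracy is a rearrangement of it.\<close>

lemma fuchs_relation: "(\<Sum>k<K. gen_degree k) = order_at_zero + (\<Sum>a=1..m. reduced_mult a) + dim_U"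
proof -
  obtain c where c: "c \<noteq> 0"
    "wronskian_poly (\<lambda>r. r) = Polynomial.smult c ([:- 0, 1:] ^ order_at_zero * (\<Prod>a=1..m. [:- z a, 1:] ^ reduced_mult a) * sing_poly)"
    by (rule wronskian_poly_eq) (rule that)
  have nz: "(\<Prod>a=1..m. [:- z a, 1:] ^ reduced_mult a) \<noteq> 0" by auto
  have "(\<Sum>k<K. gen_degree k) = degree ([:- 0, 1:] ^ order_at_zero * (\<Prod>a=1..m. [:- z a, 1:] ^ reduced_mult a) * sing_poly)"
    using degree_wronskian_poly c by simp
  also have "\<dots> = degree ([:- 0, 1:] ^ order_at_zero :: complex poly) + degree (\<Prod>a=1..m. [:- z a, 1:] ^ reduced_mult a) + degree sing_poly"
    using nz sing_poly_props(3) by (simp add: degree_mult_eq)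
  also have "\<dots> = order_at_zero + (\<Sum>a=1..m. reduced_mult a) + dim_U"
    by (simp only: degree_linear_power degree_linear_powers[OF finite_atLeastAtMost] sing_poly_props(1))
  finally show ?thesis .
qed

lemma numerically_nondegenerate_V: "numerically_nondegenerate m M mm n N nn"
proof -
  have "(\<Sum>a=1..m. \<Sum>b=1..M a. int (mm a b) + 1 - int b) = (\<Sum>a=1..m. int (wronskian_mult a))"
    unfolding wronskian_mult_def of_nat_sum
    by (intro sum.cong refl) (use mm_ge in \<open>force simp: of_nat_diff\<close>)
  also have "\<dots> = int ((\<Sum>a=1..m. reduced_mult a) + dim_U)"
    by (simp add: wronskian_mult_eq dim_U_def sum.distrib)
  also have "\<dots> = (\<Sum>k<K. int (gen_degree k)) - int order_at_zero"
    using fuchs_relation by (simp flip: of_nat_sum)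
  also have "\<dots> = (\<Sum>k<K. int (gen_degree k) + 1 - int (snd (ix k)))"
  proof -
    have "int order_at_zero = (\<Sum>k<K. int (snd (ix k)) - 1)"
      unfolding order_at_zero_def of_nat_sum by (intro sum.cong refl) (use ix_range(2) in force)
    thus ?thesis by (simp add: sum_subtractf sum.distrib)
  qed
  also have "\<dots> = (\<Sum>i=1..n. \<Sum>j=1..N i. int (nn i j) + 1 - int j)"
    unfolding gen_degree_def by (rule sum_ix[of "\<lambda>i j. int (nn i j) + 1 - int j"])
  finally show ?thesis by (simp add: numerically_nondegenerate_def)
qed

text \<open>Cramer's rule, divided by the common factor of all the determinants.\<close>

lemma operator_exists:
  obtains A where "\<And>j. j \<le> K \<Longrightarrow> degree (A j) \<le> dim_U" "A K = sing_poly"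
    "\<And>k. k < K \<Longrightarrow> (\<Sum>j\<le>K. A j * (twisted_theta (L k) ^^ j) (gen_poly k)) = 0"
proof -
  define Y where "Y = [:- 0, 1:] ^ order_at_zero * (\<Prod>a=1..m. [:- z a, 1:] ^ reduced_mult a)"
  define Q where "Q = (\<lambda>j. wronskian_poly (\<lambda>r. if r = j then K else r))"
  have Ynz: "Y \<noteq> 0" by (auto simp: Y_def)
  obtain c where c0: "c \<noteq> 0"
    "wronskian_poly (\<lambda>r. r) = Polynomial.smult c ([:- 0, 1:] ^ order_at_zero * (\<Prod>a=1..m. [:- z a, 1:] ^ reduced_mult a) * sing_poly)"
    by (rule wronskian_poly_eq) (rule that)
  note c = c0(1) c0(2)[folded Y_def]
  have Ydvd: "Y dvd Q j" if "j < K" for j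
  proof -
    define z' where "z' = (\<lambda>a. if a = 0 then 0 else z a)"
    define k' where "k' = (\<lambda>a. if a = 0 then order_at_zero else reduced_mult a)"
    have inj: "inj_on z' {0..m}"
      unfolding z'_def by (rule points_inj)
    have "(\<Prod>a\<in>{0..m}. [:- z' a, 1:] ^ k' a) dvd Q j"
    proof (rule linear_powers_dvd[OF _ inj])
      fix a assume "a \<in> {0..m}"
      thus "[:- z' a, 1:] ^ k' a dvd Q j"
        using wronskian_poly_at_0(1) wronskian_poly_dvd_sing[of a j] \<open>j < K\<close> unfolding Q_def z'_def k'_def
        by (cases "a = 0") auto
    qed simp
    also have "{0..m} = insert 0 {1..m}" by auto
    also have "(\<Prod>a\<in>insert 0 {1..m}. [:- z' a, 1:] ^ k' a) = Y"
      unfolding Y_def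
      by (subst prod.insert) (auto simp: z'_def k'_def intro!: prod.cong arg_cong2[where f = "(*)"])
    finally show ?thesis .
  qed
  hence "\<forall>j. \<exists>R. j < K \<longrightarrow> Q j = Y * R" by (auto elim: dvdE)
  from choice[OF this] obtain R where R: "\<forall>j. j < K \<longrightarrow> Q j = Y * R j" by (elim exE) (rule that)
  define A where "A = (\<lambda>j. if j < K then Polynomial.smult (- 1 / c) (R j) else sing_poly)"
  show thesis
  proof (rule that)
    fix j assume "j \<le> K"
    show "degree (A j) \<le> dim_U"
    proof (cases "j < K \<and> R j \<noteq> 0")
      case True
      hence "degree (Q j) = degree Y + degree (R j)" using R Ynz by (simp add: degree_mult_eq)
      moreover have "degree (Q j) \<le> (\<Sum>k<K. gen_degree k)" unfolding Q_def by (rule degree_wronskian_poly_le)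
      moreover have "(\<Sum>k<K. gen_degree k) = degree Y + dim_U"
        using degree_wronskian_poly c Ynz sing_poly_props(1,3) by (simp add: degree_mult_eq)
      ultimately show ?thesis using True c(1) by (simp add: A_def)
    next
      case False
      thus ?thesis using sing_poly_props(1) by (auto simp: A_def)
    qed
  next
    show "A K = sing_poly" by (simp add: A_def)
  next
    fix k assume k: "k < K"
    have "(\<Sum>j<K. Q j * (twisted_theta (L k) ^^ j) (gen_poly k)) = wronskian_poly (\<lambda>r. r) * (twisted_theta (L k) ^^ K) (gen_poly k)"
    proof -
      have "Q j = ndet K (\<lambda>r l. if r = j then (twisted_theta (L l) ^^ K) (gen_poly l) else (twisted_theta (L l) ^^ r) (gen_poly l))" for j
        unfolding Q_def wronskian_poly_def by (rule ndet_cong) simp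
      thus ?thesis unfolding wronskian_poly_def using ndet_cramer[OF k, of "\<lambda>l. (twisted_theta (L l) ^^ K) (gen_poly l)"] by simp
    qed
    hence "Y * (\<Sum>j<K. R j * (twisted_theta (L k) ^^ j) (gen_poly k)) = Y * (Polynomial.smult c sing_poly * (twisted_theta (L k) ^^ K) (gen_poly k))"
      using R c(2) by (simp add: sum_distrib_left mult_ac)
    hence "Y * (\<Sum>j<K. R j * (twisted_theta (L k) ^^ j) (gen_poly k)) = Y * Polynomial.smult c (sing_poly * (twisted_theta (L k) ^^ K) (gen_poly k))"
      by simp
    hence "(\<Sum>j<K. R j * (twisted_theta (L k) ^^ j) (gen_poly k)) = Polynomial.smult c (sing_poly * (twisted_theta (L k) ^^ K) (gen_poly k))"
      by (simp only: mult_left_cancel[OF Ynz])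
    moreover have "(\<Sum>j\<le>K. A j * (twisted_theta (L k) ^^ j) (gen_poly k)) =
        Polynomial.smult (- 1 / c) (\<Sum>j<K. R j * (twisted_theta (L k) ^^ j) (gen_poly k)) + sing_poly * (twisted_theta (L k) ^^ K) (gen_poly k)"
    proof -
      have "(\<Sum>j<K. A j * (twisted_theta (L k) ^^ j) (gen_poly k)) =
          (\<Sum>j<K. [:- 1 / c:] * (R j * (twisted_theta (L k) ^^ j) (gen_poly k)))"
        by (intro sum.cong refl) (simp add: A_def)
      also have "\<dots> = [:- 1 / c:] * (\<Sum>j<K. R j * (twisted_theta (L k) ^^ j) (gen_poly k))"
        by (rule sum_distrib_left[symmetric])
      finally show ?thesis by (simp add: A_def flip: lessThan_Suc_atMost)
    qed
    ultimately show "(\<Sum>j\<le>K. A j * (twisted_theta (L k) ^^ j) (gen_poly k)) = 0" using c(1) by simp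
  qed
qed

end

section \<open>Coefficients with respect to the two derivations\<close>

lemma xddx_eq_deriv: "xddx f = deriv f"
  by (rule ext) (simp add: xddx_def ddx_def)

lemma ddx_iter_entire: "f holomorphic_on UNIV \<Longrightarrow> (ddx ^^ k) f holomorphic_on UNIV"
proof (induction k)
  case (Suc k)
  thus ?case by (auto simp: ddx_def[abs_def] intro!: holomorphic_intros holomorphic_deriv)
qed simp

text \<open>In the notation of the coordinate \<open>x\<close> this is the expansion of \<open>(x d/dx)\<^sup>j\<close> in terms of
  \<open>x\<^sup>k (d/dx)\<^sup>k\<close>.\<close>

lemma higher_deriv_stirling:
  assumes "f holomorphic_on UNIV"
  shows "(deriv ^^ j) f w = (\<Sum>k\<le>j. of_nat (Stirling j k) * (exp w ^ k * (ddx ^^ k) f w))"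
proof (induction j arbitrary: w)
  case (Suc j)
  let ?y = "\<lambda>k. (ddx ^^ k) f"
  have d: "(?y k has_field_derivative exp w * ?y (Suc k) w) (at w)" for k
    using holomorphic_derivI[OF ddx_iter_entire[OF assms, of k] open_UNIV, of w]
    by (simp add: ddx_def)
  have p: "((\<lambda>w. exp w ^ k) has_field_derivative of_nat k * exp w ^ k) (at w)" for k
  proof -
    have "(\<lambda>w::complex. exp w ^ k) = (\<lambda>w. exp (of_nat k * w))" by (simp add: exp_of_nat_mult)
    moreover have "((\<lambda>w. exp (of_nat k * w)) has_field_derivative of_nat k * exp (of_nat k * w)) (at w)"
      by (auto intro!: derivative_eq_intros)
    ultimately show ?thesis by (simp add: exp_of_nat_mult)
  qed
  have q: "((\<lambda>w. exp w ^ k * ?y k w) has_field_derivative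
      (of_nat k * exp w ^ k * ?y k w + exp w ^ k * (exp w * ?y (Suc k) w))) (at w)" for k
    by (rule DERIV_cong[OF DERIV_mult'[OF p d]]) simp
  have "(deriv ^^ Suc j) f w = deriv (\<lambda>w. \<Sum>k\<le>j. of_nat (Stirling j k) * (exp w ^ k * ?y k w)) w"
  proof -
    have "(deriv ^^ j) f = (\<lambda>w. \<Sum>k\<le>j. of_nat (Stirling j k) * (exp w ^ k * ?y k w))"
      by (rule ext) (rule Suc)
    thus ?thesis unfolding funpow.simps comp_def by (rule arg_cong[where f = "\<lambda>g. deriv g w"])
  qed
  also have "\<dots> = (\<Sum>k\<le>j. of_nat (Stirling j k) * (of_nat k * exp w ^ k * ?y k w + exp w ^ k * (exp w * ?y (Suc k) w)))"
    by (intro DERIV_imp_deriv DERIV_sum DERIV_cmult q)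
  also have "\<dots> = (\<Sum>k\<le>j. of_nat (k * Stirling j k) * (exp w ^ k * ?y k w)) +
       (\<Sum>k\<le>j. of_nat (Stirling j k) * (exp w ^ Suc k * ?y (Suc k) w))"
    by (simp add: sum.distrib[symmetric] algebra_simps)
  also have "(\<Sum>k\<le>j. of_nat (k * Stirling j k) * (exp w ^ k * ?y k w)) =
       (\<Sum>k\<le>Suc j. of_nat (k * Stirling j k) * (exp w ^ k * ?y k w))"
    by (simp add: Stirling_less)
  also have "\<dots> = (\<Sum>k\<le>j. of_nat (Suc k * Stirling j (Suc k)) * (exp w ^ Suc k * ?y (Suc k) w))"
    by (subst sum.atMost_Suc_shift) simp
  also have "\<dots> + (\<Sum>k\<le>j. of_nat (Stirling j k) * (exp w ^ Suc k * ?y (Suc k) w)) =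
       (\<Sum>k\<le>j. of_nat (Stirling (Suc j) (Suc k)) * (exp w ^ Suc k * ?y (Suc k) w))"
    by (simp add: sum.distrib[symmetric] algebra_simps)
  also have "\<dots> = (\<Sum>k\<le>Suc j. of_nat (Stirling (Suc j) k) * (exp w ^ k * ?y k w))"
    by (subst sum.atMost_Suc_shift) simp
  finally show ?case .
qed simp

text \<open>The Stirling matrix is unitriangular, so the two kinds of Wronskians differ by a power of \<open>x\<close>.\<close>

lemma ndet_deriv_eq_Wr:
  assumes "\<And>f. f \<in> set fs \<Longrightarrow> f holomorphic_on UNIV" "length fs = k"
  shows "ndet k (\<lambda>i j. (deriv ^^ i) (fs ! j) w) = exp w ^ (\<Sum>i<k. i) * Wr fs w"
proof -
  have "ndet k (\<lambda>i j. (deriv ^^ i) (fs ! j) w) =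
      ndet k (\<lambda>i j. \<Sum>l<k. of_nat (Stirling i l) * (exp w ^ l * (ddx ^^ l) (fs ! j) w))"
  proof (rule ndet_cong)
    fix i j assume ij: "i < k" "j < k"
    have "(deriv ^^ i) (fs ! j) w = (\<Sum>l\<le>i. of_nat (Stirling i l) * (exp w ^ l * (ddx ^^ l) (fs ! j) w))"
      using ij assms by (intro higher_deriv_stirling) auto
    also have "\<dots> = (\<Sum>l<k. of_nat (Stirling i l) * (exp w ^ l * (ddx ^^ l) (fs ! j) w))"
      using ij by (intro sum.mono_neutral_left) (auto simp: Stirling_less)
    finally show "(deriv ^^ i) (fs ! j) w = \<dots>" .
  qed
  also have "\<dots> = ndet k (\<lambda>i j. of_nat (Stirling i j)) * ndet k (\<lambda>l j. exp w ^ l * ((ddx ^^ l) (fs ! j) w * 1))"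
    by (simp add: ndet_mult)
  also have "ndet k (\<lambda>i j. of_nat (Stirling i j) :: complex) = 1"
    by (rule ndet_lower_unitriangular) (auto simp: Stirling_less)
  also have "ndet k (\<lambda>l j. exp w ^ l * ((ddx ^^ l) (fs ! j) w * 1)) =
      exp w ^ (\<Sum>i<k. i) * ndet k (\<lambda>l j. (ddx ^^ l) (fs ! j) w)"
    by (subst ndet_scale) (simp add: power_sum)
  also have "ndet k (\<lambda>l j. (ddx ^^ l) (fs ! j) w) = Wr fs w"
    by (simp add: ndet_def Wr_def assms(2))
  finally show ?thesis by simp
qed

lemma ddx_iter_exp: "(ddx ^^ k) (\<lambda>w. exp (s * w)) = (\<lambda>w. (\<Prod>i<k. s - of_nat i) * exp ((s - of_nat k) * w))"
proof (induction k)
  case (Suc k)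
  have "deriv (\<lambda>w. (\<Prod>i<k. s - of_nat i) * exp ((s - of_nat k) * w)) w =
      (\<Prod>i<k. s - of_nat i) * ((s - of_nat k) * exp ((s - of_nat k) * w))" for w
    by (rule DERIV_imp_deriv) (auto intro!: derivative_eq_intros)
  moreover have "exp ((s - of_nat k) * w) / exp w = exp ((s - of_nat (Suc k)) * w)" for w
    by (simp add: exp_diff[symmetric] algebra_simps)
  ultimately have "ddx (\<lambda>w. (\<Prod>i<k. s - of_nat i) * exp ((s - of_nat k) * w)) w =
      (\<Prod>i<Suc k. s - of_nat i) * exp ((s - of_nat (Suc k)) * w)" for w
    unfolding ddx_def by (simp only: prod.lessThan_Suc mult.assoc times_divide_eq_right[symmetric])
  thus ?case unfolding funpow.simps comp_def Suc by (rule ext)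
qed simp

lemma higher_deriv_exp: "(deriv ^^ k) (\<lambda>w. exp (s * w)) = (\<lambda>w. s ^ k * exp (s * w))" for s :: complex
proof (induction k)
  case (Suc k)
  have "deriv (\<lambda>w. s ^ k * exp (s * w)) w = s ^ Suc k * exp (s * w)" for w
    by (rule DERIV_imp_deriv) (auto intro!: derivative_eq_intros)
  thus ?case unfolding funpow.simps comp_def Suc by (rule ext)
qed simp

context qp_space
begin

text \<open>The operator with coefficients \<open>A j\<close> with respect to \<open>(x d/dx)\<^sup>j\<close> annihilates \<open>V\<close>, as an identity of
  polynomials for each generator.\<close>

definition annihilating :: "(nat \<Rightarrow> complex poly) \<Rightarrow> bool" where
  "annihilating A \<longleftrightarrow> (\<forall>k<K. (\<Sum>j\<le>K. A j * (twisted_theta (L k) ^^ j) (gen_poly k)) = 0)"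

definition theta_op :: "(nat \<Rightarrow> complex poly) \<Rightarrow> (complex \<Rightarrow> complex) \<Rightarrow> complex \<Rightarrow> complex" where
  "theta_op A f w = (\<Sum>j\<le>K. poly (A j) (exp w) * (deriv ^^ j) f w)"

lemma theta_op_G: "theta_op A (G k) w = exp (L k * w) * poly (\<Sum>j\<le>K. A j * (twisted_theta (L k) ^^ j) (gen_poly k)) (exp w)"
  unfolding theta_op_def G_def higher_deriv_quasi_monomial quasi_monomial_def
  by (simp add: poly_sum sum_distrib_left mult_ac)

lemma theta_op_lincomb:
  assumes "finite I" "\<And>k. k \<in> I \<Longrightarrow> F k holomorphic_on UNIV"
  shows "theta_op A (\<lambda>w. \<Sum>k\<in>I. c k * F k w) w = (\<Sum>k\<in>I. c k * theta_op A (F k) w)"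
proof -
  have "theta_op A (\<lambda>w. \<Sum>k\<in>I. c k * F k w) w =
      (\<Sum>j\<le>K. \<Sum>k\<in>I. c k * (poly (A j) (exp w) * (deriv ^^ j) (F k) w))"
  proof -
    have "(deriv ^^ j) (\<lambda>w. \<Sum>k\<in>I. c k * F k w) = (\<lambda>w. \<Sum>k\<in>I. c k * (deriv ^^ j) (F k) w)" for j
      by (rule higher_deriv_lincomb) (use assms in auto)
    thus ?thesis unfolding theta_op_def by (simp add: sum_distrib_left mult_ac)
  qed
  also have "\<dots> = (\<Sum>k\<in>I. c k * theta_op A (F k) w)"
    unfolding theta_op_def by (subst sum.swap) (simp add: sum_distrib_left)
  finally show ?thesis .
qed

lemma annihilating_V: "annihilating A \<Longrightarrow> f \<in> V \<Longrightarrow> theta_op A f w = 0"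
proof -
  assume A: "annihilating A" and "f \<in> V"
  then obtain c where c: "f = (\<lambda>w. \<Sum>k<K. c k * G k w)" unfolding V_eq by auto
  have "theta_op A f w = (\<Sum>k<K. c k * theta_op A (G k) w)"
    unfolding c by (rule theta_op_lincomb) (auto intro: G_entire)
  also have "\<dots> = 0" using A by (simp add: theta_op_G annihilating_def)
  finally show ?thesis .
qed

lemma annihilating_of_V:
  assumes "\<And>f w. f \<in> V \<Longrightarrow> exp w \<notin> S \<Longrightarrow> theta_op A f w = 0" "finite S"
  shows "annihilating A"
  unfolding annihilating_def
proof (intro allI impI)
  fix k assume "k < K"
  hence "G k \<in> V" by (rule frame_V[OF frame_G])
  show "(\<Sum>j\<le>K. A j * (twisted_theta (L k) ^^ j) (gen_poly k)) = 0"
  proof (rule poly_eq_of_exp[OF _ assms(2)])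
    fix w assume "exp w \<notin> S"
    with assms(1)[OF \<open>G k \<in> V\<close>] have "theta_op A (G k) w = 0" by simp
    thus "poly (\<Sum>j\<le>K. A j * (twisted_theta (L k) ^^ j) (gen_poly k)) (exp w) = poly 0 (exp w)"
      by (simp add: theta_op_G)
  qed
qed

lemma sing_poly_nz: "x \<notin> z ` {1..m} \<Longrightarrow> poly sing_poly x \<noteq> 0"
  by (auto simp: sing_poly_props(4))

lemma regularized_of_annihilating:
  assumes "A K = sing_poly" "annihilating A"
  shows "regularized_diff_operator V K m M z (theta_op A)"
proof -
  define b where "b = (\<lambda>k x. (\<Sum>j\<le>K. poly (A j) x * of_nat (Stirling j k)) * x ^ k / (x ^ K * poly sing_poly x))"
  have eq: "exp w ^ K * poly sing_poly (exp w) * diff_operator K b f w = theta_op A f w"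
    if "f holomorphic_on UNIV" "exp w \<notin> z ` {1..m}" for f w
  proof -
    have "exp w ^ K * poly sing_poly (exp w) * diff_operator K b f w =
        (\<Sum>k\<le>K. \<Sum>j\<le>K. poly (A j) (exp w) * (of_nat (Stirling j k) * (exp w ^ k * (ddx ^^ k) f w)))"
      unfolding diff_operator_def sum_distrib_left using sing_poly_nz[OF that(2)]
      by (intro sum.cong refl) (simp add: b_def sum_distrib_right sum_distrib_left field_simps)
    also have "\<dots> = (\<Sum>j\<le>K. poly (A j) (exp w) * (\<Sum>k\<le>K. of_nat (Stirling j k) * (exp w ^ k * (ddx ^^ k) f w)))"
      by (subst sum.swap) (simp add: sum_distrib_left)
    also have "\<dots> = theta_op A f w"
      unfolding theta_op_def
    proof (intro sum.cong refl arg_cong2[where f = "(*)"])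
      fix j assume "j \<in> {..K}"
      thus "(\<Sum>k\<le>K. of_nat (Stirling j k) * (exp w ^ k * (ddx ^^ k) f w)) = (deriv ^^ j) f w"
        unfolding higher_deriv_stirling[OF that(1)]
        by (intro sum.mono_neutral_right) (auto simp: Stirling_less)
    qed
    finally show ?thesis .
  qed
  have "fundamental_diff_operator V K (z ` {1..m}) b"
    unfolding fundamental_diff_operator_def
  proof (intro conjI allI impI ballI)
    fix k assume "k \<le> K"
    show "b k holomorphic_on - insert 0 (z ` {1..m})"
      unfolding b_def using sing_poly_nz
      by (auto intro!: holomorphic_intros simp: poly_altdef[abs_def])
  next
    fix x assume x: "x \<in> - insert 0 (z ` {1..m})"
    have "(\<Sum>j\<le>K. poly (A j) x * of_nat (Stirling j K)) = (\<Sum>j\<le>K. if j = K then poly sing_poly x else 0)"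
      by (intro sum.cong refl) (auto simp: assms(1) Stirling_less)
    thus "b K x = 1" using x sing_poly_nz[of x] by (simp add: b_def)
  next
    fix f w assume "f \<in> V" "exp w \<notin> z ` {1..m}"
    thus "diff_operator K b f w = 0"
      using eq[OF V_entire[OF \<open>f \<in> V\<close>], of w] annihilating_V[OF assms(2), of f w] sing_poly_nz[of "exp w"] by simp
  qed
  thus ?thesis unfolding regularized_diff_operator_def
    using eq by (intro exI[of _ b]) (auto simp: sing_poly_props(4))
qed

text \<open>Apply the operator to \<open>x\<close> to the power \<open>s\<close> and compare the coefficients of \<open>s\<^sup>K\<close>. Thus every
  representation of the regularized operator by constants \<open>A\<^sub>i\<^sub>j\<close> has the two properties from which the
  rest of the proof starts.\<close>

lemma annihilating_of_regularized:
  assumes "regularized_diff_operator V K m M z (theta_op A)"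
  shows "A K = sing_poly" "annihilating A"
proof -
  from assms obtain b where b: "fundamental_diff_operator V K (z ` {1..m}) b"
    "\<And>f w. f holomorphic_on UNIV \<Longrightarrow> exp w \<notin> z ` {1..m} \<Longrightarrow>
        theta_op A f w = exp w ^ K * poly sing_poly (exp w) * diff_operator K b f w"
    unfolding regularized_diff_operator_def sing_poly_props(4) by auto
  show "annihilating A"
  proof (rule annihilating_of_V[where S = "z ` {1..m}"])
    fix f w assume "f \<in> V" "exp w \<notin> z ` {1..m}"
    thus "theta_op A f w = 0" using b V_entire by (simp add: fundamental_diff_operator_def)
  qed simp
  show "A K = sing_poly"
  proof (rule poly_eq_of_exp[where S = "z ` {1..m}"])
    fix w assume w: "exp w \<notin> z ` {1..m}"
    let ?x = "exp w"
    let ?\<phi> = "\<lambda>k. \<Prod>i<k. [:- of_nat i, 1:] :: complex poly"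
    define c where "c = (\<lambda>k. ?x ^ K * poly sing_poly ?x * b k ?x * exp (- of_nat k * w))"
    have "poly (\<Sum>j\<le>K. monom (poly (A j) ?x) j) s = poly (\<Sum>k\<le>K. Polynomial.smult (c k) (?\<phi> k)) s" for s
    proof -
      have "exp (s * w) * poly (\<Sum>j\<le>K. monom (poly (A j) ?x) j) s = theta_op A (\<lambda>w. exp (s * w)) w"
        unfolding theta_op_def higher_deriv_exp
        by (simp add: poly_sum poly_monom sum_distrib_left mult_ac)
      also have "\<dots> = ?x ^ K * poly sing_poly ?x * diff_operator K b (\<lambda>w. exp (s * w)) w"
        by (rule b(2)[OF _ w]) (intro holomorphic_intros)
      also have "\<dots> = exp (s * w) * (\<Sum>k\<le>K. c k * poly (?\<phi> k) s)"
        unfolding diff_operator_def ddx_iter_exp sum_distrib_left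
        by (intro sum.cong refl)
           (simp add: c_def falling_factorial_poly left_diff_distrib exp_diff exp_minus field_simps)
      finally show ?thesis by (simp add: poly_sum)
    qed
    hence "(\<Sum>j\<le>K. monom (poly (A j) ?x) j) = (\<Sum>k\<le>K. Polynomial.smult (c k) (?\<phi> k))"
      by (rule poly_ext)
    hence "coeff (\<Sum>j\<le>K. monom (poly (A j) ?x) j) K = coeff (\<Sum>k\<le>K. Polynomial.smult (c k) (?\<phi> k)) K" by simp
    moreover have "coeff (\<Sum>j\<le>K. monom (poly (A j) ?x) j) K = poly (A K) ?x"
      by (simp add: coeff_sum)
    moreover have "coeff (\<Sum>k\<le>K. Polynomial.smult (c k) (?\<phi> k)) K = (\<Sum>k\<le>K. if k = K then c K else 0)"
      unfolding coeff_sum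
    proof (intro sum.cong refl)
      fix k assume "k \<in> {..K}"
      show "coeff (Polynomial.smult (c k) (?\<phi> k)) K = (if k = K then c K else 0)"
      proof (cases "k = K")
        case True
        have "coeff (?\<phi> K) K = 1"
          using falling_factorial_poly(3)[of K] falling_factorial_poly(2)[of K] by simp
        thus ?thesis using True by simp
      next
        case False
        hence "coeff (?\<phi> k) K = 0"
          using \<open>k \<in> {..K}\<close> falling_factorial_poly(2)[of k] by (intro coeff_eq_0) simp
        thus ?thesis using False by simp
      qed
    qed
    moreover have "c K = poly sing_poly ?x"
    proof -
      have "b K ?x = 1" using b(1) w by (simp add: fundamental_diff_operator_def)
      thus ?thesis by (simp add: c_def exp_minus exp_of_nat_mult)
    qed
    ultimately show "poly (A K) ?x = poly sing_poly ?x" by simp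
  qed simp
qed

section \<open>The conjugate space\<close>

lemma K_pos: "K \<ge> 1"
proof -
  have "1 \<le> N 1" using dd_n n1 by (auto simp: degree_data_def)
  also have "N 1 \<le> K" unfolding K_def using n1 by (intro member_le_sum) auto
  finally show ?thesis .
qed

text \<open>The last column of the inverse of the Wronskian matrix. At zeros of the Wronskian the value is \<open>0\<close>,
  in accordance with the quotients of Wronskians in the definition of the conjugate space.\<close>

definition inverse_column :: "(nat \<Rightarrow> complex \<Rightarrow> complex) \<Rightarrow> nat \<Rightarrow> complex \<Rightarrow> complex" where
  "inverse_column F k w = ncofactor K (\<lambda>r l. (deriv ^^ r) (F l) w) (K - 1) k / wronskian (\<lambda>r. r) K F w"

lemma inverse_column_inverse:
  assumes "wronskian (\<lambda>r. r) K F w \<noteq> 0" "r < K"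
  shows "(\<Sum>k<K. (deriv ^^ r) (F k) w * inverse_column F k w) = (if r = K - 1 then 1 else 0)"
proof -
  have "(\<Sum>k<K. (deriv ^^ r) (F k) w * inverse_column F k w) =
      (\<Sum>k<K. (deriv ^^ r) (F k) w * ncofactor K (\<lambda>r l. (deriv ^^ r) (F l) w) (K - 1) k) / wronskian (\<lambda>r. r) K F w"
    by (simp add: inverse_column_def sum_divide_distrib)
  also have "\<dots> = (if r = K - 1 then 1 else 0)"
    using assms K_pos by (subst ndet_adj_row) (auto simp: wronskian_def)
  finally show ?thesis .
qed

lemma frame_independent:
  assumes "frame F" "\<And>w. (\<Sum>k<K. c k * F k w) = 0" "k < K"
  shows "c k = 0"
proof -
  from assms(1) obtain w where w: "wronskian (\<lambda>r. r) K F w \<noteq> 0" by (auto simp: frame_def)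
  have "(deriv ^^ r) (\<lambda>w. \<Sum>k<K. c k * F k w) w = (\<Sum>k<K. c k * (deriv ^^ r) (F k) w)" for r
    using frame_entire[OF assms(1)] by (subst higher_deriv_lincomb) auto
  moreover have "(\<lambda>w. \<Sum>k<K. c k * F k w) = (\<lambda>w. 0)" using assms(2) by auto
  ultimately have "(\<Sum>k<K. (deriv ^^ r) (F k) w * c k) = 0" for r
    by (simp add: mult.commute)
  thus ?thesis using w assms(3) unfolding wronskian_def by (intro ndet_nonzero_kernel) auto
qed

lemma frame_basis: "frame F \<Longrightarrow> basis_list V (map F [0..<K])"
  by (rule basis_listI) (use frame_independent frame_span in blast)+

lemma frame_expand:
  assumes "frame F" "\<And>j. j < k \<Longrightarrow> H j \<in> V"
  obtains C where "\<And>j. j < k \<Longrightarrow> H j = (\<lambda>w. \<Sum>l<K. C l j * F l w)"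
proof -
  have "\<exists>c. H j = (\<lambda>w. \<Sum>l<K. c l * F l w)" if "j < k" for j
    using assms(2)[OF that] frame_span[OF assms(1)] by auto
  hence "\<forall>j. \<exists>c. j < k \<longrightarrow> H j = (\<lambda>w. \<Sum>l<K. c l * F l w)" by auto
  from choice[OF this] obtain c where "\<forall>j. j < k \<longrightarrow> H j = (\<lambda>w. \<Sum>l<K. c j l * F l w)"
    by (elim exE) (rule that)
  thus thesis by (intro that[of "\<lambda>l j. c j l"]) simp
qed

lemma Wr_basis:
  assumes "frame F" "basis_list V gs"
  obtains d where "d \<noteq> 0" "\<And>w. exp w ^ (\<Sum>i<K. i) * Wr gs w = d * wronskian (\<lambda>r. r) K F w" "length gs = K"
proof -
  have len: "length gs = K" using basis_list_length[OF assms(2) frame_basis[OF assms(1)]] by simp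
  have gV: "g \<in> V" if "g \<in> set gs" for g
    using assms(2) cfun.span_base[OF that] by (simp add: basis_list_def)
  obtain C where C: "\<And>j. j < K \<Longrightarrow> gs ! j = (\<lambda>w. \<Sum>l<K. C l j * F l w)"
    by (rule frame_expand[OF assms(1), of K "(!) gs"]) (use gV len in simp, rule that, simp)
  have "ndet K C \<noteq> 0"
  proof
    assume "ndet K C = 0"
    then obtain c where c: "\<And>i. i < K \<Longrightarrow> (\<Sum>j<K. C i j * c j) = 0" "\<exists>j<K. c j \<noteq> 0"
      by (rule ndet_zero_kernel) (rule that)
    have "(\<Sum>j<length gs. c j * (gs ! j) w) = 0" for w
    proof -
      have "(\<Sum>j<length gs. c j * (gs ! j) w) = (\<Sum>j<K. \<Sum>l<K. C l j * c j * F l w)"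
        by (intro sum.cong) (simp_all add: len C sum_distrib_left mult_ac)
      also have "\<dots> = (\<Sum>l<K. (\<Sum>j<K. C l j * c j) * F l w)"
        by (subst sum.swap) (simp add: sum_distrib_right)
      finally show ?thesis by (simp add: c(1))
    qed
    from basis_listD(2)[OF assms(2) this] c(2) len show False by auto
  qed
  moreover have "exp w ^ (\<Sum>i<K. i) * Wr gs w = ndet K C * wronskian (\<lambda>r. r) K F w" for w
  proof -
    have "exp w ^ (\<Sum>i<K. i) * Wr gs w = wronskian (\<lambda>r. r) K ((!) gs) w"
      unfolding wronskian_def using V_entire gV len by (subst ndet_deriv_eq_Wr) auto
    also have "\<dots> = wronskian (\<lambda>r. r) K F w * ndet K C"
      by (rule wronskian_lincomb) (use frame_entire[OF assms(1)] C in auto)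
    finally show ?thesis by (simp add: mult.commute)
  qed
  ultimately show thesis using len by (rule that)
qed

lemma sum_less_K: "(\<Sum>i<K. i) = (\<Sum>i<K - 1. i) + (K - 1)"
  using K_pos by (metis Suc_diff_1 less_eq_Suc_le One_nat_def sum.lessThan_Suc)

text \<open>Complete the matrix of the \<open>K - 1\<close> given functions by the last unit vector. This vector is the
  Wronskian matrix of the frame times \<open>inverse_column\<close>, and the given functions are the Wronskian matrix
  times constants. Hence the quotient is a determinant with one nonconstant column, expanded
  along that column.\<close>

lemma conjugate_generator:
  assumes F: "frame F" and fs: "set fs \<subseteq> V" "length fs = K - 1" and gs: "basis_list V gs"
  shows "\<exists>\<kappa>. (\<lambda>w. Wr fs w / Wr gs w) = (\<lambda>w. \<Sum>k<K. \<kappa> k * (exp w ^ (K - 1) * inverse_column F k w))"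
proof -
  obtain d where d: "d \<noteq> 0" "\<And>w. exp w ^ (\<Sum>i<K. i) * Wr gs w = d * wronskian (\<lambda>r. r) K F w"
    by (rule Wr_basis[OF F gs]) (rule that)
  have fV: "fs ! j \<in> V" if "j < K - 1" for j
    using fs that nth_mem[of j fs] by auto
  obtain C where C: "\<And>j. j < K - 1 \<Longrightarrow> fs ! j = (\<lambda>w. \<Sum>l<K. C l j * F l w)"
    by (rule frame_expand[OF F, of "K - 1" "(!) fs"]) (erule fV, rule that, simp)
  define \<kappa> where "\<kappa> = (\<lambda>l. ncofactor K C l (K - 1))"
  have "Wr fs w / Wr gs w = (\<Sum>k<K. (\<kappa> k / d) * (exp w ^ (K - 1) * inverse_column F k w))" for w
  proof (cases "wronskian (\<lambda>r. r) K F w = 0")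
    case True
    hence "Wr gs w = 0" using d(2)[of w] by simp
    thus ?thesis using True by (simp add: inverse_column_def)
  next
    case False
    define a where "a = (\<lambda>r k. (deriv ^^ r) (fs ! k) w)"
    have "exp w ^ (\<Sum>i<K - 1. i) * Wr fs w = ndet (K - 1) a"
      unfolding a_def using fs V_entire by (subst ndet_deriv_eq_Wr) auto
    also have "\<dots> = ncofactor K a (K - 1) (K - 1)"
      unfolding ncofactor_def by (simp add: mult_2[symmetric] power_mult cong: ndet_cong) 
    also have "\<dots> = (\<Sum>r<K. (if r = K - 1 then 1 else 0) * ncofactor K a r (K - 1))"
      using K_pos by (simp add: if_distrib[of "\<lambda>x. x * _"] cong: if_cong)
    also have "\<dots> = ndet K (\<lambda>r k. if k = K - 1 then (if r = K - 1 then 1 else 0) else a r k)"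
      using K_pos by (subst ndet_expand_col) auto
    also have "\<dots> = ndet K (\<lambda>r k. \<Sum>l<K. (deriv ^^ r) (F l) w * (if k = K - 1 then inverse_column F l w else C l k))"
    proof (rule ndet_cong)
      fix r k assume rk: "r < K" "k < K"
      show "(if k = K - 1 then (if r = K - 1 then 1 else 0) else a r k) =
          (\<Sum>l<K. (deriv ^^ r) (F l) w * (if k = K - 1 then inverse_column F l w else C l k))"
      proof (cases "k = K - 1")
        case True
        thus ?thesis using inverse_column_inverse[OF False rk(1)] by simp
      next
        case k: False
        hence "k < K - 1" using rk by simp
        have "(deriv ^^ r) (\<lambda>w. \<Sum>l<K. C l k * F l w) w = (\<Sum>l<K. C l k * (deriv ^^ r) (F l) w)"
          using frame_entire[OF F] by (subst higher_deriv_lincomb) auto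
        thus ?thesis using k by (simp add: a_def C[OF \<open>k < K - 1\<close>] mult.commute)
      qed
    qed
    also have "\<dots> = wronskian (\<lambda>r. r) K F w * (\<Sum>l<K. inverse_column F l w * \<kappa> l)"
      unfolding ndet_mult wronskian_def \<kappa>_def using K_pos by (subst ndet_expand_col) auto
    finally have *: "exp w ^ (\<Sum>i<K - 1. i) * Wr fs w = wronskian (\<lambda>r. r) K F w * (\<Sum>l<K. inverse_column F l w * \<kappa> l)" .
    have "Wr fs w / Wr gs w = (exp w ^ (\<Sum>i<K. i) * Wr fs w) / (exp w ^ (\<Sum>i<K. i) * Wr gs w)" by simp
    also have "exp w ^ (\<Sum>i<K. i) * Wr fs w = exp w ^ (K - 1) * (exp w ^ (\<Sum>i<K - 1. i) * Wr fs w)"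
      unfolding sum_less_K power_add by (simp add: mult_ac)
    also have "\<dots> / (exp w ^ (\<Sum>i<K. i) * Wr gs w) = exp w ^ (K - 1) * (\<Sum>l<K. inverse_column F l w * \<kappa> l) / d"
      unfolding * d(2) using False d(1) by (simp add: field_simps)
    finally show ?thesis by (simp add: sum_distrib_left sum_divide_distrib mult_ac)
  qed
  thus ?thesis by (intro exI[of _ "\<lambda>k. \<kappa> k / d"]) auto
qed

lemma conjugate_space_eq:
  assumes F: "frame F"
  shows "conjugate_space V K = {f. \<exists>c. f = (\<lambda>w. \<Sum>k<K. c k * (exp w ^ (K - 1) * inverse_column F k w))}"
    (is "_ = ?R")
proof
  have R: "?R = cfun.span ((\<lambda>k w. exp w ^ (K - 1) * inverse_column F k w) ` {..<K})"
    by (subst span_image_eq) auto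
  show "conjugate_space V K \<subseteq> ?R"
    unfolding conjugate_space_def
  proof (rule cfun.span_minimal)
    show "{\<lambda>w. Wr fs w / Wr gs w | fs gs. set fs \<subseteq> V \<and> length fs = K - 1 \<and> basis_list V gs} \<subseteq> ?R"
      using conjugate_generator[OF F] by blast
    show "cfun.subspace ?R" unfolding R by (rule cfun.subspace_span)
  qed
  show "?R \<subseteq> conjugate_space V K"
    unfolding R
  proof (rule cfun.span_minimal)
    show "cfun.subspace (conjugate_space V K)"
      unfolding conjugate_space_def by (rule cfun.subspace_span)
    show "(\<lambda>k w. exp w ^ (K - 1) * inverse_column F k w) ` {..<K} \<subseteq> conjugate_space V K"
    proof safe
      fix k assume k: "k < K"
      define fs where "fs = map (\<lambda>r. F (insert_index k r)) [0..<K - 1]"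
      have fs: "set fs \<subseteq> V" "length fs = K - 1"
        using k frame_V[OF F] by (auto simp: fs_def insert_index_def)
      have gs: "basis_list V (map F [0..<K])" by (rule frame_basis[OF F])
      have "exp w ^ (K - 1) * inverse_column F k w = (-1) ^ (K - 1 + k) * (Wr fs w / Wr (map F [0..<K]) w)" for w
      proof -
        have 1: "exp w ^ (\<Sum>i<K. i) * Wr (map F [0..<K]) w = wronskian (\<lambda>r. r) K F w"
        proof -
          have "ndet K (\<lambda>i j. (deriv ^^ i) (map F [0..<K] ! j) w) = exp w ^ (\<Sum>i<K. i) * Wr (map F [0..<K]) w"
            using frame_entire[OF F] by (intro ndet_deriv_eq_Wr) auto
          moreover have "ndet K (\<lambda>i j. (deriv ^^ i) (map F [0..<K] ! j) w) = wronskian (\<lambda>r. r) K F w"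
            unfolding wronskian_def by (rule ndet_cong) simp
          ultimately show ?thesis by simp
        qed
        have 2: "exp w ^ (\<Sum>i<K - 1. i) * Wr fs w =
            ndet (K - 1) (\<lambda>r l. (deriv ^^ insert_index (K - 1) r) (F (insert_index k l)) w)"
        proof -
          have "ndet (K - 1) (\<lambda>i j. (deriv ^^ i) (fs ! j) w) = exp w ^ (\<Sum>i<K - 1. i) * Wr fs w"
            using fs V_entire by (intro ndet_deriv_eq_Wr) auto
          moreover have "ndet (K - 1) (\<lambda>i j. (deriv ^^ i) (fs ! j) w) =
              ndet (K - 1) (\<lambda>r l. (deriv ^^ insert_index (K - 1) r) (F (insert_index k l)) w)"
            by (rule ndet_cong) (simp add: fs_def)
          ultimately show ?thesis by simp
        qed
        have "inverse_column F k w = (-1) ^ (K - 1 + k) * ((exp w ^ (\<Sum>i<K - 1. i) * Wr fs w) /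
            (exp w ^ (\<Sum>i<K. i) * Wr (map F [0..<K]) w))"
          unfolding inverse_column_def ncofactor_def 1 2 by simp
        thus ?thesis unfolding sum_less_K power_add by simp
      qed
      hence "(\<lambda>w. exp w ^ (K - 1) * inverse_column F k w) = (\<lambda>w. (-1) ^ (K - 1 + k) * (Wr fs w / Wr (map F [0..<K]) w))"
        by auto
      also have "\<dots> \<in> conjugate_space V K"
        unfolding conjugate_space_def
        by (intro cfun.span_scale cfun.span_base) (use fs gs in blast)
      finally show "(\<lambda>w. exp w ^ (K - 1) * inverse_column F k w) \<in> conjugate_space V K" .
    qed
  qed
qed

text \<open>The power of \<open>x\<close> that comes from passing between the two derivations leaves a single factor \<open>x\<close>
  in the denominator.\<close>

definition reg_conjugate :: "(nat \<Rightarrow> complex \<Rightarrow> complex) \<Rightarrow> nat \<Rightarrow> complex \<Rightarrow> complex" where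
  "reg_conjugate F k w = inverse_column F k w / (exp w * poly sing_poly (exp w))"

lemma regularized_conjugate_space_eq:
  assumes "frame F"
  shows "regularized_conjugate_space V K m M z = {f. \<exists>c. f = (\<lambda>w. \<Sum>k<K. c k * reg_conjugate F k w)}"
proof -
  have e: "exp w ^ K = exp w * exp w ^ (K - 1)" for w :: complex
    using K_pos by (cases K) auto
  have *: "(\<Sum>k<K. c k * (exp w ^ (K - 1) * inverse_column F k w)) / (exp w ^ K * (\<Prod>a=1..m. (exp w - z a) ^ M a)) =
     (\<Sum>k<K. c k * reg_conjugate F k w)" for c w
    unfolding sum_divide_distrib e sing_poly_props(4)[symmetric]
    by (intro sum.cong refl) (simp add: reg_conjugate_def)
  have R: "{f. \<exists>c. f = (\<lambda>w. g c w)} = range g" for g :: "(nat \<Rightarrow> complex) \<Rightarrow> complex \<Rightarrow> complex"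
    by auto
  show ?thesis
    unfolding regularized_conjugate_space_def conjugate_space_eq[OF assms] R image_image * ..
qed

end

section \<open>Contour integrals around the singular points\<close>

lemma log_branch_props:
  assumes "exp c = \<zeta>" "x \<in> ball \<zeta> (cmod \<zeta>)"
  shows "x \<noteq> 0" "exp (log_branch \<zeta> c x) = x"
    "(log_branch \<zeta> c has_field_derivative 1 / x) (at x)"
proof -
  have \<zeta>: "\<zeta> \<noteq> 0" using assms(1) by auto
  show x: "x \<noteq> 0" using assms(2) by (auto simp: dist_norm)
  show "exp (log_branch \<zeta> c x) = x"
    using \<zeta> x assms(1) by (simp add: log_branch_def exp_add)
  have "cmod (x / \<zeta> - 1) < 1"
  proof -
    have "x / \<zeta> - 1 = (x - \<zeta>) / \<zeta>" using \<zeta> by (simp add: field_simps)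
    thus ?thesis using assms(2) \<zeta> by (simp add: norm_divide dist_norm norm_minus_commute)
  qed
  hence "\<bar>Re (x / \<zeta> - 1)\<bar> < 1" using abs_Re_le_cmod[of "x / \<zeta> - 1"] by linarith
  hence "0 < Re (x / \<zeta>)" by simp
  hence "x / \<zeta> \<notin> \<real>\<^sub>\<le>\<^sub>0" by (auto simp: complex_nonpos_Reals_iff)
  hence "((\<lambda>x. c + Ln (x / \<zeta>)) has_field_derivative 1 / x) (at x)"
    using \<zeta> x by (auto intro!: derivative_eq_intros simp: field_simps)
  thus "(log_branch \<zeta> c has_field_derivative 1 / x) (at x)"
    by (simp add: log_branch_def[abs_def])
qed

lemma log_branch_centre: "exp c = \<zeta> \<Longrightarrow> log_branch \<zeta> c \<zeta> = c"
  by (auto simp: log_branch_def)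

text \<open>Each differentiation multiplies \<open>x\<close> to the power \<open>u\<close> by a polynomial in \<open>u\<close> of one degree more,
  with leading coefficient \<open>1 / x\<close>.\<close>

lemma higher_deriv_power_times:
  assumes D: "open D" "0 \<notin> D" and Lg: "\<And>x. x \<in> D \<Longrightarrow> (Lg has_field_derivative 1 / x) (at x)"
    and H: "H holomorphic_on D"
  shows "\<exists>h. (\<forall>k. h k holomorphic_on D) \<and> (\<forall>x\<in>D. h j x = H x / x ^ j) \<and>
     (\<forall>u. \<forall>x\<in>D. (deriv ^^ j) (\<lambda>x. exp (u * Lg x) * H x) x = exp (u * Lg x) * (\<Sum>k\<le>j. u ^ k * h k x))"
proof (induction j)
  case 0
  show ?case using H by (intro exI[of _ "\<lambda>_. H"]) auto
next
  case (Suc j)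
  from Suc obtain h where h: "\<forall>k. h k holomorphic_on D" "\<forall>x\<in>D. h j x = H x / x ^ j"
    "\<forall>u. \<forall>x\<in>D. (deriv ^^ j) (\<lambda>x. exp (u * Lg x) * H x) x = exp (u * Lg x) * (\<Sum>k\<le>j. u ^ k * h k x)"
    by (elim exE conjE) (rule that)
  define h' where "h' = (\<lambda>k x. (if k = 0 then 0 else h (k - 1) x / x) + (if k \<le> j then deriv (h k) x else 0))"
  have "h' k holomorphic_on D" for k
    unfolding h'_def using h(1) D
    by (cases "k = 0"; cases "k \<le> j") (auto intro!: holomorphic_intros holomorphic_deriv)
  moreover have "h' (Suc j) x = H x / x ^ Suc j" if "x \<in> D" for x
    using h(2) that by (simp add: h'_def)
  moreover have "(deriv ^^ Suc j) (\<lambda>x. exp (u * Lg x) * H x) x = exp (u * Lg x) * (\<Sum>k\<le>Suc j. u ^ k * h' k x)"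
    if x: "x \<in> D" for u x
  proof -
    let ?g = "\<lambda>x. exp (u * Lg x) * (\<Sum>k\<le>j. u ^ k * h k x)"
    have hd: "(h k has_field_derivative deriv (h k) x) (at x)" for k
      using h(1) holomorphic_derivI[OF _ D(1) x] by blast
    have 1: "((\<lambda>x. exp (u * Lg x)) has_field_derivative exp (u * Lg x) * (u * (1 / x))) (at x)"
      by (rule DERIV_fun_exp) (rule DERIV_cmult[OF Lg[OF x]])
    have 2: "((\<lambda>x. \<Sum>k\<le>j. u ^ k * h k x) has_field_derivative (\<Sum>k\<le>j. u ^ k * deriv (h k) x)) (at x)"
      by (intro DERIV_sum DERIV_cmult hd)
    have g: "(?g has_field_derivative exp (u * Lg x) * (\<Sum>k\<le>j. u ^ k * deriv (h k) x) +
        exp (u * Lg x) * (u * (1 / x)) * (\<Sum>k\<le>j. u ^ k * h k x)) (at x)"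
      by (rule DERIV_mult'[OF 1 2])
    have "((deriv ^^ j) (\<lambda>x. exp (u * Lg x) * H x) has_field_derivative
        exp (u * Lg x) * (\<Sum>k\<le>j. u ^ k * deriv (h k) x) +
        exp (u * Lg x) * (u * (1 / x)) * (\<Sum>k\<le>j. u ^ k * h k x)) (at x)"
      by (rule has_field_derivative_transform_within_open[OF g D(1) x]) (use h(3) in simp)
    hence "(deriv ^^ Suc j) (\<lambda>x. exp (u * Lg x) * H x) x =
        exp (u * Lg x) * (\<Sum>k\<le>j. u ^ k * deriv (h k) x) +
        exp (u * Lg x) * (u * (1 / x)) * (\<Sum>k\<le>j. u ^ k * h k x)"
      unfolding funpow.simps comp_def by (rule DERIV_imp_deriv)
    also have "\<dots> = exp (u * Lg x) * ((\<Sum>k\<le>j. u ^ k * deriv (h k) x) + (\<Sum>k\<le>j. u ^ Suc k * (h k x / x)))"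
      by (simp add: distrib_left sum_distrib_left mult_ac)
    also have "(\<Sum>k\<le>j. u ^ k * deriv (h k) x) = (\<Sum>k\<le>Suc j. u ^ k * (if k \<le> j then deriv (h k) x else 0))"
      by simp
    also have "(\<Sum>k\<le>j. u ^ Suc k * (h k x / x)) = (\<Sum>k\<le>Suc j. u ^ k * (if k = 0 then 0 else h (k - 1) x / x))"
      by (subst sum.atMost_Suc_shift) simp
    also have "(\<Sum>k\<le>Suc j. u ^ k * (if k \<le> j then deriv (h k) x else 0)) + \<dots> = (\<Sum>k\<le>Suc j. u ^ k * h' k x)"
      unfolding h'_def distrib_left sum.distrib by (rule add.commute)
    finally show ?thesis .
  qed
  ultimately show ?case by (intro exI[of _ h'] conjI) auto
qed

text \<open>Cauchy's formula for the \<open>j\<close>-th derivative. The coefficient of \<open>u\<^sup>j\<close> is a nonzero multiple of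
  \<open>H \<zeta>\<close>.\<close>

lemma circle_integral_pole:
  assumes c: "exp c = \<zeta>" and r: "0 < r"
    and D: "open D" "cball \<zeta> r \<subseteq> D" "D \<subseteq> ball \<zeta> (cmod \<zeta>)"
    and H: "H holomorphic_on D" "H \<zeta> \<noteq> 0"
  obtains q where "degree q = j"
    "\<And>u. ((\<lambda>x. exp (u * log_branch \<zeta> c x) * (H x / (x - \<zeta>) ^ Suc j)) has_contour_integral
        exp (u * c) * poly q u) (circlepath \<zeta> r)"
proof -
  let ?Lg = "log_branch \<zeta> c"
  have Lg: "\<And>x. x \<in> D \<Longrightarrow> (?Lg has_field_derivative 1 / x) (at x)"
    using log_branch_props(3)[OF c] D(3) by blast
  have D0: "0 \<notin> D" using log_branch_props(1)[OF c] D(3) by blast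
  have \<zeta>D: "\<zeta> \<in> D" using D(2) r by auto
  have \<zeta>0: "\<zeta> \<noteq> 0" using c by auto
  have "\<exists>h. (\<forall>k. h k holomorphic_on D) \<and> (\<forall>x\<in>D. h j x = H x / x ^ j) \<and>
     (\<forall>u. \<forall>x\<in>D. (deriv ^^ j) (\<lambda>x. exp (u * ?Lg x) * H x) x = exp (u * ?Lg x) * (\<Sum>k\<le>j. u ^ k * h k x))"
    by (rule higher_deriv_power_times[OF D(1) D0 _ H(1)]) (rule Lg)
  then obtain h where
    h: "\<forall>k. h k holomorphic_on D" "\<forall>x\<in>D. h j x = H x / x ^ j"
    "\<forall>u. \<forall>x\<in>D. (deriv ^^ j) (\<lambda>x. exp (u * ?Lg x) * H x) x = exp (u * ?Lg x) * (\<Sum>k\<le>j. u ^ k * h k x)"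
    by (elim exE conjE) (rule that)
  define C where "C = 2 * pi * \<i> / fact j"
  have C0: "C \<noteq> 0" by (simp add: C_def)
  define q where "q = (\<Sum>k\<le>j. monom (C * h k \<zeta>) k)"
  have "coeff q j \<noteq> 0"
    using h(2) \<zeta>D H(2) \<zeta>0 C0 by (simp add: q_def coeff_sum)
  moreover have "degree q \<le> j"
    unfolding q_def by (rule degree_sum_le) (auto intro: order_trans[OF degree_monom_le])
  ultimately have "degree q = j" using le_degree[of q j] by simp
  moreover have "((\<lambda>x. exp (u * ?Lg x) * (H x / (x - \<zeta>) ^ Suc j)) has_contour_integral
        exp (u * c) * poly q u) (circlepath \<zeta> r)" for u
  proof -
    have Lgh: "?Lg holomorphic_on D"
      using Lg D(1) by (auto simp: holomorphic_on_open)
    have f: "(\<lambda>x. exp (u * ?Lg x) * H x) holomorphic_on D"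
      by (intro holomorphic_intros Lgh H(1))
    have "((\<lambda>x. (exp (u * ?Lg x) * H x) / (x - \<zeta>) ^ Suc j) has_contour_integral
        (2 * pi * \<i>) / fact j * (deriv ^^ j) (\<lambda>x. exp (u * ?Lg x) * H x) \<zeta>) (circlepath \<zeta> r)"
    proof (rule Cauchy_has_contour_integral_higher_derivative_circlepath)
      show "continuous_on (cball \<zeta> r) (\<lambda>x. exp (u * ?Lg x) * H x)"
        using f D(2) by (meson holomorphic_on_imp_continuous_on continuous_on_subset)
      show "(\<lambda>x. exp (u * ?Lg x) * H x) holomorphic_on ball \<zeta> r"
        using f D(2) ball_subset_cball by (meson holomorphic_on_subset order_trans)
      show "\<zeta> \<in> ball \<zeta> r" using r by simp
    qed
    moreover have "(2 * pi * \<i>) / fact j * (deriv ^^ j) (\<lambda>x. exp (u * ?Lg x) * H x) \<zeta> = exp (u * c) * poly q u"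
    proof -
      have "(deriv ^^ j) (\<lambda>x. exp (u * ?Lg x) * H x) \<zeta> = exp (u * c) * (\<Sum>k\<le>j. u ^ k * h k \<zeta>)"
        using h(3) \<zeta>D by (simp add: log_branch_centre[OF c])
      thus ?thesis unfolding C_def[symmetric]
        by (simp add: q_def poly_sum poly_monom sum_distrib_left mult_ac)
    qed
    ultimately show ?thesis by simp
  qed
  ultimately show thesis by (rule that)
qed

lemma circle_integral_regular:
  assumes c: "exp c = \<zeta>" and D: "open D" "cball \<zeta> r \<subseteq> D" "D \<subseteq> ball \<zeta> (cmod \<zeta>)" "0 < r"
    and H: "H holomorphic_on D"
  shows "((\<lambda>x. exp (u * log_branch \<zeta> c x) * H x) has_contour_integral 0) (circlepath \<zeta> r)"
proof -
  have Lg: "\<And>x. x \<in> D \<Longrightarrow> (log_branch \<zeta> c has_field_derivative 1 / x) (at x)"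
    using log_branch_props(3)[OF c] D(3) by blast
  hence Lgh: "log_branch \<zeta> c holomorphic_on D"
    using D(1) by (auto simp: holomorphic_on_open)
  have "(\<lambda>x. exp (u * log_branch \<zeta> c x) * H x) holomorphic_on D"
    by (intro holomorphic_intros Lgh H)
  hence "(\<lambda>x. exp (u * log_branch \<zeta> c x) * H x) holomorphic_on cball \<zeta> r"
    using D(2) by (rule holomorphic_on_subset)
  thus ?thesis
    by (rule Cauchy_theorem_convex_simple) (use D(4) in auto)
qed

text \<open>The operator is a parameter, because the last part of the theorem concerns an arbitrary
  representation of the regularized operator.\<close>

locale bispectral_setting = qp_space +
  fixes l :: "nat \<Rightarrow> complex" and r :: "nat \<Rightarrow> real" and A :: "nat \<Rightarrow> complex poly"
  assumes l: "\<And>a. a \<in> {1..m} \<Longrightarrow> exp (l a) = z a"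
    and radii: "small_radii m z r"
    and A_lead: "A K = sing_poly" and A_annihilating: "annihilating A"
    and A_degree: "\<And>j. j \<le> K \<Longrightarrow> degree (A j) \<le> dim_U"
begin

abbreviation Lg :: "nat \<Rightarrow> complex \<Rightarrow> complex" where "Lg a \<equiv> log_branch (z a) (l a)"

text \<open>A neighbourhood of the disc bounded by the circle around \<open>z a\<close> on which the branch of the logarithm is
  holomorphic and \<open>z a\<close> is the only singular point.\<close>

definition log_domain :: "nat \<Rightarrow> complex set" where
  "log_domain a = ball (z a) (cmod (z a)) - z ` ({1..m} - {a})"

lemma log_domain:
  assumes "a \<in> {1..m}"
  shows "open (log_domain a)" "cball (z a) (r a) \<subseteq> log_domain a" "log_domain a \<subseteq> ball (z a) (cmod (z a))" "z a \<in> log_domain a" "0 < r a"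
    "\<And>x. x \<in> log_domain a \<Longrightarrow> x \<noteq> z a \<Longrightarrow> x \<notin> z ` {1..m}"
proof -
  have r: "0 < r a" "r a < cmod (z a)" "\<And>b. b \<in> {1..m} \<Longrightarrow> b \<noteq> a \<Longrightarrow> r a < dist (z a) (z b)"
    using radii assms unfolding small_radii_def by auto
  show "open (log_domain a)" unfolding log_domain_def by (intro open_Diff finite_imp_closed) auto
  show "cball (z a) (r a) \<subseteq> log_domain a" using r by (force simp: log_domain_def)
  show "log_domain a \<subseteq> ball (z a) (cmod (z a))" by (auto simp: log_domain_def)
  show "0 < r a" by (rule r)
  show "z a \<in> log_domain a" using \<open>cball (z a) (r a) \<subseteq> log_domain a\<close> r(1) by auto
  fix x assume "x \<in> log_domain a" "x \<noteq> z a"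
  thus "x \<notin> z ` {1..m}" by (auto simp: log_domain_def)
qed

lemma Lg:
  assumes "a \<in> {1..m}" "x \<in> log_domain a"
  shows "x \<noteq> 0" "exp (Lg a x) = x" "(Lg a has_field_derivative 1 / x) (at x)"
  using log_branch_props[OF l[OF assms(1)], of x] log_domain(3)[OF assms(1)] assms(2) by auto

lemma Lg_centre: "a \<in> {1..m} \<Longrightarrow> Lg a (z a) = l a"
  using log_branch_centre[OF l] by auto

lemma Lg_holomorphic: "a \<in> {1..m} \<Longrightarrow> Lg a holomorphic_on log_domain a"
  using Lg(3) log_domain(1) by (auto simp: holomorphic_on_open)

lemma compose_Lg: "a \<in> {1..m} \<Longrightarrow> f holomorphic_on UNIV \<Longrightarrow> (\<lambda>x. f (Lg a x)) holomorphic_on log_domain a"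
  using holomorphic_on_compose[OF Lg_holomorphic, of a f] holomorphic_on_subset[of f UNIV]
  by (auto simp: comp_def)

lemma circle_in_log_domain:
  assumes "a \<in> {1..m}"
  shows "path_image (circlepath (z a) (r a)) \<subseteq> log_domain a - {z a}"
proof -
  have "path_image (circlepath (z a) (r a)) = sphere (z a) (r a)"
    using log_domain(5)[OF assms] by (simp add: path_image_circlepath)
  moreover have "sphere (z a) (r a) \<subseteq> cball (z a) (r a) - {z a}" using log_domain(5)[OF assms] by auto
  ultimately show ?thesis using log_domain(2)[OF assms] by blast
qed

lemma sum_insert_index:
  fixes e :: "nat \<Rightarrow> nat"
  assumes "k < K"
  shows "(\<Sum>j<K - 1. e (insert_index k j)) + e k = (\<Sum>j<K. e j)"
proof -
  have K: "Suc (K - 1) = K" using K_pos by simp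
  have "(\<Sum>j<K - 1. e (insert_index k j)) = (\<Sum>j\<in>insert_index k ` {0..<K - 1}. e j)"
    by (subst sum.reindex[OF insert_index_inj_on]) (simp add: lessThan_atLeast0)
  also have "insert_index k ` {0..<K - 1} = {..<K} - {k}"
    using insert_index_image[of k "K - 1"] assms K by (simp add: lessThan_atLeast0)
  finally show ?thesis using assms by (simp add: sum.remove[of "{..<K}" k e])
qed

text \<open>Both the Wronskian and the minor in the numerator of \<open>inverse_column\<close> are Wronskians of functions
  of known orders. The total says that the order of \<open>reg_conjugate F k\<close> at \<open>z a\<close> is
  \<open>K - 1 - M a - sing_exponent a k\<close>; the equation avoids negative exponents.\<close>

lemma local_shape:
  assumes a: "a \<in> {1..m}" and F: "adapted (l a) (sing_exponent a) F g" and k: "k < K"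
  obtains H where "H holomorphic_on log_domain a" "H (z a) \<noteq> 0"
    "\<And>x. x \<in> log_domain a - {z a} \<Longrightarrow> reg_conjugate F k (Lg a x) * (x - z a) ^ (M a + sing_exponent a k) = (x - z a) ^ (K - 1) * H x"
proof -
  let ?e = "sing_exponent a" and ?c = "l a" and ?\<zeta> = "z a"
  obtain B where B: "B holomorphic_on UNIV" "B ?c \<noteq> 0" "(\<Sum>r<K. r) \<le> (\<Sum>k<K. ?e k)"
    "\<And>w. wronskian (\<lambda>r. r) K F w = (w - ?c) ^ ((\<Sum>k<K. ?e k) - (\<Sum>r<K. r)) * B w"
    by (rule adapted_wronskian[OF F sing_exponent_inj[OF a]]) (rule that)
  have inj: "inj_on (\<lambda>j. ?e (insert_index k j)) {..<K - 1}"
  proof -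
    have "insert_index k ` {..<K - 1} \<subseteq> {..<K}" using k by (auto simp: insert_index_def)
    hence "inj_on (?e \<circ> insert_index k) {..<K - 1}"
      by (intro comp_inj_on insert_index_inj_on inj_on_subset[OF sing_exponent_inj[OF a]])
    thus ?thesis by (simp add: comp_def)
  qed
  have ii: "insert_index k j < K" if "j < K - 1" for j using that k by (auto simp: insert_index_def)
  obtain B' where B': "B' holomorphic_on UNIV" "B' ?c \<noteq> 0"
    "(\<Sum>r<K - 1. r) \<le> (\<Sum>j<K - 1. ?e (insert_index k j))"
    "\<And>w. wronskian (\<lambda>r. r) (K - 1) (\<lambda>j. F (insert_index k j)) w =
        (w - ?c) ^ ((\<Sum>j<K - 1. ?e (insert_index k j)) - (\<Sum>r<K - 1. r)) * B' w"
    by (rule wronskian_order[of "K - 1" "\<lambda>j. g (insert_index k j)" ?c "\<lambda>j. F (insert_index k j)" "\<lambda>j. ?e (insert_index k j)"])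
       (use F ii inj in \<open>simp_all add: adapted_def that\<close>)
  define \<beta> where "\<beta> = (\<Sum>k<K. ?e k) - (\<Sum>r<K. r)"
  define \<alpha> where "\<alpha> = (\<Sum>j<K - 1. ?e (insert_index k j)) - (\<Sum>r<K - 1. r)"
  have \<alpha>\<beta>: "\<alpha> + ?e k = \<beta> + (K - 1)"
    using sum_insert_index[OF k, of ?e] B(3) B'(3) sum_less_K unfolding \<alpha>_def \<beta>_def by linarith
  obtain \<psi> where \<psi>: "\<psi> holomorphic_on UNIV" "\<psi> ?c \<noteq> 0" "\<And>w. exp w - exp ?c = (w - ?c) * \<psi> w"
    by (rule exp_minus_exp_factor) (rule that)
  define R where "R = (\<lambda>x. \<Prod>b\<in>{1..m} - {a}. (x - z b) ^ M b)"
  define s where "s = ((-1) ^ (K - 1 + k) :: complex)"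
  \<comment> \<open>\<open>R x\<close> collects the other singular points, and the powers of \<open>\<psi>\<close> turn powers of \<open>w - l a\<close> into powers of \<open>x - z a\<close>\<close>
  define H where "H = (\<lambda>x. s * B' (Lg a x) * \<psi> (Lg a x) ^ \<beta> / (B (Lg a x) * x * R x * \<psi> (Lg a x) ^ \<alpha>))"
  have xz: "x - ?\<zeta> = (Lg a x - ?c) * \<psi> (Lg a x)" if "x \<in> log_domain a" for x
    using \<psi>(3)[of "Lg a x"] Lg(2)[OF a that] l[OF a] by simp
  have R0: "R x \<noteq> 0" if "x \<in> log_domain a" for x
    using that by (auto simp: R_def log_domain_def)
  have \<psi>0: "\<psi> (Lg a x) \<noteq> 0" if "x \<in> log_domain a" for x
    using xz[OF that] \<psi>(2) Lg_centre[OF a] by (cases "x = ?\<zeta>") auto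
  have frame: "frame F" by (rule adapted_frame[OF F sing_exponent_inj[OF a]])
  have W0: "wronskian (\<lambda>r. r) K F (Lg a x) \<noteq> 0" if "x \<in> log_domain a" "x \<noteq> ?\<zeta>" for x
    by (rule frame_regular[OF frame]) (use log_domain(6)[OF a that] Lg(2)[OF a that(1)] in simp)
  have B0: "B (Lg a x) \<noteq> 0" if "x \<in> log_domain a" for x
    using W0[OF that] B(2) B(4)[of "Lg a x"] Lg_centre[OF a] by (cases "x = ?\<zeta>") auto
  have "H holomorphic_on log_domain a"
    unfolding H_def R_def
    by (intro holomorphic_intros compose_Lg[OF a] B(1) B'(1) \<psi>(1))
       (use B0 \<psi>0 R0 Lg(1)[OF a] in \<open>auto simp: R_def\<close>)
  moreover have "H ?\<zeta> \<noteq> 0"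
    using B0[OF log_domain(4)[OF a]] B'(2) \<psi>0[OF log_domain(4)[OF a]] R0[OF log_domain(4)[OF a]] Lg(1)[OF a log_domain(4)[OF a]]
    by (simp add: H_def s_def Lg_centre[OF a])
  moreover have "reg_conjugate F k (Lg a x) * (x - ?\<zeta>) ^ (M a + ?e k) = (x - ?\<zeta>) ^ (K - 1) * H x"
    if x: "x \<in> log_domain a - {?\<zeta>}" for x
  proof -
    define w where "w = Lg a x"
    define t where "t = w - ?c"
    have xD: "x \<in> log_domain a" "x \<noteq> ?\<zeta>" using x by auto
    have t: "x - ?\<zeta> = t * \<psi> w" using xz[OF xD(1)] by (simp add: t_def w_def)
    have t0: "t \<noteq> 0" using t xD(2) by auto
    have nz: "\<psi> w \<noteq> 0" "B w \<noteq> 0" "R x \<noteq> 0" "x \<noteq> 0" "x - ?\<zeta> \<noteq> 0"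
      using \<psi>0 B0 R0 Lg(1)[OF a] xD by (simp_all add: w_def)
    have "ncofactor K (\<lambda>r l. (deriv ^^ r) (F l) w) (K - 1) k = s * wronskian (\<lambda>r. r) (K - 1) (\<lambda>j. F (insert_index k j)) w"
      unfolding ncofactor_def wronskian_def s_def by (intro arg_cong2[where f = "(*)"] refl ndet_cong) simp
    hence v: "inverse_column F k w = s * (t ^ \<alpha> * B' w) / (t ^ \<beta> * B w)"
      unfolding inverse_column_def B(4) B'(4) \<alpha>_def \<beta>_def t_def by (simp only:)
    have Al: "poly sing_poly x = (x - ?\<zeta>) ^ M a * R x"
      unfolding sing_poly_props(4) R_def by (rule prod.remove) (use a in auto)
    have ex: "exp w = x" using Lg(2)[OF a xD(1)] by (simp add: w_def)
    have "reg_conjugate F k w * (x - ?\<zeta>) ^ (M a + ?e k) =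
        s * B' w * (t ^ \<alpha> * (x - ?\<zeta>) ^ ?e k) / (t ^ \<beta> * B w * x * R x)"
      unfolding reg_conjugate_def v ex Al using nz t0 by (simp add: power_add field_simps)
    also have "t ^ \<alpha> * (x - ?\<zeta>) ^ ?e k = (x - ?\<zeta>) ^ (K - 1) * (t ^ \<beta> * \<psi> w ^ \<beta>) / \<psi> w ^ \<alpha>"
    proof -
      have "t ^ \<alpha> * (x - ?\<zeta>) ^ ?e k * \<psi> w ^ \<alpha> = (x - ?\<zeta>) ^ (\<alpha> + ?e k)"
        unfolding power_add t by (simp add: power_mult_distrib mult_ac)
      also have "\<dots> = (x - ?\<zeta>) ^ (K - 1) * (t ^ \<beta> * \<psi> w ^ \<beta>)"
        unfolding \<alpha>\<beta> power_add t by (simp add: power_mult_distrib mult_ac)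
      finally show ?thesis using nz(1) by (simp add: field_simps)
    qed
    also have "s * B' w * ((x - ?\<zeta>) ^ (K - 1) * (t ^ \<beta> * \<psi> w ^ \<beta>) / \<psi> w ^ \<alpha>) / (t ^ \<beta> * B w * x * R x) =
        (x - ?\<zeta>) ^ (K - 1) * H x"
      unfolding H_def w_def[symmetric] using nz t0 by (simp add: field_simps)
    finally show ?thesis by (simp add: w_def)
  qed
  ultimately show thesis by (rule that)
qed

text \<open>The two cases are those of a regular point and of a pole of order \<open>m\<^sub>a\<^sub>b + 1\<close>.\<close>

lemma integral_shape:
  assumes a: "a \<in> {1..m}" and F: "adapted (l a) (sing_exponent a) F g" and k: "k < K"
  shows "\<exists>q. (if k < K - M a then q = 0 else degree q = mm a (k - (K - M a) + 1)) \<and>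
    (\<forall>u. ((\<lambda>x. exp (u * Lg a x) * reg_conjugate F k (Lg a x)) has_contour_integral exp (u * l a) * poly q u)
       (circlepath (z a) (r a)))"
proof -
  let ?\<zeta> = "z a"
  obtain H where H: "H holomorphic_on log_domain a" "H ?\<zeta> \<noteq> 0"
    "\<And>x. x \<in> log_domain a - {?\<zeta>} \<Longrightarrow> reg_conjugate F k (Lg a x) * (x - ?\<zeta>) ^ (M a + sing_exponent a k) = (x - ?\<zeta>) ^ (K - 1) * H x"
    by (rule local_shape[OF assms]) (rule that)
  have circ: "x \<in> log_domain a - {?\<zeta>}" if "x \<in> path_image (circlepath ?\<zeta> (r a))" for x
    using that circle_in_log_domain[OF a] by blast
  show ?thesis
  proof (cases "k < K - M a")
    case True
    define s where "s = K - 1 - (M a + k)"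
    have s: "K - 1 = s + (M a + k)" using True by (simp add: s_def)
    have e: "sing_exponent a k = k" using True by (simp add: sing_exponent_def)
    have V: "reg_conjugate F k (Lg a x) = (x - ?\<zeta>) ^ s * H x" if "x \<in> log_domain a - {?\<zeta>}" for x
      using H(3)[OF that] that unfolding e s power_add by simp
    have "((\<lambda>x. exp (u * Lg a x) * reg_conjugate F k (Lg a x)) has_contour_integral 0) (circlepath ?\<zeta> (r a))" for u
    proof (rule has_contour_integral_eq)
      show "((\<lambda>x. exp (u * Lg a x) * ((x - ?\<zeta>) ^ s * H x)) has_contour_integral 0) (circlepath ?\<zeta> (r a))"
        by (rule circle_integral_regular[OF l[OF a] log_domain(1,2,3,5)[OF a]]) (intro holomorphic_intros H(1))
    qed (use V circ in simp)
    thus ?thesis using True by (intro exI[of _ 0]) simp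
  next
    case False
    define j where "j = mm a (k - (K - M a) + 1)"
    have e: "M a + sing_exponent a k = (K - 1) + Suc j"
      using False M_le[OF a] K_pos by (simp add: sing_exponent_def j_def)
    have V: "reg_conjugate F k (Lg a x) = H x / (x - ?\<zeta>) ^ Suc j" if "x \<in> log_domain a - {?\<zeta>}" for x
    proof -
      have "x - ?\<zeta> \<noteq> 0" using that by auto
      moreover have "(x - ?\<zeta>) ^ (K - 1) * (reg_conjugate F k (Lg a x) * (x - ?\<zeta>) ^ Suc j) = (x - ?\<zeta>) ^ (K - 1) * H x"
        using H(3)[OF that] unfolding e power_add by (simp only: mult_ac)
      ultimately have "reg_conjugate F k (Lg a x) * (x - ?\<zeta>) ^ Suc j = H x" by simp
      thus ?thesis using \<open>x - ?\<zeta> \<noteq> 0\<close> by (simp add: nonzero_eq_divide_eq)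
    qed
    obtain q where q: "degree q = j"
      "\<And>u. ((\<lambda>x. exp (u * Lg a x) * (H x / (x - ?\<zeta>) ^ Suc j)) has_contour_integral
          exp (u * l a) * poly q u) (circlepath ?\<zeta> (r a))"
      by (rule circle_integral_pole[OF l[OF a] log_domain(5)[OF a] log_domain(1,2,3)[OF a] H(1,2), of j]) (rule that)
    have "((\<lambda>x. exp (u * Lg a x) * reg_conjugate F k (Lg a x)) has_contour_integral exp (u * l a) * poly q u)
       (circlepath ?\<zeta> (r a))" for u
      by (rule has_contour_integral_eq[OF q(2)]) (use V circ in simp)
    thus ?thesis using False q(1) by (intro exI[of _ q]) (simp add: j_def)
  qed
qed

section \<open>The difference equation\<close>

text \<open>The operator maps \<open>x\<close> to the power \<open>u\<close> to the sum of \<open>chi i u\<close> times \<open>x\<close> to the power \<open>u + i\<close>.\<close>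

definition chi :: "nat \<Rightarrow> complex \<Rightarrow> complex" where
  "chi i u = (\<Sum>j\<le>K. coeff (A j) i * u ^ j)"

lemma theta_op_exp: "theta_op A (\<lambda>w. exp (u * w)) w = (\<Sum>i\<le>dim_U. chi i u * exp ((u + of_nat i) * w))"
proof -
  have "theta_op A (\<lambda>w. exp (u * w)) w = (\<Sum>j\<le>K. (\<Sum>i\<le>dim_U. coeff (A j) i * exp w ^ i) * (u ^ j * exp (u * w)))"
    unfolding theta_op_def higher_deriv_exp
  proof (intro sum.cong refl arg_cong2[where f = "(*)"])
    fix j assume "j \<in> {..K}"
    hence "degree (A j) \<le> dim_U" using A_degree by simp
    thus "poly (A j) (exp w) = (\<Sum>i\<le>dim_U. coeff (A j) i * exp w ^ i)"
      unfolding poly_altdef by (intro sum.mono_neutral_left) (auto simp: coeff_eq_0)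
  qed
  also have "\<dots> = (\<Sum>i\<le>dim_U. \<Sum>j\<le>K. coeff (A j) i * u ^ j * (exp w ^ i * exp (u * w)))"
    unfolding sum_distrib_right by (subst sum.swap) (simp add: mult_ac)
  also have "\<dots> = (\<Sum>i\<le>dim_U. chi i u * exp ((u + of_nat i) * w))"
    unfolding chi_def sum_distrib_right
    by (intro sum.cong refl) (simp add: distrib_right exp_add exp_of_nat_mult)
  finally show ?thesis .
qed

text \<open>Write the vector of derivatives of \<open>h\<close> of order less than \<open>K\<close> as a combination of those of
  the \<open>F k\<close>, with coefficients \<open>c k\<close> depending on \<open>w\<close>. Differentiating the combination shows that the
  derivatives of the \<open>c k\<close> solve the same linear system, with right-hand side concentrated in the last
  row and equal to the monic operator applied to \<open>h\<close>.\<close>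

lemma variation_of_constants:
  assumes F: "frame F" and k: "k < K" and h: "h holomorphic_on UNIV"
  obtains c where "\<And>w. exp w \<notin> z ` {1..m} \<Longrightarrow>
      (c has_field_derivative inverse_column F k w * theta_op A h w / poly sing_poly (exp w)) (at w)"
proof -
  let ?W = "wronskian (\<lambda>r. r) K F"
  define T where "T = {w. exp w \<notin> z ` {1..m}}"
  have "T = exp -` (- (z ` {1..m}))" by (auto simp: T_def)
  hence T: "open T"
    by (simp only:) (intro open_vimage continuous_intros, auto intro: finite_imp_closed)
  have W0: "?W w \<noteq> 0" if "w \<in> T" for w using frame_regular[OF F] that by (simp add: T_def)
  have Fe: "\<And>k. k < K \<Longrightarrow> F k holomorphic_on UNIV" by (rule frame_entire[OF F])
  \<comment> \<open>Cramer's rule for the coefficients\<close>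
  define c where "c = (\<lambda>k w. wronskian (\<lambda>r. r) K (F(k := h)) w / ?W w)"
  have ch: "c k holomorphic_on T" for k
    unfolding c_def
  proof (intro holomorphic_on_divide)
    show "wronskian (\<lambda>r. r) K (F(k := h)) holomorphic_on T"
      by (rule holomorphic_on_subset[OF wronskian_entire]) (use Fe h in auto)
    show "?W holomorphic_on T" by (rule holomorphic_on_subset[OF wronskian_entire]) (use Fe in auto)
  qed (rule W0)
  have csum: "(\<Sum>k<K. c k w * (deriv ^^ r) (F k) w) = (deriv ^^ r) h w" if "w \<in> T" "r < K" for w r
  proof -
    let ?a = "\<lambda>r l. (deriv ^^ r) (F l) w"
    have "wronskian (\<lambda>r. r) K (F(k := h)) w = (\<Sum>s<K. (deriv ^^ s) h w * ncofactor K ?a s k)" if "k < K" for k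
    proof -
      have "wronskian (\<lambda>r. r) K (F(k := h)) w = ndet K (\<lambda>r l. if l = k then (deriv ^^ r) h w else ?a r l)"
        unfolding wronskian_def by (rule ndet_cong) simp
      thus ?thesis using ndet_expand_col[OF that] by simp
    qed
    hence "(\<Sum>k<K. c k w * ?a r k) = (\<Sum>k<K. \<Sum>s<K. (deriv ^^ s) h w * (?a r k * ncofactor K ?a s k)) / ?W w"
      unfolding c_def sum_divide_distrib
      by (intro sum.cong refl) (simp add: sum_distrib_left sum_distrib_right sum_divide_distrib mult_ac)
    also have "(\<Sum>k<K. \<Sum>s<K. (deriv ^^ s) h w * (?a r k * ncofactor K ?a s k)) =
        (\<Sum>s<K. (deriv ^^ s) h w * (\<Sum>k<K. ?a r k * ncofactor K ?a s k))"
      by (subst sum.swap) (simp add: sum_distrib_left)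
    also have "\<dots> = (\<Sum>s<K. if s = r then (deriv ^^ r) h w * ?W w else 0)"
      by (intro sum.cong refl, subst ndet_adj_row) (use that in \<open>auto simp: wronskian_def\<close>)
    finally show ?thesis using that W0 by simp
  qed
  have "(c k has_field_derivative inverse_column F k w * theta_op A h w / poly sing_poly (exp w)) (at w)"
    if w: "w \<in> T" for w
  proof -
    have Al: "poly sing_poly (exp w) \<noteq> 0" using w by (intro sing_poly_nz) (simp add: T_def)
    have cd: "(c k has_field_derivative deriv (c k) w) (at w)" for k
      by (rule holomorphic_derivI[OF ch T w])
    have Fd: "((deriv ^^ r) (F k) has_field_derivative (deriv ^^ Suc r) (F k) w) (at w)" if "k < K" for r k
      using has_field_derivative_higher_deriv[OF Fe[OF that] open_UNIV UNIV_I] .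
    have hd: "((deriv ^^ r) h has_field_derivative (deriv ^^ Suc r) h w) (at w)" for r
      using has_field_derivative_higher_deriv[OF h open_UNIV UNIV_I] .
    have diff: "(\<Sum>k<K. deriv (c k) w * (deriv ^^ r) (F k) w) =
        (deriv ^^ Suc r) h w - (\<Sum>k<K. c k w * (deriv ^^ Suc r) (F k) w)" if r: "r < K" for r
    proof -
      have "((\<lambda>w. \<Sum>k<K. c k w * (deriv ^^ r) (F k) w) has_field_derivative
          (\<Sum>k<K. c k w * (deriv ^^ Suc r) (F k) w + deriv (c k) w * (deriv ^^ r) (F k) w)) (at w)"
        by (intro DERIV_sum DERIV_mult' cd Fd) simp
      hence "((deriv ^^ r) h has_field_derivative
          (\<Sum>k<K. c k w * (deriv ^^ Suc r) (F k) w + deriv (c k) w * (deriv ^^ r) (F k) w)) (at w)"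
        by (rule has_field_derivative_transform_within_open[OF _ T w]) (rule csum[OF _ r])
      from DERIV_unique[OF this hd[of r]] show ?thesis
        unfolding sum.distrib by (simp add: algebra_simps)
    qed
    define E where "E = theta_op A h w / poly sing_poly (exp w)"
    have rel: "(\<Sum>k<K. (deriv ^^ r) (F k) w * deriv (c k) w) = (if r = K - 1 then E else 0)" if r: "r < K" for r
    proof (cases "r = K - 1")
      case False
      hence "Suc r < K" using r by simp
      thus ?thesis using diff[OF r] csum[OF w \<open>Suc r < K\<close>] False by (simp add: mult.commute)
    next
      case True
      hence S: "Suc r = K" using r by simp
      have DF: "poly sing_poly (exp w) * (deriv ^^ K) (F k) w = - (\<Sum>j<K. poly (A j) (exp w) * (deriv ^^ j) (F k) w)"
        if "k < K" for k
        using annihilating_V[OF A_annihilating frame_V[OF F that], of w] A_lead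
        by (simp add: theta_op_def lessThan_Suc_atMost[symmetric] eq_neg_iff_add_eq_0 add.commute)
      have "poly sing_poly (exp w) * (\<Sum>k<K. c k w * (deriv ^^ K) (F k) w) =
          (\<Sum>k<K. c k w * (poly sing_poly (exp w) * (deriv ^^ K) (F k) w))"
        by (simp add: sum_distrib_left mult_ac)
      also have "\<dots> = - (\<Sum>k<K. \<Sum>j<K. poly (A j) (exp w) * (c k w * (deriv ^^ j) (F k) w))"
        by (simp add: DF sum_negf sum_distrib_left mult_ac)
      also have "\<dots> = - (\<Sum>j<K. poly (A j) (exp w) * (\<Sum>k<K. c k w * (deriv ^^ j) (F k) w))"
        by (subst sum.swap) (simp add: sum_distrib_left)
      also have "\<dots> = - (\<Sum>j<K. poly (A j) (exp w) * (deriv ^^ j) h w)"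
        using csum[OF w] by simp
      finally have "poly sing_poly (exp w) * ((deriv ^^ K) h w - (\<Sum>k<K. c k w * (deriv ^^ K) (F k) w)) = theta_op A h w"
        using A_lead by (simp add: theta_op_def lessThan_Suc_atMost[symmetric] right_diff_distrib)
      hence "(deriv ^^ K) h w - (\<Sum>k<K. c k w * (deriv ^^ K) (F k) w) = E"
        using Al by (simp add: E_def field_simps)
      thus ?thesis using diff[OF r] S True by (simp add: mult.commute)
    qed
    have "deriv (c k) w - inverse_column F k w * E = 0"
    proof (rule ndet_nonzero_kernel[OF _ _ k, where a = "\<lambda>r k. (deriv ^^ r) (F k) w"
            and c = "\<lambda>k. deriv (c k) w - inverse_column F k w * E"])
      show "ndet K (\<lambda>r k. (deriv ^^ r) (F k) w) \<noteq> 0" using W0[OF w] by (simp add: wronskian_def)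
      fix r assume r: "r < K"
      have "(\<Sum>k<K. (deriv ^^ r) (F k) w * (inverse_column F k w * E)) = (if r = K - 1 then E else 0)"
        using inverse_column_inverse[OF W0[OF w] r] by (simp add: sum_distrib_right[symmetric] mult.assoc[symmetric])
      thus "(\<Sum>k<K. (deriv ^^ r) (F k) w * (deriv (c k) w - inverse_column F k w * E)) = 0"
        using rel[OF r] by (simp add: right_diff_distrib sum_subtractf)
    qed
    hence "deriv (c k) w = inverse_column F k w * theta_op A h w / poly sing_poly (exp w)" by (simp add: E_def)
    thus ?thesis using cd[of k] by simp
  qed
  thus thesis by (intro that[of "c k"]) (simp add: T_def)
qed

text \<open>For \<open>h\<close> equal to \<open>x\<close> to the power \<open>u\<close>, the combination of the integrands is the derivative of a
  function that is single-valued on a neighbourhood of the circle.\<close>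

lemma integral_recurrence:
  assumes a: "a \<in> {1..m}" and F: "frame F" and k: "k < K"
    and Q: "\<And>u. ((\<lambda>x. exp (u * Lg a x) * reg_conjugate F k (Lg a x)) has_contour_integral Q u) (circlepath (z a) (r a))"
  shows "(\<Sum>i\<le>dim_U. chi i u * Q (u + of_nat i)) = 0"
proof -
  have h: "(\<lambda>w. exp (u * w)) holomorphic_on UNIV" by (intro holomorphic_intros)
  obtain c where c: "\<And>w. exp w \<notin> z ` {1..m} \<Longrightarrow>
      (c has_field_derivative inverse_column F k w * theta_op A (\<lambda>w. exp (u * w)) w / poly sing_poly (exp w)) (at w)"
    by (rule variation_of_constants[OF F k h]) (rule that)
  let ?f = "\<lambda>x. \<Sum>i\<le>dim_U. chi i u * (exp ((u + of_nat i) * Lg a x) * reg_conjugate F k (Lg a x))"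
  have 1: "(?f has_contour_integral (\<Sum>i\<le>dim_U. chi i u * Q (u + of_nat i))) (circlepath (z a) (r a))"
    by (intro has_contour_integral_sum has_contour_integral_lmul Q) simp
  have d: "((\<lambda>x. c (Lg a x)) has_field_derivative ?f x) (at x within log_domain a - {z a})" if x: "x \<in> log_domain a - {z a}" for x
  proof -
    let ?w = "Lg a x"
    have e: "exp ?w = x" "x \<noteq> 0" using Lg[OF a] x by auto
    have "exp ?w \<notin> z ` {1..m}" using log_domain(6)[OF a] x e by auto
    from DERIV_chain2[OF c[OF this] Lg(3)[OF a]] x
    have "((\<lambda>x. c (Lg a x)) has_field_derivative
        inverse_column F k ?w * theta_op A (\<lambda>w. exp (u * w)) ?w / poly sing_poly (exp ?w) * (1 / x)) (at x)" by auto
    moreover have "inverse_column F k ?w * theta_op A (\<lambda>w. exp (u * w)) ?w / poly sing_poly (exp ?w) * (1 / x) = ?f x"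
      unfolding theta_op_exp reg_conjugate_def e
      by (simp add: sum_distrib_left sum_divide_distrib mult_ac)
    ultimately show ?thesis by (simp add: has_field_derivative_at_within)
  qed
  have "(?f has_contour_integral (c (Lg a (pathfinish (circlepath (z a) (r a)))) -
      c (Lg a (pathstart (circlepath (z a) (r a)))))) (circlepath (z a) (r a))"
    by (rule contour_integral_primitive[OF d _ circle_in_log_domain[OF a]]) auto
  hence "(?f has_contour_integral 0) (circlepath (z a) (r a))" by simp
  with 1 show ?thesis by (rule has_contour_integral_unique)
qed

end

section \<open>The structure of the dual space\<close>

text \<open>The difference operator \<open>\<tau> - z b\<close> lowers the degree of \<open>Q b\<close> and preserves the degrees of the
  other polynomials; induct on the total size.\<close>

lemma exponential_polynomials_independent:
  fixes z :: "nat \<Rightarrow> complex" and Q :: "nat \<Rightarrow> complex poly"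
  assumes "finite I" "inj_on z I" "\<And>a. a \<in> I \<Longrightarrow> z a \<noteq> 0"
    and "\<And>k::nat. (\<Sum>a\<in>I. z a ^ k * poly (Q a) (of_nat k)) = 0"
  shows "\<forall>a\<in>I. Q a = 0"
  using assms(4)
proof (induction "\<Sum>a\<in>I. if Q a = 0 then 0 else Suc (degree (Q a))" arbitrary: Q rule: less_induct)
  case less
  show ?case
  proof (rule ccontr)
    assume "\<not> (\<forall>a\<in>I. Q a = 0)"
    then obtain b where b: "b \<in> I" "Q b \<noteq> 0" by auto
    define S where "S = (\<lambda>a. Q a \<circ>\<^sub>p [:1, 1:])"
    define R where "R = (\<lambda>a. Polynomial.smult (z a) (S a) - Polynomial.smult (z b) (Q a))"
    have dS: "degree (S a) = degree (Q a)" "coeff (S a) (degree (Q a)) = lead_coeff (Q a)" for a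
    proof -
      show "degree (S a) = degree (Q a)" by (simp add: S_def degree_pcompose)
      thus "coeff (S a) (degree (Q a)) = lead_coeff (Q a)"
        using lead_coeff_comp[of "[:1, 1::complex:]" "Q a"] by (simp add: S_def)
    qed
    have dR: "degree (R a) \<le> degree (Q a)" for a
      unfolding R_def by (rule degree_diff_le) (auto intro: order_trans[OF degree_smult_le] simp: dS)
    have R0: "Q a = 0 \<Longrightarrow> R a = 0" for a by (simp add: R_def S_def)
    have Rb: "R b = 0 \<or> degree (R b) < degree (Q b)"
    proof -
      have "coeff (R b) (degree (Q b)) = 0" by (simp add: R_def dS)
      thus ?thesis using dR[of b] by (metis le_neq_implies_less leading_coeff_0_iff)
    qed
    have "(\<Sum>a\<in>I. if R a = 0 then 0 else Suc (degree (R a))) < (\<Sum>a\<in>I. if Q a = 0 then 0 else Suc (degree (Q a)))"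
    proof (rule sum_strict_mono_ex1[OF assms(1)])
      show "\<forall>a\<in>I. (if R a = 0 then 0 else Suc (degree (R a))) \<le> (if Q a = 0 then 0 else Suc (degree (Q a)))"
        using dR R0 by auto
      show "\<exists>a\<in>I. (if R a = 0 then 0 else Suc (degree (R a))) < (if Q a = 0 then 0 else Suc (degree (Q a)))"
        using b Rb by (intro bexI[of _ b]) auto
    qed
    moreover have "(\<Sum>a\<in>I. z a ^ k * poly (R a) (of_nat k)) = 0" for k
    proof -
      have "(\<Sum>a\<in>I. z a ^ k * poly (R a) (of_nat k)) =
          (\<Sum>a\<in>I. z a ^ Suc k * poly (Q a) (of_nat (Suc k))) - z b * (\<Sum>a\<in>I. z a ^ k * poly (Q a) (of_nat k))"
        unfolding sum_distrib_left sum_subtractf[symmetric]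
        by (intro sum.cong refl) (simp add: R_def S_def poly_pcompose algebra_simps)
      also have "\<dots> = 0" by (simp only: less.prems) simp
      finally show ?thesis .
    qed
    ultimately have R: "\<forall>a\<in>I. R a = 0" by (rule less.hyps)
    have Qa: "Q a = 0" if "a \<in> I" "a \<noteq> b" for a
    proof -
      have "coeff (R a) (degree (Q a)) = (z a - z b) * lead_coeff (Q a)"
        by (simp add: R_def dS algebra_simps)
      hence "(z a - z b) * lead_coeff (Q a) = 0" using R that by simp
      moreover have "z a \<noteq> z b" using that b(1) assms(2) by (auto dest: inj_onD)
      ultimately show ?thesis by simp
    qed
    have "poly (Q b) (of_nat k) = 0" for k
    proof -
      have "0 = (\<Sum>a\<in>I. z a ^ k * poly (Q a) (of_nat k))" by (simp only: less.prems)
      also have "\<dots> = (\<Sum>a\<in>I. if a = b then z b ^ k * poly (Q b) (of_nat k) else 0)"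
        by (intro sum.cong refl) (auto simp: Qa)
      also have "\<dots> = z b ^ k * poly (Q b) (of_nat k)" using b(1) assms(1) by simp
      finally show ?thesis using assms(3)[OF b(1)] by simp
    qed
    hence "range (of_nat :: nat \<Rightarrow> complex) \<subseteq> {x. poly (Q b) x = 0}" by auto
    moreover have "infinite (range (of_nat :: nat \<Rightarrow> complex))"
      by (rule range_inj_infinite) (simp add: inj_on_def)
    ultimately show False using b(2) poly_roots_finite finite_subset by blast
  qed
qed

context bispectral_setting
begin

abbreviation dual_space :: "(complex \<Rightarrow> complex) set" where "dual_space \<equiv> bispectral_dual V K m M z l r"

text \<open>The coefficients of the difference operator, as polynomials in \<open>u\<close>.\<close>

definition chi_poly :: "nat \<Rightarrow> complex poly" where "chi_poly i = (\<Sum>j\<le>K. monom (coeff (A j) i) j)"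

lemma poly_chi_poly: "poly (chi_poly i) u = chi i u"
  by (simp add: chi_poly_def chi_def poly_sum poly_monom)

lemma coeff_chi_poly: "coeff (chi_poly i) j = (if j \<le> K then coeff (A j) i else 0)"
  by (simp add: chi_poly_def coeff_sum)

lemma chi_beyond: "i > dim_U \<Longrightarrow> chi i u = 0"
  unfolding chi_def
proof (intro sum.neutral ballI)
  fix j assume "dim_U < i" "j \<in> {..K}"
  hence "degree (A j) < i" using A_degree[of j] by simp
  thus "coeff (A j) i * u ^ j = 0" by (simp add: coeff_eq_0)
qed

lemma chi_poly_lead: "degree (chi_poly dim_U) = K" "lead_coeff (chi_poly dim_U) = 1"
proof -
  have 1: "coeff (chi_poly dim_U) K = 1"
    using sing_poly_props(1,2) by (simp add: coeff_chi_poly A_lead)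
  have "degree (chi_poly dim_U) \<le> K" by (rule degree_le) (simp add: coeff_chi_poly)
  thus "degree (chi_poly dim_U) = K" using 1 le_degree[of "chi_poly dim_U" K] by simp
  thus "lead_coeff (chi_poly dim_U) = 1" using 1 by simp
qed

text \<open>The coefficient of \<open>x\<close> to the power \<open>\<nu> + t\<close> in the equation satisfied by \<open>x\<close> to the power \<open>\<nu>\<close>
  times \<open>P\<close>.\<close>

lemma killed_coeff:
  assumes "(\<Sum>j\<le>K. A j * (twisted_theta \<nu> ^^ j) P) = 0"
  shows "(\<Sum>i\<le>t. chi i (\<nu> + of_nat (t - i)) * coeff P (t - i)) = 0"
proof -
  have "0 = coeff (\<Sum>j\<le>K. A j * (twisted_theta \<nu> ^^ j) P) t" by (simp add: assms)
  also have "\<dots> = (\<Sum>j\<le>K. \<Sum>i\<le>t. coeff (A j) i * ((\<nu> + of_nat (t - i)) ^ j * coeff P (t - i)))"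
    by (simp add: coeff_sum coeff_mult coeff_twisted_theta_iter)
  also have "\<dots> = (\<Sum>i\<le>t. chi i (\<nu> + of_nat (t - i)) * coeff P (t - i))"
    by (subst sum.swap) (simp add: chi_def sum_distrib_left sum_distrib_right mult_ac)
  finally show ?thesis by simp
qed

lemma chi_top_root:
  assumes "k < K"
  shows "chi dim_U (L k + of_nat (gen_degree k)) = 0"
proof -
  have "(\<Sum>i\<le>dim_U + gen_degree k. chi i (L k + of_nat (dim_U + gen_degree k - i)) * coeff (gen_poly k) (dim_U + gen_degree k - i)) = 0"
    using A_annihilating assms by (intro killed_coeff) (simp add: annihilating_def)
  moreover have "(\<Sum>i\<le>dim_U + gen_degree k. chi i (L k + of_nat (dim_U + gen_degree k - i)) * coeff (gen_poly k) (dim_U + gen_degree k - i)) =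
      (\<Sum>i\<le>dim_U + gen_degree k. if i = dim_U then chi dim_U (L k + of_nat (gen_degree k)) * lead_coeff (gen_poly k) else 0)"
  proof (intro sum.cong refl)
    fix i assume "i \<in> {..dim_U + gen_degree k}"
    show "chi i (L k + of_nat (dim_U + gen_degree k - i)) * coeff (gen_poly k) (dim_U + gen_degree k - i) =
       (if i = dim_U then chi dim_U (L k + of_nat (gen_degree k)) * lead_coeff (gen_poly k) else 0)"
    proof (cases "i < dim_U")
      case True
      hence "coeff (gen_poly k) (dim_U + gen_degree k - i) = 0"
        using degree_gen_poly[OF assms] by (intro coeff_eq_0) simp
      thus ?thesis using True by simp
    qed (use chi_beyond degree_gen_poly[OF assms] in auto)
  qed
  ultimately show ?thesis using gen_poly_nz[OF assms] by simp
qed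

lemma top_exponents_inj: "inj_on (\<lambda>k. L k + of_nat (gen_degree k)) {..<K}"
  unfolding gen_degree_def by (rule inj_exponents) (rule nn_inj)

text \<open>The exponents at infinity are \<open>K\<close> distinct zeros of a polynomial of degree \<open>K\<close>.\<close>

lemma chi_top_zero_iff: "chi dim_U u = 0 \<longleftrightarrow> (\<exists>k<K. u = L k + of_nat (gen_degree k))"
proof -
  let ?R = "(\<lambda>k. L k + of_nat (gen_degree k)) ` {..<K}"
  have nz: "chi_poly dim_U \<noteq> 0" using chi_poly_lead(2) by auto
  have "?R = {x. poly (chi_poly dim_U) x = 0}"
  proof (rule card_seteq)
    show "finite {x. poly (chi_poly dim_U) x = 0}" using nz by (rule poly_roots_finite)
    show "?R \<subseteq> {x. poly (chi_poly dim_U) x = 0}" using chi_top_root by (auto simp: poly_chi_poly)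
    have "card {x. poly (chi_poly dim_U) x = 0} \<le> K"
      using card_poly_roots_bound[OF nz] chi_poly_lead(1) by simp
    thus "card {x. poly (chi_poly dim_U) x = 0} \<le> card ?R"
      by (simp add: card_image[OF top_exponents_inj])
  qed
  thus ?thesis by (auto simp: poly_chi_poly)
qed

lemma chi_top_zeroD:
  assumes "i \<in> {1..n}" "chi dim_U (lam i + of_nat k) = 0"
  shows "\<exists>j\<in>{1..N i}. k = nn i j"
proof -
  obtain t where t: "t < K" "lam i + of_nat k = L t + of_nat (gen_degree t)"
    using assms(2) by (auto simp: chi_top_zero_iff)
  have "lam i - lam (fst (ix t)) = of_int (int (gen_degree t) - int k)"
    using t(2) by (simp add: L_def algebra_simps)
  hence "lam i - lam (fst (ix t)) \<in> \<int>" by simp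
  hence i: "i = fst (ix t)"
    using nr[unfolded non_resonant_def, rule_format, OF assms(1) ix_range(1)[OF t(1)]] by blast
  hence "k = gen_degree t" using t(2) by (simp add: L_def)
  thus ?thesis using ix_range(2)[OF t(1)] i by (auto simp: gen_degree_def)
qed

lemma twisted_theta_iter_lincomb:
  "(twisted_theta \<nu> ^^ j) (\<Sum>k\<in>I. Polynomial.smult (c k) (q k)) = (\<Sum>k\<in>I. Polynomial.smult (c k) ((twisted_theta \<nu> ^^ j) (q k)))"
  by (rule poly_eqI) (simp add: coeff_twisted_theta_iter coeff_sum sum_distrib_left mult_ac)

lemma killed_at_0:
  assumes "k < K"
  shows "\<exists>P. (\<Sum>j\<le>K. A j * (twisted_theta (L k) ^^ j) P) = 0 \<and>
    (\<forall>s<snd (ix k) - 1. coeff P s = 0) \<and> coeff P (snd (ix k) - 1) \<noteq> 0"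
proof -
  obtain C P0 where C: "\<And>k. k < K \<Longrightarrow> P0 k = (\<Sum>l<K. Polynomial.smult (C l k) (gen_poly l))"
    "\<And>k l. k < K \<Longrightarrow> l < K \<Longrightarrow> C l k \<noteq> 0 \<Longrightarrow> fst (ix l) = fst (ix k)"
    "\<And>k s. k < K \<Longrightarrow> s < snd (ix k) - 1 \<Longrightarrow> coeff (P0 k) s = 0"
    "\<And>k. k < K \<Longrightarrow> coeff (P0 k) (snd (ix k) - 1) \<noteq> 0" by (rule adapted_at_0) blast
  have "(\<Sum>j\<le>K. A j * (twisted_theta (L k) ^^ j) (P0 k)) = (\<Sum>l<K. [:C l k:] * (\<Sum>j\<le>K. A j * (twisted_theta (L k) ^^ j) (gen_poly l)))"
    unfolding C(1)[OF assms] twisted_theta_iter_lincomb sum_distrib_left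
    by (subst sum.swap) (simp add: mult_ac)
  also have "\<dots> = 0"
  proof (intro sum.neutral ballI)
    fix l assume l: "l \<in> {..<K}"
    show "[:C l k:] * (\<Sum>j\<le>K. A j * (twisted_theta (L k) ^^ j) (gen_poly l)) = 0"
    proof (cases "C l k = 0")
      case False
      hence "L k = L l" using C(2)[OF assms, of l] l by (simp add: L_def)
      thus ?thesis using A_annihilating l by (simp add: annihilating_def)
    qed simp
  qed
  finally show ?thesis using C(3,4)[OF assms] by blast
qed

text \<open>For \<open>k \<ge> 0\<close> the operator maps \<open>x\<close> to the power \<open>\<lambda>\<^sub>i + k\<close> to a multiple of \<open>x\<close> to the power
  \<open>\<lambda>\<^sub>i + N\<^sub>i\<close> by a polynomial. For \<open>k < N\<^sub>i\<close> this follows from the solutions adapted to \<open>0\<close>, by induction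
  downwards on \<open>k\<close>.\<close>

lemma chi_low_zero:
  assumes "i \<in> {1..n}" "s + k < N i"
  shows "chi s (lam i + of_nat k) = 0"
  using assms(2)
proof (induction "N i - k" arbitrary: s k rule: less_induct)
  case less
  have "(i, Suc k) \<in> (SIGMA i:{1..n}. {1..N i})" using assms(1) less.prems by auto
  then obtain \<kappa> where \<kappa>: "\<kappa> < K" "ix \<kappa> = (i, Suc k)"
    using ix by (metis bij_betw_def imageE lessThan_iff)
  have L\<kappa>: "L \<kappa> = lam i" using \<kappa>(2) by (simp add: L_def)
  obtain P where P: "(\<Sum>j\<le>K. A j * (twisted_theta (lam i) ^^ j) P) = 0" "\<forall>s<k. coeff P s = 0" "coeff P k \<noteq> 0"
    using killed_at_0[OF \<kappa>(1)] unfolding \<kappa>(2) L\<kappa> by auto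
  have "0 = (\<Sum>q\<le>s + k. chi q (lam i + of_nat (s + k - q)) * coeff P (s + k - q))"
    using killed_coeff[OF P(1), of "s + k"] by simp
  also have "\<dots> = (\<Sum>q\<le>s + k. if q = s then chi s (lam i + of_nat k) * coeff P k else 0)"
  proof (intro sum.cong refl)
    fix q assume q: "q \<in> {..s + k}"
    consider "q < s" | "q = s" | "q > s" by linarith
    thus "chi q (lam i + of_nat (s + k - q)) * coeff P (s + k - q) =
        (if q = s then chi s (lam i + of_nat k) * coeff P k else 0)"
    proof cases
      case 1
      hence "chi q (lam i + of_nat (s + k - q)) = 0"
        using less.prems by (intro less.hyps) auto
      thus ?thesis using 1 by simp
    next
      case 3
      hence "s + k - q < k" using q by auto
      thus ?thesis using 3 P(2) by simp
    qed simp
  qed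
  also have "\<dots> = chi s (lam i + of_nat k) * coeff P k" by simp
  finally show ?case using P(3) by simp
qed

text \<open>Otherwise all \<open>chi s\<close>, and in particular the top one, would vanish at \<open>\<lambda>\<^sub>i\<close>, but the zeros of the
  top one are the \<open>\<lambda>\<^sub>i + n\<^sub>i\<^sub>j\<close> with \<open>n\<^sub>i\<^sub>j > 0\<close>.\<close>

lemma N_le_dim_U: "i \<in> {1..n} \<Longrightarrow> N i \<le> dim_U"
proof (rule ccontr)
  assume i: "i \<in> {1..n}" and "\<not> N i \<le> dim_U"
  hence "chi dim_U (lam i + of_nat 0) = 0" by (intro chi_low_zero) auto
  from chi_top_zeroD[OF i this] obtain j where "j \<in> {1..N i}" "nn i j = 0" by auto
  thus False using nn_ge[OF i, of j] by auto
qed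

lemma m_pos: "1 \<le> m"
proof (rule ccontr)
  assume "\<not> 1 \<le> m"
  hence "dim_U = 0" by (simp add: dim_U_def)
  moreover have "1 \<le> N 1" "N 1 \<le> dim_U" using dd_n n1 N_le_dim_U[of 1] by (auto simp: degree_data_def)
  ultimately show False by simp
qed

text \<open>The frame \<open>F\<close> is used for the integrals around \<open>z a\<close>, and \<open>Q k\<close> is the polynomial factor of the
  integral of its \<open>k\<close>-th conjugate function.\<close>

definition integral_data :: "nat \<Rightarrow> (nat \<Rightarrow> complex \<Rightarrow> complex) \<Rightarrow> (nat \<Rightarrow> complex poly) \<Rightarrow> bool" where
  "integral_data a F Q \<longleftrightarrow> frame F \<and>
     (\<forall>k<K. (if k < K - M a then Q k = 0 else degree (Q k) = mm a (k - (K - M a) + 1)) \<and>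
       (\<forall>u. ((\<lambda>x. exp (u * Lg a x) * reg_conjugate F k (Lg a x)) has_contour_integral
          exp (u * l a) * poly (Q k) u) (circlepath (z a) (r a))))"

lemma local_integrals:
  assumes a: "a \<in> {1..m}"
  shows "\<exists>F Q. integral_data a F Q"
proof -
  obtain F g where F: "adapted (l a) (sing_exponent a) F g"
    by (rule adapted_at_sing[OF a l[OF a]]) (rule that)
  have "\<forall>k. \<exists>q. k < K \<longrightarrow> (if k < K - M a then q = 0 else degree q = mm a (k - (K - M a) + 1)) \<and>
    (\<forall>u. ((\<lambda>x. exp (u * Lg a x) * reg_conjugate F k (Lg a x)) has_contour_integral exp (u * l a) * poly q u)
       (circlepath (z a) (r a)))"
    using integral_shape[OF a F] by auto
  from choice[OF this] have "\<exists>Q. integral_data a F Q"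
    unfolding integral_data_def using adapted_frame[OF F sing_exponent_inj[OF a]] by simp
  thus ?thesis by (rule exI[of _ F])
qed

definition quasi_exp :: "(nat \<Rightarrow> nat \<Rightarrow> complex poly) \<Rightarrow> nat \<times> nat \<Rightarrow> complex \<Rightarrow> complex" where
  "quasi_exp q x u = exp (u * l (fst x)) * poly (q (fst x) (snd x)) u"

abbreviation dual_index :: "(nat \<times> nat) set" where "dual_index \<equiv> (SIGMA a:{1..m}. {1..M a})"

text \<open>The frames adapted to different singular points differ, but each of them describes the whole conjugate
  space.\<close>

lemma dual_structure:
  obtains q where "\<And>a b. a \<in> {1..m} \<Longrightarrow> b \<in> {1..M a} \<Longrightarrow> degree (q a b) = mm a b"
    "dual_space = cfun.span (quasi_exp q ` dual_index)"
    "\<And>x u. x \<in> dual_index \<Longrightarrow> (\<Sum>i\<le>dim_U. chi i u * quasi_exp q x (u + of_nat i)) = 0"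
proof -
  have "\<forall>a. \<exists>F. \<exists>Q. a \<in> {1..m} \<longrightarrow> integral_data a F Q"
    using local_integrals by simp
  from choice[OF this] obtain F where "\<forall>a. \<exists>Q. a \<in> {1..m} \<longrightarrow> integral_data a (F a) Q"
    by (elim exE) (rule that)
  from choice[OF this] obtain Q where "\<forall>a. a \<in> {1..m} \<longrightarrow> integral_data a (F a) (Q a)"
    by (elim exE) (rule that)
  note FQ = this[unfolded integral_data_def]
  have fr: "frame (F a)" if "a \<in> {1..m}" for a using FQ that by simp
  have Q0: "Q a k = 0" if "a \<in> {1..m}" "k < K - M a" for a k using FQ that by simp
  have dQ: "degree (Q a k) = mm a (k - (K - M a) + 1)" if "a \<in> {1..m}" "k < K" "\<not> k < K - M a" for a k
    using FQ that by simp
  have int: "((\<lambda>x. exp (u * Lg a x) * reg_conjugate (F a) k (Lg a x)) has_contour_integral exp (u * l a) * poly (Q a k) u)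
       (circlepath (z a) (r a))" if "a \<in> {1..m}" "k < K" for a k u using FQ that by blast
  define q where "q = (\<lambda>a b. Q a (K - M a + (b - 1)))"
  have kb: "K - M a + (b - 1) < K" if "a \<in> {1..m}" "b \<in> {1..M a}" for a b
    using that M_le[of a] by auto
  let ?S1 = "{\<lambda>u. contour_integral (circlepath (z a) (r a)) (\<lambda>x. exp (u * Lg a x) * f (Lg a x)) | a f.
      a \<in> {1..m} \<and> f \<in> regularized_conjugate_space V K m M z}"
  have "cfun.span ?S1 = cfun.span (quasi_exp q ` dual_index)"
    unfolding cfun.span_eq
  proof
    show "?S1 \<subseteq> cfun.span (quasi_exp q ` dual_index)"
    proof clarify
      fix a f assume a: "a \<in> {1..m}" and "f \<in> regularized_conjugate_space V K m M z"
      then obtain c where f: "f = (\<lambda>w. \<Sum>k<K. c k * reg_conjugate (F a) k w)"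
        unfolding regularized_conjugate_space_eq[OF fr[OF a]] by auto
      have "contour_integral (circlepath (z a) (r a)) (\<lambda>x. exp (u * Lg a x) * f (Lg a x)) =
          (\<Sum>k<K. c k * (exp (u * l a) * poly (Q a k) u))" for u
      proof (rule contour_integral_unique)
        have "((\<lambda>x. \<Sum>k<K. c k * (exp (u * Lg a x) * reg_conjugate (F a) k (Lg a x))) has_contour_integral
          (\<Sum>k<K. c k * (exp (u * l a) * poly (Q a k) u))) (circlepath (z a) (r a))"
          by (intro has_contour_integral_sum has_contour_integral_lmul int[OF a]) auto
        thus "((\<lambda>x. exp (u * Lg a x) * f (Lg a x)) has_contour_integral
          (\<Sum>k<K. c k * (exp (u * l a) * poly (Q a k) u))) (circlepath (z a) (r a))"
          by (simp add: f sum_distrib_left mult_ac)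
      qed
      hence "(\<lambda>u. contour_integral (circlepath (z a) (r a)) (\<lambda>x. exp (u * Lg a x) * f (Lg a x))) =
          (\<Sum>k<K. (\<lambda>u. c k * (exp (u * l a) * poly (Q a k) u)))"
        by (intro ext) (simp only: sum_fun_apply)
      also have "\<dots> \<in> cfun.span (quasi_exp q ` dual_index)"
      proof (rule cfun.span_sum, rule cfun.span_scale)
        fix k assume k: "k \<in> {..<K}"
        show "(\<lambda>u. exp (u * l a) * poly (Q a k) u) \<in> cfun.span (quasi_exp q ` dual_index)"
        proof (cases "k < K - M a")
          case True
          hence "(\<lambda>u. exp (u * l a) * poly (Q a k) u) = 0" using Q0[OF a] by (simp add: zero_fun_def)
          thus ?thesis by (simp only: cfun.span_zero)
        next
          case False
          hence "K - M a + ((k - (K - M a) + 1) - 1) = k" by simp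
          hence "(\<lambda>u. exp (u * l a) * poly (Q a k) u) = quasi_exp q (a, k - (K - M a) + 1)"
            by (simp add: quasi_exp_def[abs_def] q_def)
          moreover have "(a, k - (K - M a) + 1) \<in> dual_index" using a k False M_le[OF a] by auto
          ultimately show ?thesis by (simp only:) (rule cfun.span_base, blast)
        qed
      qed
      finally show "(\<lambda>u. contour_integral (circlepath (z a) (r a)) (\<lambda>x. exp (u * Lg a x) * f (Lg a x)))
          \<in> cfun.span (quasi_exp q ` dual_index)" .
    qed
    show "quasi_exp q ` dual_index \<subseteq> cfun.span ?S1"
    proof
      fix h assume "h \<in> quasi_exp q ` dual_index"
      then obtain a b where ab: "a \<in> {1..m}" "b \<in> {1..M a}" "h = quasi_exp q (a, b)" by auto
      define k where "k = K - M a + (b - 1)"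
      have k: "k < K" using kb[OF ab(1,2)] by (simp add: k_def)
      have "reg_conjugate (F a) k = (\<lambda>w. \<Sum>t<K. (if t = k then 1 else 0) * reg_conjugate (F a) t w)"
      proof
        fix w
        have "(\<Sum>t<K. (if t = k then 1 else 0) * reg_conjugate (F a) t w) = (\<Sum>t<K. if t = k then reg_conjugate (F a) t w else 0)"
          by (intro sum.cong refl) simp
        thus "reg_conjugate (F a) k w = (\<Sum>t<K. (if t = k then 1 else 0) * reg_conjugate (F a) t w)" using k by simp
      qed
      hence mem: "reg_conjugate (F a) k \<in> regularized_conjugate_space V K m M z"
        unfolding regularized_conjugate_space_eq[OF fr[OF ab(1)]] by (intro CollectI exI)
      have "h = (\<lambda>u. contour_integral (circlepath (z a) (r a)) (\<lambda>x. exp (u * Lg a x) * reg_conjugate (F a) k (Lg a x)))"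
        unfolding ab(3) using contour_integral_unique[OF int[OF ab(1) k]]
        by (intro ext) (simp add: quasi_exp_def q_def k_def)
      hence "h \<in> ?S1" using ab(1) mem by (intro CollectI exI conjI)
      thus "h \<in> cfun.span ?S1" by (rule cfun.span_base)
    qed
  qed
  hence span: "dual_space = cfun.span (quasi_exp q ` dual_index)" by (simp only: bispectral_dual_def)
  have deg: "degree (q a b) = mm a b" if "a \<in> {1..m}" "b \<in> {1..M a}" for a b
  proof -
    have "K - M a + (b - 1) - (K - M a) + 1 = b" using that by auto
    thus ?thesis using dQ[OF that(1) kb[OF that]] by (simp add: q_def)
  qed
  have rec: "(\<Sum>i\<le>dim_U. chi i u * quasi_exp q x (u + of_nat i)) = 0" if "x \<in> dual_index" for x u
  proof -
    have x: "fst x \<in> {1..m}" "snd x \<in> {1..M (fst x)}" using that by auto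
    show ?thesis unfolding quasi_exp_def q_def
      by (rule integral_recurrence[OF x(1) fr[OF x(1)] kb[OF x] int[OF x(1) kb[OF x]]])
  qed
  show thesis by (rule that[OF deg span rec])
qed

end

locale dual_basis = bispectral_setting +
  fixes q :: "nat \<Rightarrow> nat \<Rightarrow> complex poly"
  assumes q_degree: "\<And>a b. a \<in> {1..m} \<Longrightarrow> b \<in> {1..M a} \<Longrightarrow> degree (q a b) = mm a b"
    and dual_space_span: "dual_space = cfun.span (quasi_exp q ` dual_index)"
    and quasi_exp_recurrence: "\<And>x u. x \<in> dual_index \<Longrightarrow> (\<Sum>i\<le>dim_U. chi i u * quasi_exp q x (u + of_nat i)) = 0"
begin

definition dual_enum :: "nat \<Rightarrow> nat \<times> nat" where "dual_enum = (SOME h. bij_betw h {..<dim_U} dual_index)"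
definition dual_gen :: "nat \<Rightarrow> complex \<Rightarrow> complex" where "dual_gen s = quasi_exp q (dual_enum s)"

lemma dual_enum: "bij_betw dual_enum {..<dim_U} dual_index"
proof -
  have "card dual_index = dim_U" by (simp add: dim_U_def)
  hence "\<exists>h. bij_betw h {..<dim_U} dual_index"
    using ex_bij_betw_nat_finite[of dual_index] by (auto simp: lessThan_atLeast0)
  thus ?thesis unfolding dual_enum_def by (rule someI_ex)
qed

lemma dual_space_eq: "dual_space = {f. \<exists>c. f = (\<lambda>u. \<Sum>s<dim_U. c s * dual_gen s u)}"
proof -
  have "quasi_exp q ` dual_index = dual_gen ` {..<dim_U}"
    using dual_enum unfolding bij_betw_def by (metis dual_gen_def image_cong image_image)
  thus ?thesis unfolding dual_space_span by (simp only:) (rule span_image_eq, simp)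
qed

text \<open>The generators remain independent on every progression \<open>\<mu>, \<mu> + 1, \<dots>\<close>. For distinct \<open>a\<close> this is the
  independence of exponential polynomials, and for one \<open>a\<close> the degrees are distinct.\<close>

lemma dual_gen_combination_zero:
  assumes "\<And>k::nat. (\<Sum>s<dim_U. c s * dual_gen s (\<mu> + of_nat k)) = 0"
  shows "\<forall>s<dim_U. c s = 0"
proof -
  define d where "d = (\<lambda>x. c (the_inv_into {..<dim_U} dual_enum x))"
  have inj: "inj_on dual_enum {..<dim_U}" using dual_enum by (simp add: bij_betw_def)
  have d: "d (dual_enum s) = c s" if "s < dim_U" for s
    using that by (simp add: d_def the_inv_into_f_f[OF inj])
  define Q where "Q = (\<lambda>a. \<Sum>b=1..M a. Polynomial.smult (d (a, b)) (q a b))"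
  have "(\<Sum>s<dim_U. c s * dual_gen s u) = (\<Sum>a=1..m. exp (u * l a) * poly (Q a) u)" for u
  proof -
    have "(\<Sum>s<dim_U. c s * dual_gen s u) = (\<Sum>s<dim_U. d (dual_enum s) * quasi_exp q (dual_enum s) u)"
      by (intro sum.cong refl) (simp add: d dual_gen_def)
    also have "\<dots> = (\<Sum>x\<in>dual_index. d x * quasi_exp q x u)"
      by (rule sum.reindex_bij_betw[OF dual_enum])
    also have "\<dots> = (\<Sum>a=1..m. \<Sum>b=1..M a. d (a, b) * quasi_exp q (a, b) u)"
      by (subst sum.Sigma) (auto simp: case_prod_beta)
    also have "\<dots> = (\<Sum>a=1..m. exp (u * l a) * poly (Q a) u)"
      by (intro sum.cong refl) (simp add: Q_def quasi_exp_def poly_sum sum_distrib_left mult_ac)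
    finally show ?thesis .
  qed
  hence *: "(\<Sum>a=1..m. exp ((\<mu> + of_nat k) * l a) * poly (Q a) (\<mu> + of_nat k)) = 0" for k
    using assms[of k] by simp
  have "\<forall>a\<in>{1..m}. Polynomial.smult (exp (\<mu> * l a)) (Q a \<circ>\<^sub>p [:\<mu>, 1:]) = 0"
  proof (rule exponential_polynomials_independent[of "{1..m}" z])
    fix k :: nat
    have "(\<Sum>a=1..m. z a ^ k * poly (Polynomial.smult (exp (\<mu> * l a)) (Q a \<circ>\<^sub>p [:\<mu>, 1:])) (of_nat k)) =
        (\<Sum>a=1..m. exp ((\<mu> + of_nat k) * l a) * poly (Q a) (\<mu> + of_nat k))"
    proof (intro sum.cong refl)
      fix a assume "a \<in> {1..m}"
      hence "exp ((\<mu> + of_nat k) * l a) = exp (\<mu> * l a) * z a ^ k"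
        using l[of a] by (simp add: distrib_right exp_add exp_of_nat_mult)
      thus "z a ^ k * poly (Polynomial.smult (exp (\<mu> * l a)) (Q a \<circ>\<^sub>p [:\<mu>, 1:])) (of_nat k) =
          exp ((\<mu> + of_nat k) * l a) * poly (Q a) (\<mu> + of_nat k)"
        by (simp add: poly_pcompose)
    qed
    thus "(\<Sum>a=1..m. z a ^ k * poly (Polynomial.smult (exp (\<mu> * l a)) (Q a \<circ>\<^sub>p [:\<mu>, 1:])) (of_nat k)) = 0"
      using * by simp
  qed (use z_inj z_nz in auto)
  hence Q0: "Q a = 0" if "a \<in> {1..m}" for a
    using that by (simp add: pcompose_eq_0_iff)
  have d0: "d (a, b) = 0" if "a \<in> {1..m}" "b \<in> {1..M a}" for a b
  proof -
    have "\<forall>b\<in>{1..M a}. d (a, b) = 0"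
    proof (rule distinct_degree_independent[of _ "q a"])
      show "inj_on (\<lambda>b. degree (q a b)) {1..M a}"
      proof -
        have "inj_on (mm a) {1..M a}"
          using dd_m that(1) unfolding degree_data_def by (auto intro: strict_mono_on_imp_inj_on)
        thus ?thesis using q_degree[OF that(1)] unfolding inj_on_def by metis
      qed
      show "q a b \<noteq> 0" if "b \<in> {1..M a}" for b
        using q_degree[OF \<open>a \<in> {1..m}\<close> that] mm_ge[OF \<open>a \<in> {1..m}\<close> that] that by auto
      show "(\<Sum>b\<in>{1..M a}. Polynomial.smult (d (a, b)) (q a b)) = 0"
        using Q0[OF that(1)] by (simp add: Q_def)
    qed simp
    thus ?thesis using that(2) by blast
  qed
  show ?thesis
  proof (intro allI impI)
    fix s assume s: "s < dim_U"
    hence "dual_enum s \<in> dual_index" using dual_enum by (auto simp: bij_betw_def)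
    thus "c s = 0" using d0[of "fst (dual_enum s)" "snd (dual_enum s)"] d[OF s] by auto
  qed
qed

lemma dual_space_zero:
  assumes "f \<in> dual_space" "\<And>k::nat. f (\<mu> + of_nat k) = 0"
  shows "f = (\<lambda>_. 0)"
proof -
  from assms(1) obtain c where c: "f = (\<lambda>u. \<Sum>s<dim_U. c s * dual_gen s u)" unfolding dual_space_eq by auto
  have "\<forall>s<dim_U. c s = 0" by (rule dual_gen_combination_zero) (use assms(2) in \<open>simp add: c\<close>)
  thus ?thesis unfolding c by simp
qed

lemma dual_space_recurrence:
  assumes "f \<in> dual_space"
  shows "(\<Sum>i\<le>dim_U. chi i u * f (u + of_nat i)) = 0"
proof -
  from assms obtain c where c: "f = (\<lambda>u. \<Sum>s<dim_U. c s * dual_gen s u)" unfolding dual_space_eq by auto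
  have "(\<Sum>i\<le>dim_U. chi i u * f (u + of_nat i)) = (\<Sum>s<dim_U. c s * (\<Sum>i\<le>dim_U. chi i u * dual_gen s (u + of_nat i)))"
    unfolding c sum_distrib_left by (subst sum.swap) (simp add: mult_ac)
  also have "\<dots> = 0"
  proof (intro sum.neutral ballI)
    fix s assume "s \<in> {..<dim_U}"
    hence "dual_enum s \<in> dual_index" using dual_enum by (auto simp: bij_betw_def)
    thus "c s * (\<Sum>i\<le>dim_U. chi i u * dual_gen s (u + of_nat i)) = 0" unfolding dual_gen_def by (simp only: quasi_exp_recurrence) simp
  qed
  finally show ?thesis .
qed

text \<open>Any \<open>dim_U\<close> points that separate the elements of the dual space are interpolation points.\<close>

lemma dual_space_interpolation:
  assumes "\<And>f. f \<in> dual_space \<Longrightarrow> (\<And>s. s < dim_U \<Longrightarrow> f (pt s) = 0) \<Longrightarrow> f = (\<lambda>_. 0)"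
  obtains f where "f \<in> dual_space" "\<And>s. s < dim_U \<Longrightarrow> f (pt s) = v s"
proof -
  obtain x where x: "\<And>s. s < dim_U \<Longrightarrow> (\<Sum>t<dim_U. dual_gen t (pt s) * x t) = v s"
  proof (rule square_solve[of dim_U "\<lambda>s t. dual_gen t (pt s)" v])
    fix c assume c: "\<And>s. s < dim_U \<Longrightarrow> (\<Sum>t<dim_U. dual_gen t (pt s) * c t) = 0"
    define f where "f = (\<lambda>u. \<Sum>t<dim_U. c t * dual_gen t u)"
    have "f = (\<lambda>_. 0)"
    proof (rule assms)
      show "f \<in> dual_space" unfolding dual_space_eq f_def by (intro CollectI exI) (rule refl)
      show "\<And>s. s < dim_U \<Longrightarrow> f (pt s) = 0" using c by (simp add: f_def mult.commute)
    qed
    hence "(\<Sum>t<dim_U. c t * dual_gen t (0 + of_nat k)) = 0" for k by (simp add: f_def fun_eq_iff)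
    thus "\<forall>t<dim_U. c t = 0" by (rule dual_gen_combination_zero)
  qed (rule that)
  show thesis
  proof (rule that[of "\<lambda>u. \<Sum>t<dim_U. x t * dual_gen t u"])
    show "(\<lambda>u. \<Sum>t<dim_U. x t * dual_gen t u) \<in> dual_space" unfolding dual_space_eq by (intro CollectI exI) (rule refl)
    show "\<And>s. s < dim_U \<Longrightarrow> (\<Sum>t<dim_U. x t * dual_gen t (pt s)) = v s" using x by (simp add: mult.commute)
  qed
qed

lemma dual_space_lincomb: "(\<And>s. s \<in> I \<Longrightarrow> f s \<in> dual_space) \<Longrightarrow> (\<lambda>u. \<Sum>s\<in>I. c s * f s u) \<in> dual_space"
proof -
  assume *: "\<And>s. s \<in> I \<Longrightarrow> f s \<in> dual_space"
  have "(\<lambda>u. \<Sum>s\<in>I. c s * f s u) = (\<Sum>s\<in>I. (\<lambda>u. c s * f s u))"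
    by (rule ext) (simp add: sum_fun_apply)
  also have "\<dots> \<in> dual_space" using * unfolding dual_space_span by (intro cfun.span_sum cfun.span_scale)
  finally show ?thesis .
qed

section \<open>Discrete exponents\<close>

definition dual_exponents :: "nat \<Rightarrow> nat list" where
  "dual_exponents i = [0..<dim_U - N i] @ map (\<lambda>j. dim_U - N i + nn i j) [1..<Suc (N i)]"

lemma dual_exponents_length: "i \<in> {1..n} \<Longrightarrow> length (dual_exponents i) = dim_U"
  using N_le_dim_U by (simp add: dual_exponents_def del: upt_Suc)

lemma dual_exponents_sorted: "i \<in> {1..n} \<Longrightarrow> sorted_wrt (<) (dual_exponents i)"
proof -
  assume i: "i \<in> {1..n}"
  have mono: "strict_mono_on {1..N i} (nn i)" using dd_n i by (simp add: degree_data_def)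
  have "sorted_wrt (\<lambda>x y. dim_U - N i + nn i x < dim_U - N i + nn i y) [1..<Suc (N i)]"
  proof (rule sorted_wrt_mono_rel[of _ "(<)"])
    fix x y assume "x \<in> set [1..<Suc (N i)]" "y \<in> set [1..<Suc (N i)]" "x < y"
    thus "dim_U - N i + nn i x < dim_U - N i + nn i y"
      using mono by (auto simp: strict_mono_on_def simp del: upt_Suc)
  qed (simp del: upt_Suc)
  thus ?thesis by (auto simp: dual_exponents_def sorted_wrt_append sorted_wrt_map simp del: upt_Suc)
qed

text \<open>Suppose that the first nonzero value occurs at distance \<open>c \<ge> dim_U - N i\<close> and put
  \<open>k = c - (dim_U - N i)\<close>. In the recurrence at \<open>\<lambda>\<^sub>i + k\<close> the values at the points before \<open>\<lambda>\<^sub>i + N\<^sub>i\<close> are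
  multiplied by zeros of \<open>chi\<close>, the values between this point and the first nonzero value vanish, and so
  the top coefficient has to vanish as well. Its zeros are known.\<close>

lemma first_nonzero:
  assumes i: "i \<in> {1..n}" and f: "f \<in> dual_space" "f \<noteq> (\<lambda>_. 0)"
  defines "\<mu> \<equiv> lam i + of_nat (N i)"
  obtains c where "c \<in> set (dual_exponents i)" "\<And>j. j < c \<Longrightarrow> f (\<mu> + of_nat j) = 0" "f (\<mu> + of_nat c) \<noteq> 0"
proof -
  define c where "c = (LEAST c. f (\<mu> + of_nat c) \<noteq> 0)"
  have "\<exists>c. f (\<mu> + of_nat c) \<noteq> 0" using dual_space_zero[OF f(1), of \<mu>] f(2) by blast
  hence c: "f (\<mu> + of_nat c) \<noteq> 0" unfolding c_def by (rule LeastI_ex)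
  have lt: "f (\<mu> + of_nat j) = 0" if "j < c" for j using not_less_Least[of j] that unfolding c_def by blast
  have N: "N i \<le> dim_U" by (rule N_le_dim_U[OF i])
  have "c \<in> set (dual_exponents i)"
  proof (cases "c < dim_U - N i")
    case False
    define k where "k = c - (dim_U - N i)"
    have k: "k + dim_U = N i + c" using False N by (simp add: k_def)
    let ?u = "lam i + of_nat k"
    have *: "(\<Sum>s\<le>dim_U. chi s ?u * f (?u + of_nat s)) = (\<Sum>s\<le>dim_U. if s = dim_U then chi dim_U ?u * f (\<mu> + of_nat c) else 0)"
    proof (intro sum.cong refl)
      fix s assume s: "s \<in> {..dim_U}"
      show "chi s ?u * f (?u + of_nat s) = (if s = dim_U then chi dim_U ?u * f (\<mu> + of_nat c) else 0)"
      proof (cases "s = dim_U")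
        case True
        have "?u + of_nat dim_U = lam i + of_nat (k + dim_U)" by simp
        also have "\<dots> = \<mu> + of_nat c" unfolding k by (simp add: \<mu>_def)
        finally have "?u + of_nat dim_U = \<mu> + of_nat c" .
        thus ?thesis using True by simp
      next
        case sne: False
        show ?thesis
        proof (cases "s + k < N i")
          case True
          thus ?thesis using chi_low_zero[OF i True] sne by simp
        next
          case F: False
          define j where "j = s + k - N i"
          have j: "s + k = N i + j" "j < c" using F s sne k by (auto simp: j_def)
          have "?u + of_nat s = lam i + of_nat (s + k)" by simp
          also have "\<dots> = \<mu> + of_nat j" unfolding j(1) by (simp add: \<mu>_def)
          finally have "?u + of_nat s = \<mu> + of_nat j" .
          thus ?thesis using lt[OF j(2)] sne by simp
        qed
      qed
    qed
    hence "chi dim_U ?u * f (\<mu> + of_nat c) = 0" using dual_space_recurrence[OF f(1), of ?u] by simp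
    hence "chi dim_U ?u = 0" using c by simp
    from chi_top_zeroD[OF i this] obtain j where j: "j \<in> {1..N i}" "k = nn i j" by auto
    have "c = dim_U - N i + nn i j" using j(2) False by (simp add: k_def)
    thus ?thesis using j(1) by (auto simp: dual_exponents_def simp del: upt_Suc)
  qed (simp add: dual_exponents_def)
  thus thesis using lt c by (rule that)
qed

text \<open>The candidates are as many as the dimension, and the values at them determine an element. Hence there is
  an element that takes the value \<open>1\<close> at one candidate and \<open>0\<close> at the others, and its first nonzero value is
  at that candidate.\<close>

lemma discrete_exponents_dual:
  assumes i: "i \<in> {1..n}"
  shows "discrete_exponents dual_space (lam i + of_nat (N i)) (dual_exponents i)"
proof -
  let ?\<mu> = "lam i + of_nat (N i)" and ?c = "\<lambda>s. dual_exponents i ! s"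
  have dist: "distinct (dual_exponents i)" using dual_exponents_sorted[OF i] by (simp add: strict_sorted_iff)
  have zero: "f = (\<lambda>_. 0)" if fU: "f \<in> dual_space" and fz: "\<And>s. s < dim_U \<Longrightarrow> f (?\<mu> + of_nat (?c s)) = 0" for f
  proof (rule ccontr)
    assume "f \<noteq> (\<lambda>_. 0)"
    then obtain c where "c \<in> set (dual_exponents i)" "f (?\<mu> + of_nat c) \<noteq> 0"
      by (rule first_nonzero[OF i fU]) (rule that)
    thus False using fz dual_exponents_length[OF i] by (metis in_set_conv_nth)
  qed
  have "\<forall>s. \<exists>f. f \<in> dual_space \<and> (\<forall>t<dim_U. f (?\<mu> + of_nat (?c t)) = (if t = s then 1 else 0))"
  proof
    fix s
    obtain f where "f \<in> dual_space" "\<And>t. t < dim_U \<Longrightarrow> f (?\<mu> + of_nat (?c t)) = (if t = s then 1 else 0)"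
      by (rule dual_space_interpolation[of "\<lambda>t. ?\<mu> + of_nat (?c t)" "\<lambda>t. if t = s then 1 else 0"])
         (use zero in blast, rule that)
    thus "\<exists>f. f \<in> dual_space \<and> (\<forall>t<dim_U. f (?\<mu> + of_nat (?c t)) = (if t = s then 1 else 0))" by auto
  qed
  from choice[OF this] obtain f where f0: "\<forall>s. f s \<in> dual_space \<and> (\<forall>t<dim_U. f s (?\<mu> + of_nat (?c t)) = (if t = s then 1 else 0))"
    by (elim exE) (rule that)
  have fU: "f s \<in> dual_space" and fv: "t < dim_U \<Longrightarrow> f s (?\<mu> + of_nat (?c t)) = (if t = s then 1 else 0)" for s t
    using f0 by auto
  have comb: "(\<Sum>s<dim_U. c s * f s (?\<mu> + of_nat (?c t))) = c t" if "t < dim_U" for c t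
  proof -
    have "(\<Sum>s<dim_U. c s * f s (?\<mu> + of_nat (?c t))) = (\<Sum>s<dim_U. if s = t then c t else 0)"
      by (intro sum.cong refl) (simp add: fv[OF that])
    thus ?thesis using that by simp
  qed
  have "basis_list dual_space (map f [0..<dim_U])"
  proof (rule basis_listI)
    fix c assume "\<And>w. (\<Sum>k<dim_U. c k * f k w) = 0"
    thus "\<forall>k<dim_U. c k = 0" using comb[of _ c] by simp
  next
    show "dual_space = {g. \<exists>c. g = (\<lambda>w. \<Sum>k<dim_U. c k * f k w)}"
    proof
      show "{g. \<exists>c. g = (\<lambda>w. \<Sum>k<dim_U. c k * f k w)} \<subseteq> dual_space" using fU by (auto intro!: dual_space_lincomb)
      show "dual_space \<subseteq> {g. \<exists>c. g = (\<lambda>w. \<Sum>k<dim_U. c k * f k w)}"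
      proof
        fix g assume g: "g \<in> dual_space"
        define c where "c = (\<lambda>s. g (?\<mu> + of_nat (?c s)))"
        have "(\<lambda>u. g u - (\<Sum>k<dim_U. c k * f k u)) = (\<lambda>_. 0)"
        proof (rule zero)
          have "(\<lambda>u. \<Sum>k<dim_U. c k * f k u) \<in> dual_space" using fU by (intro dual_space_lincomb)
          hence "g - (\<lambda>u. \<Sum>k<dim_U. c k * f k u) \<in> dual_space"
            using g unfolding dual_space_span by (intro cfun.span_diff)
          thus "(\<lambda>u. g u - (\<Sum>k<dim_U. c k * f k u)) \<in> dual_space" by (simp add: fun_diff_def)
        qed (simp add: comb c_def)
        hence "g = (\<lambda>u. \<Sum>k<dim_U. c k * f k u)" by (simp add: fun_eq_iff)
        thus "g \<in> {g. \<exists>c. g = (\<lambda>w. \<Sum>k<dim_U. c k * f k w)}" by (intro CollectI exI)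
      qed
    qed
  qed
  moreover have "(\<forall>j<?c s. f s (?\<mu> + of_nat j) = 0) \<and> f s (?\<mu> + of_nat (?c s)) \<noteq> 0" if s: "s < dim_U" for s
  proof -
    have "f s \<noteq> (\<lambda>_. 0)" using fv[OF s, of s] by auto
    then obtain c where c: "c \<in> set (dual_exponents i)" "\<And>j. j < c \<Longrightarrow> f s (?\<mu> + of_nat j) = 0" "f s (?\<mu> + of_nat c) \<noteq> 0"
      by (rule first_nonzero[OF i fU]) (rule that)
    then obtain t where t: "t < dim_U" "c = ?c t" using dual_exponents_length[OF i] by (metis in_set_conv_nth)
    hence "t = s" using fv[OF t(1), of s] c(3) by (auto split: if_splits)
    thus ?thesis using c(2,3) t(2) by simp
  qed
  ultimately show ?thesis
    unfolding discrete_exponents_def using dual_exponents_sorted[OF i] dual_exponents_length[OF i]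
    by (intro conjI exI[of _ "map f [0..<dim_U]"]) auto
qed

lemma quasi_exponentials_dual: "quasi_exponentials dual_space m M mm z l n N nn (\<lambda>i. lam i + of_nat (N i))"
  unfolding quasi_exponentials_def
proof (intro conjI)
  show "1 \<le> m" by (rule m_pos)
  show "1 \<le> n" by (rule n1)
  show "degree_data m M mm" by (rule dd_m)
  show "inj_on z {1..m}" by (rule z_inj)
  show "\<forall>a\<in>{1..m}. z a \<noteq> 0 \<and> exp (l a) = z a" using z_nz l by auto
  show "\<exists>q :: nat \<Rightarrow> nat \<Rightarrow> complex poly.
        (\<forall>a\<in>{1..m}. \<forall>b\<in>{1..M a}. degree (q a b) = mm a b) \<and>
        dual_space = cfun.span {\<lambda>u. exp (u * l a) * poly (q a b) u | a b. a \<in> {1..m} \<and> b \<in> {1..M a}}"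
  proof (intro exI[of _ q] conjI)
    show "\<forall>a\<in>{1..m}. \<forall>b\<in>{1..M a}. degree (q a b) = mm a b" using q_degree by blast
    have "quasi_exp q ` dual_index = {\<lambda>u. exp (u * l a) * poly (q a b) u | a b. a \<in> {1..m} \<and> b \<in> {1..M a}}"
      by (force simp: quasi_exp_def fun_eq_iff)
    thus "dual_space = cfun.span {\<lambda>u. exp (u * l a) * poly (q a b) u | a b. a \<in> {1..m} \<and> b \<in> {1..M a}}"
      using dual_space_span by simp
  qed
  show "non_resonant n (\<lambda>i. lam i + of_nat (N i))"
    unfolding non_resonant_def
  proof (intro ballI impI notI)
    fix i j assume ij: "i \<in> {1..n}" "j \<in> {1..n}" "i \<noteq> j"
      and "lam i + of_nat (N i) - (lam j + of_nat (N j)) \<in> \<int>"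
    moreover have "of_nat (N j) - of_nat (N i) \<in> (\<int> :: complex set)" by (intro Ints_diff Ints_of_nat)
    ultimately have "(lam i + of_nat (N i) - (lam j + of_nat (N j))) + (of_nat (N j) - of_nat (N i)) \<in> \<int>"
      by (intro Ints_add)
    hence "lam i - lam j \<in> \<int>" by (simp add: algebra_simps)
    thus False using nr ij by (simp add: non_resonant_def)
  qed
  show "degree_data n N nn" by (rule dd_n)
  show "\<forall>i\<in>{1..n}. N i \<le> sum M {1..m} \<and> discrete_exponents dual_space (lam i + of_nat (N i))
      ([0..<sum M {1..m} - N i] @ map (\<lambda>j. sum M {1..m} - N i + nn i j) [1..<Suc (N i)])"
    using N_le_dim_U discrete_exponents_dual unfolding dual_exponents_def dim_U_def by blast
qed

section \<open>Minimality of the difference operator\<close>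

text \<open>The excluded points form a countable set.\<close>

lemma generic_point:
  assumes "E \<noteq> 0"
  obtains u where "poly E u \<noteq> 0" "\<And>k::nat. chi dim_U (u + of_nat k) \<noteq> 0"
proof (rule ccontr)
  assume contr: "\<not> thesis"
  let ?B = "\<Union>k\<in>{..<K}. range (\<lambda>t::nat. L k + of_nat (gen_degree k) - of_nat t)"
  have "u \<in> {x. poly E x = 0} \<union> ?B" for u
  proof (rule ccontr)
    assume u: "u \<notin> {x. poly E x = 0} \<union> ?B"
    have "chi dim_U (u + of_nat t) \<noteq> 0" for t
    proof
      assume "chi dim_U (u + of_nat t) = 0"
      then obtain k where "k < K" "u + of_nat t = L k + of_nat (gen_degree k)" by (auto simp: chi_top_zero_iff)
      hence "u = L k + of_nat (gen_degree k) - of_nat t" "k \<in> {..<K}" by (auto simp: algebra_simps)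
      thus False using u by blast
    qed
    thus False using contr that u by blast
  qed
  hence "(UNIV :: complex set) = {x. poly E x = 0} \<union> ?B" by blast
  moreover have "countable ({x. poly E x = 0} \<union> ?B)"
    using poly_roots_finite[OF assms] by (intro countable_Un countable_UN) (auto intro: countable_finite)
  ultimately show False using uncountable_UNIV_complex by simp
qed

text \<open>At a generic point \<open>u\<close> the recurrence propagates zeros at \<open>u, \<dots>, u + dim_U - 1\<close> to all \<open>u + k\<close>.
  Hence the values at these \<open>dim_U\<close> points can be prescribed arbitrarily, and each coefficient of the
  operator vanishes at \<open>u\<close>.\<close>

lemma no_lower_order:
  assumes "\<And>f u. f \<in> dual_space \<Longrightarrow> (\<Sum>i<dim_U. poly (E i) u * f (u + of_nat i)) = 0" "j < dim_U"
  shows "E j = 0"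
proof (rule ccontr)
  assume "E j \<noteq> 0"
  then obtain u where u: "poly (E j) u \<noteq> 0" "\<And>k::nat. chi dim_U (u + of_nat k) \<noteq> 0"
    by (rule generic_point) (rule that)
  obtain f where f: "f \<in> dual_space" "\<And>s. s < dim_U \<Longrightarrow> f (u + of_nat s) = (if s = j then 1 else 0)"
  proof (rule dual_space_interpolation[of "\<lambda>s. u + of_nat s" "\<lambda>s. if s = j then 1 else 0"])
    fix f assume f: "f \<in> dual_space" "\<And>s. s < dim_U \<Longrightarrow> f (u + of_nat s) = 0"
    have "f (u + of_nat k) = 0" for k
    proof (induction k rule: less_induct)
      case (less k)
      show ?case
      proof (cases "k < dim_U")
        case False
        define v where "v = u + of_nat (k - dim_U)"
        have v: "v + of_nat i = u + of_nat (k - dim_U + i)" for i by (simp add: v_def)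
        have "0 = (\<Sum>i\<le>dim_U. chi i v * f (v + of_nat i))" using dual_space_recurrence[OF f(1)] by simp
        also have "\<dots> = (\<Sum>i\<le>dim_U. if i = dim_U then chi dim_U v * f (u + of_nat k) else 0)"
        proof (intro sum.cong refl)
          fix i assume "i \<in> {..dim_U}"
          thus "chi i v * f (v + of_nat i) = (if i = dim_U then chi dim_U v * f (u + of_nat k) else 0)"
            unfolding v using False less[of "k - dim_U + i"] by auto
        qed
        finally have "chi dim_U v * f (u + of_nat k) = 0" by simp
        moreover have "chi dim_U v \<noteq> 0" unfolding v_def by (rule u(2))
        ultimately show ?thesis by simp
      qed (use f(2) in simp)
    qed
    thus "f = (\<lambda>_. 0)" by (rule dual_space_zero[OF f(1)])
  qed (rule that)
  have "(\<Sum>i<dim_U. poly (E i) u * f (u + of_nat i)) = (\<Sum>i<dim_U. if i = j then poly (E j) u else 0)"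
    by (intro sum.cong refl) (simp add: f(2))
  hence "poly (E j) u = 0" using assms(1)[OF f(1), of u] assms(2) by simp
  thus False using u(1) by simp
qed

text \<open>Otherwise the operator annihilates \<open>x\<close> to the power \<open>\<lambda>\<^sub>i + n\<^sub>i\<^sub>j\<close>. Uniqueness for the initial value problem
  at a regular point then puts this function into \<open>V\<close>, contrary to nondegeneracy at infinity.\<close>

lemma power_not_killed:
  assumes "k < K"
  shows "\<exists>i\<le>dim_U. chi i (L k + of_nat (gen_degree k)) \<noteq> 0"
proof (rule ccontr)
  assume contr: "\<not> ?thesis"
  let ?s = "L k + of_nat (gen_degree k)"
  define y where "y = (\<lambda>w. exp (?s * w))"
  have y: "y holomorphic_on UNIV" unfolding y_def by (intro holomorphic_intros)
  have Dy: "theta_op A y w = 0" for w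
    unfolding y_def theta_op_exp using contr by (intro sum.neutral) auto
  obtain w0 where w0: "exp w0 \<notin> z ` {1..m}" by (rule exists_regular_point)
  have W: "ndet K (\<lambda>r k. (deriv ^^ r) (G k) w0) \<noteq> 0"
    using wronskian_G_regular[OF w0] by (simp add: wronskian_def)
  obtain c where c: "\<And>r. r < K \<Longrightarrow> (\<Sum>k<K. (deriv ^^ r) (G k) w0 * c k) = (deriv ^^ r) y w0"
    by (rule ndet_solve[OF W, of "\<lambda>r. (deriv ^^ r) y w0"]) (rule that)
  define g where "g = (\<lambda>w. \<Sum>k<K. c k * G k w)"
  have gV: "g \<in> V" unfolding g_def V_eq by (intro CollectI exI) (rule refl)
  have g: "g holomorphic_on UNIV" by (rule V_entire[OF gV])
  have gd: "(deriv ^^ r) g w = (\<Sum>k<K. (deriv ^^ r) (G k) w * c k)" for r w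
    unfolding g_def by (subst higher_deriv_lincomb) (auto intro: G_entire simp: mult.commute)
  have Hd: "(deriv ^^ r) (\<lambda>w. y w - g w) = (\<lambda>w. (deriv ^^ r) y w - (deriv ^^ r) g w)" for r
    by (rule ext) (rule higher_deriv_diff[OF y g open_UNIV UNIV_I])
  have "(\<lambda>w. y w - g w) = (\<lambda>_. 0)"
  proof (rule linear_ode_unique[where N = K and a = "\<lambda>j w. poly (A j) (exp w)" and c = w0])
    show "\<And>j. j \<le> K \<Longrightarrow> continuous_on UNIV (\<lambda>w. poly (A j) (exp w))" by (intro continuous_intros)
    show "poly (A K) (exp w0) \<noteq> 0" using sing_poly_nz[OF w0] A_lead by simp
    show "(\<lambda>w. y w - g w) holomorphic_on UNIV" by (intro holomorphic_intros y g)
    show "(\<Sum>j\<le>K. poly (A j) (exp w) * (deriv ^^ j) (\<lambda>w. y w - g w) w) = 0" for w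
      using Dy[of w] annihilating_V[OF A_annihilating gV, of w]
      by (simp add: Hd theta_op_def right_diff_distrib sum_subtractf)
    show "(deriv ^^ r) (\<lambda>w. y w - g w) w0 = 0" if "r < K" for r
      by (simp add: Hd gd c[OF that])
  qed
  hence "y = g" by (simp add: fun_eq_iff)
  hence "y \<in> V" using gV by simp
  moreover have "y \<notin> V"
    using nondeg ix_range[OF assms] unfolding nondegenerate_quasi_polynomials_def y_def L_def gen_degree_def by blast
  ultimately show False by simp
qed

text \<open>Eliminating the leading terms of two operators of order \<open>dim_U\<close> leaves an operator of lower order,
  which is zero. So they are proportional, and the zeros of the leading coefficient \<open>chi_poly dim_U\<close> cannot be
  cancelled because they are simple and not common to all coefficients.\<close>

lemma regularized_difference: "regularized_difference_operator dual_space dim_U chi_poly"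
proof -
  have ann: "annihilating_difference_operator dual_space dim_U chi_poly"
    unfolding annihilating_difference_operator_def poly_chi_poly using dual_space_recurrence by blast
  have "K \<le> degree (C dim_U)"
    if C: "annihilating_difference_operator dual_space dim_U C" "lead_coeff (C dim_U) = 1" for C
  proof (rule ccontr)
    assume "\<not> K \<le> degree (C dim_U)"
    have nz: "C dim_U \<noteq> 0" using C(2) by auto
    define E where "E = (\<lambda>i. C i * chi_poly dim_U - chi_poly i * C dim_U)"
    have E0: "E i = 0" if "i \<le> dim_U" for i
    proof (cases "i = dim_U")
      case False
      show ?thesis
      proof (rule no_lower_order)
        fix f u assume f: "f \<in> dual_space"
        have "(\<Sum>i\<le>dim_U. poly (E i) u * f (u + of_nat i)) =
            poly (chi_poly dim_U) u * (\<Sum>i\<le>dim_U. poly (C i) u * f (u + of_nat i)) -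
            poly (C dim_U) u * (\<Sum>i\<le>dim_U. poly (chi_poly i) u * f (u + of_nat i))"
          unfolding sum_distrib_left sum_subtractf[symmetric]
          by (intro sum.cong refl) (simp add: E_def algebra_simps)
        also have "\<dots> = 0" using ann C(1) f by (simp add: annihilating_difference_operator_def)
        finally have "(\<Sum>i\<le>dim_U. poly (E i) u * f (u + of_nat i)) = 0" .
        moreover have "E dim_U = 0" by (simp add: E_def)
        ultimately show "(\<Sum>i<dim_U. poly (E i) u * f (u + of_nat i)) = 0"
          by (simp add: lessThan_Suc_atMost[symmetric])
      qed (use that False in simp)
    qed (simp add: E_def)
    have "\<exists>k<K. poly (C dim_U) (L k + of_nat (gen_degree k)) \<noteq> 0"
    proof (rule ccontr)
      assume "\<not> ?thesis"
      hence "(\<lambda>k. L k + of_nat (gen_degree k)) ` {..<K} \<subseteq> {x. poly (C dim_U) x = 0}" by auto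
      hence "card ((\<lambda>k. L k + of_nat (gen_degree k)) ` {..<K}) \<le> card {x. poly (C dim_U) x = 0}"
        by (intro card_mono poly_roots_finite nz)
      also have "\<dots> \<le> degree (C dim_U)" by (rule card_poly_roots_bound[OF nz])
      finally show False using \<open>\<not> K \<le> degree (C dim_U)\<close> by (simp add: card_image[OF top_exponents_inj])
    qed
    then obtain k where k: "k < K" "poly (C dim_U) (L k + of_nat (gen_degree k)) \<noteq> 0" by auto
    have "chi i (L k + of_nat (gen_degree k)) = 0" if "i \<le> dim_U" for i
    proof -
      have "poly (E i) (L k + of_nat (gen_degree k)) = 0" using E0[OF that] by simp
      thus ?thesis using k by (simp add: E_def poly_chi_poly chi_top_root)
    qed
    thus False using power_not_killed[OF k(1)] by auto
  qed
  thus ?thesis unfolding regularized_difference_operator_def using ann chi_poly_lead by auto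
qed

end

section \<open>The duality theorem\<close>

lemma regularized_difference_operator_cong:
  assumes "\<And>i. i \<le> k \<Longrightarrow> C i = C' i" "regularized_difference_operator U k C"
  shows "regularized_difference_operator U k C'"
proof -
  have "annihilating_difference_operator U k C = annihilating_difference_operator U k C'"
    using assms(1) by (simp add: annihilating_difference_operator_def)
  thus ?thesis using assms by (simp add: regularized_difference_operator_def)
qed

lemma (in bispectral_setting) dual_theorem:
  "quasi_exponentials dual_space m M mm z l n N nn (\<lambda>i. lam i + of_nat (N i))"
  "regularized_difference_operator dual_space dim_U chi_poly"
proof -
  obtain q where q: "\<And>a b. a \<in> {1..m} \<Longrightarrow> b \<in> {1..M a} \<Longrightarrow> degree (q a b) = mm a b"
    "dual_space = cfun.span (quasi_exp q ` dual_index)"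
    "\<And>x u. x \<in> dual_index \<Longrightarrow> (\<Sum>i\<le>dim_U. chi i u * quasi_exp q x (u + of_nat i)) = 0"
    by (rule dual_structure) (rule that)
  interpret dual_basis V p n N nn lam m M mm z l r A q
    by unfold_locales (fact q)+
  show "quasi_exponentials dual_space m M mm z l n N nn (\<lambda>i. lam i + of_nat (N i))"
    by (rule quasi_exponentials_dual)
  show "regularized_difference_operator dual_space dim_U chi_poly"
    by (rule regularized_difference)
qed

theorem theorem4p1:
  fixes V U :: "(complex \<Rightarrow> complex) set"
    and n m :: nat
    and N M :: "nat \<Rightarrow> nat"
    and nn mm :: "nat \<Rightarrow> nat \<Rightarrow> nat"
    and lam z l :: "nat \<Rightarrow> complex"
    and p :: "nat \<Rightarrow> nat \<Rightarrow> complex poly"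
    and r :: "nat \<Rightarrow> real"
  assumes "quasi_polynomials V p n N nn lam m M mm z"
    and "nondegenerate_quasi_polynomials V p n N nn lam"
    and "\<forall>a\<in>{1..m}. exp (l a) = z a"
    and "small_radii m z r"
    and "U = bispectral_dual V (sum N {1..n}) m M z l r"
  shows "quasi_exponentials U m M mm z l n N nn (\<lambda>i. lam i + of_nat (N i)) \<and>
     nondegenerate_quasi_exponentials U m M mm n N nn \<and>
     (\<exists>A :: nat \<Rightarrow> nat \<Rightarrow> complex. regularized_diff_operator V (sum N {1..n}) m M z
        (\<lambda>f w. \<Sum>i\<le>sum M {1..m}. \<Sum>j\<le>sum N {1..n}. A i j * exp w ^ i * (xddx ^^ j) f w)) \<and>
     (\<forall>A :: nat \<Rightarrow> nat \<Rightarrow> complex. regularized_diff_operator V (sum N {1..n}) m M z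
        (\<lambda>f w. \<Sum>i\<le>sum M {1..m}. \<Sum>j\<le>sum N {1..n}. A i j * exp w ^ i * (xddx ^^ j) f w) \<longrightarrow>
        regularized_difference_operator U (sum M {1..m})
          (\<lambda>i. \<Sum>j\<le>sum N {1..n}. Polynomial.monom (A i j) j))"
proof -
  interpret qp_space V p n N nn lam m M mm z
    using assms(1,2) by unfold_locales
  have U: "U = bispectral_dual V K m M z l r" using assms(5) by (simp add: K_def)
  \<comment> \<open>\<open>poly_of B j\<close> is the coefficient of \<open>(x d/dx)\<^sup>j\<close>, a polynomial in \<open>x\<close>\<close>
  define poly_of where "poly_of = (\<lambda>(B :: nat \<Rightarrow> nat \<Rightarrow> complex) j. \<Sum>i\<le>dim_U. monom (B i j) i)"
  have D: "(\<lambda>f w. \<Sum>i\<le>dim_U. \<Sum>j\<le>K. B i j * exp w ^ i * (xddx ^^ j) f w) = theta_op (poly_of B)" for B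
  proof (intro ext)
    fix f w
    have "(\<Sum>i\<le>dim_U. \<Sum>j\<le>K. B i j * exp w ^ i * (xddx ^^ j) f w) =
        (\<Sum>j\<le>K. \<Sum>i\<le>dim_U. B i j * exp w ^ i * (deriv ^^ j) f w)"
      using xddx_eq_deriv by (subst sum.swap) (simp add: ext[of xddx deriv])
    also have "\<dots> = theta_op (poly_of B) f w"
      by (simp add: theta_op_def poly_of_def poly_sum poly_monom sum_distrib_right)
    finally show "(\<Sum>i\<le>dim_U. \<Sum>j\<le>K. B i j * exp w ^ i * (xddx ^^ j) f w) = theta_op (poly_of B) f w" .
  qed
  have setting: "bispectral_setting V p n N nn lam m M mm z l r (poly_of B)"
    if "poly_of B K = sing_poly" "annihilating (poly_of B)" for B
  proof unfold_locales
    show "degree (poly_of B j) \<le> dim_U" for j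
      unfolding poly_of_def by (rule degree_sum_le) (auto intro: order_trans[OF degree_monom_le])
  qed (use assms(3,4) that in auto)
  obtain A0 where A0: "\<And>j. j \<le> K \<Longrightarrow> degree (A0 j) \<le> dim_U" "A0 K = sing_poly"
    "\<And>k. k < K \<Longrightarrow> (\<Sum>j\<le>K. A0 j * (twisted_theta (L k) ^^ j) (gen_poly k)) = 0"
    by (rule operator_exists) (rule that)
  define B0 where "B0 = (\<lambda>i j. coeff (A0 j) i)"
  have "poly_of B0 j = A0 j" if "j \<le> K" for j
    unfolding poly_of_def B0_def by (rule poly_as_sum_of_monoms'[OF A0(1)[OF that]])
  hence B0: "poly_of B0 K = sing_poly" "annihilating (poly_of B0)"
    using A0(2,3) by (simp_all add: annihilating_def)
  interpret B0: bispectral_setting V p n N nn lam m M mm z l r "poly_of B0"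
    by (rule setting[OF B0])
  have 1: "quasi_exponentials U m M mm z l n N nn (\<lambda>i. lam i + of_nat (N i))"
    unfolding U by (rule B0.dual_theorem(1))
  have 2: "nondegenerate_quasi_exponentials U m M mm n N nn"
    unfolding nondegenerate_quasi_exponentials_def U
    using numerically_nondegenerate_V B0.dual_theorem(2) B0.chi_poly_lead(1) unfolding dim_U_def K_def by blast
  have 3: "regularized_diff_operator V K m M z
        (\<lambda>f w. \<Sum>i\<le>dim_U. \<Sum>j\<le>K. B0 i j * exp w ^ i * (xddx ^^ j) f w)"
    unfolding D by (rule regularized_of_annihilating[OF B0])
  have 4: "regularized_difference_operator U dim_U (\<lambda>i. \<Sum>j\<le>K. monom (B i j) j)"
    if "regularized_diff_operator V K m M z
        (\<lambda>f w. \<Sum>i\<le>dim_U. \<Sum>j\<le>K. B i j * exp w ^ i * (xddx ^^ j) f w)" for B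
  proof -
    have "regularized_diff_operator V K m M z (theta_op (poly_of B))" using that unfolding D .
    note k = annihilating_of_regularized[OF this]
    interpret B: bispectral_setting V p n N nn lam m M mm z l r "poly_of B"
      by (rule setting[OF k])
    show ?thesis
    proof (rule regularized_difference_operator_cong)
      show "regularized_difference_operator U dim_U B.chi_poly" unfolding U by (rule B.dual_theorem(2))
      fix i assume "i \<le> dim_U"
      hence "coeff (poly_of B j) i = B i j" for j by (simp add: poly_of_def coeff_sum)
      thus "B.chi_poly i = (\<Sum>j\<le>K. monom (B i j) j)" by (simp add: B.chi_poly_def)
    qed
  qed
  show ?thesis
    using 1 2 3 4 unfolding dim_U_def K_def by blast
qed

end
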